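(* Let $(X,m)$ and $(Y,n)$ be standard measure spaces, $\mathcal{H}_1=L^2(X,m)$, $\mathcal{H}_2=L^2(Y,n)$, and let $\mathcal{D}_1$ and $\mathcal{D}_2$ be the multiplication masas on $\mathcal{H}_1$ and $\mathcal{H}_2$. Then an ultraweakly closed normalizing $\mathcal{D}_2,\mathcal{D}_1$-bimodule $\mathcal{U}\subseteq\mathcal{B}(\mathcal{H}_1,\mathcal{H}_2)$ is thin if and only if there exists an almost one-to-one and onto Borel function $f:X\to Y$ which preserves null sets, such that $\mathcal{U}=\mathcal{M}_{max}(\kappa)$, where $\kappa=\{(x,f(x)):x\in X\}$ is the graph of $f$.
   Context: The multiplication masas are the algebras of multiplication operators by functions in $L^\infty(X,m)$ and $L^\infty(Y,n)$; a masa is a maximal abelian selfadjoint algebra. A Borel function $f:X\to Y$ preserves null sets if $f^{-1}(\beta)$ is null whenever $\beta\subseteq Y$ is null. "Almost" means up to null sets. A $\mathcal{D}_2,\mathcal{D}_1$-bimodule (masa-bimodule) is a subspace $\mathcal{U}\subseteq\mathcal{B}(\mathcal{H}_1,\mathcal{H}_2)$ with $\mathcal{D}_2\mathcal{U}\mathcal{D}_1\subseteq\mathcal{U}$. $P(\alpha)$ denotes the projection of multiplication by the characteristic function of a Borel set $\alpha$. A subset of $X\times Y$ is marginally null if it is contained in $(M\times Y)\cup(X\times N)$ with $M\subseteq X$, $N\subseteq Y$ null sets. For a Borel set $\kappa\subseteq X\times Y$ whose complement is a union of Borel rectangles, $\mathcal{M}_{max}(\kappa)$ is the set of operators $T\in\mathcal{B}(\mathcal{H}_1,\mathcal{H}_2)$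 supported on $\kappa$, i.e. with $P(\beta)TP(\alpha)=0$ for each Borel rectangle $\alpha\times\beta$ whose intersection with $\kappa$ is marginally null. Let $\mathcal{P}_i$ be the lattice of orthogonal projections on $\mathcal{H}_i$. $\mathrm{Map}\,\mathcal{U}:\mathcal{P}_1\to\mathcal{P}_2$ sends $P$ to the projection onto the closed linear span of $\{Sx:S\in\mathcal{U},x\in P\mathcal{H}_1\}$. For a map $\varphi:\mathcal{P}_1\to\mathcal{P}_2$ preserving $0$ and arbitrary suprema, put $\mathcal{S}_{1\varphi}=\{\bigvee\{P\in\mathcal{P}_1:\varphi(P)\le Q\}:Q\in\mathcal{P}_2\}$; $\varphi$ is an ortho-map if $\varphi(L)\perp\varphi(L^\perp)$ for each $L\in\mathcal{S}_{1\varphi}$. An ultraweakly closed masa-bimodule $\mathcal{U}$ is normalizing if $\mathrm{Map}\,\mathcal{U}$ is an ortho-map; such bimodules are known to be reflexive, where $\mathcal{U}$ is reflexive if $\mathcal{U}=\{T:\varphi(P)^\perp TP=0\ \text{for all }P\in\mathcal{P}_1\}$ for some map $\varphi:\mathcal{P}_1\to\mathcal{P}_2$ preserving $0$ and arbitrary suprema. A reflexive $\mathcal{D}_2,\mathcal{D}_1$-bimodule $\mathcal{U}$ is thin if the biggest algebras over which it is a bimodule are the masas, i.e. $\{A\in\mathcal{B}(\mathcal{H}_1):\mathcal{U}A\subseteq\mathcal{U}\}=\mathcal{D}_1$ and $\{B\in\mathcal{B}(\mathcal{H}_2):B\mathcal{U}\subseteq\mathcal{U}\}=\mathcal{D}_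2$.
   Formalization: Excludes U={0} when H1 and H2 both have dimension at most 1 (one-atom spaces with U={0} are a counterexample); "almost onto" means that f(X\A) misses only a null set of Y for every null set A in X, since otherwise the "if" direction fails. *)

theory Defs
  imports "HOL-Analysis.Analysis"
begin

definition standard_measure_space :: "'a measure \<Rightarrow> bool" where
  "standard_measure_space M \<longleftrightarrow> sigma_finite_measure M \<and>
     (\<exists>T. completely_metrizable_space T \<and> second_countable T \<and> topspace T = space M \<and>
          sets M = sigma_sets (space M) {V. openin T V})"


section \<open>The Hilbert space of square integrable functions\<close>

text \<open>A vector is an almost everywhere equality class of measurable functions; operations on
  classes are computed on an arbitrary representative.\<close>

type_synonym 'a vec = "('a \<Rightarrow> complex) set"
type_synonym ('a, 'b) oper = "'a vec \<Rightarrow> 'b vec"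

definition ae_class :: "'a measure \<Rightarrow> ('a \<Rightarrow> complex) \<Rightarrow> 'a vec" where
  "ae_class M f = {g \<in> borel_measurable M. AE x in M. g x = f x}"

definition rep :: "'a vec \<Rightarrow> 'a \<Rightarrow> complex" where
  "rep F = (SOME f. f \<in> F)"

definition L2 :: "'a measure \<Rightarrow> 'a vec set" where
  "L2 M = ae_class M ` {f \<in> borel_measurable M. integrable M (\<lambda>x. (cmod (f x))\<^sup>2)}"

definition l2_zero :: "'a measure \<Rightarrow> 'a vec" where
  "l2_zero M = ae_class M (\<lambda>_. 0)"

definition l2_add :: "'a measure \<Rightarrow> 'a vec \<Rightarrow> 'a vec \<Rightarrow> 'a vec" where
  "l2_add M F G = ae_class M (\<lambda>x. rep F x + rep G x)"

definition l2_diff :: "'a measure \<Rightarrow> 'a vec \<Rightarrow> 'a vec \<Rightarrow> 'a vec" where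
  "l2_diff M F G = ae_class M (\<lambda>x. rep F x - rep G x)"

definition l2_scale :: "'a measure \<Rightarrow> complex \<Rightarrow> 'a vec \<Rightarrow> 'a vec" where
  "l2_scale M c F = ae_class M (\<lambda>x. c * rep F x)"

definition l2_inner :: "'a measure \<Rightarrow> 'a vec \<Rightarrow> 'a vec \<Rightarrow> complex" where
  "l2_inner M F G = (LINT x|M. rep F x * cnj (rep G x))"

definition l2_norm :: "'a measure \<Rightarrow> 'a vec \<Rightarrow> real" where
  "l2_norm M F = sqrt (LINT x|M. (cmod (rep F x))\<^sup>2)"

definition l2_closed_subspace :: "'a measure \<Rightarrow> 'a vec set \<Rightarrow> bool" where
  "l2_closed_subspace M V \<longleftrightarrow> V \<subseteq> L2 M \<and> l2_zero M \<in> V \<and>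
     (\<forall>F\<in>V. \<forall>G\<in>V. l2_add M F G \<in> V) \<and> (\<forall>c. \<forall>F\<in>V. l2_scale M c F \<in> V) \<and>
     (\<forall>F\<in>L2 M. (\<forall>e>0. \<exists>G\<in>V. l2_norm M (l2_diff M F G) < e) \<longrightarrow> F \<in> V)"

definition closed_span :: "'a measure \<Rightarrow> 'a vec set \<Rightarrow> 'a vec set" where
  "closed_span M S = l2_closed_subspace M hull S"


section \<open>Bounded operators\<close>

text \<open>Operators are extensional functions on \<^const>\<open>L2\<close>, so that equality of operators is
  equality in HOL; the composition of \<open>S\<close> after \<open>T\<close> is \<open>compose (L2 M) S T\<close>.\<close>

definition bounded_ops :: "'a measure \<Rightarrow> 'b measure \<Rightarrow> ('a, 'b) oper set" where
  "bounded_ops M N = {T \<in> L2 M \<rightarrow>\<^sub>E L2 N.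
     (\<forall>F\<in>L2 M. \<forall>G\<in>L2 M. T (l2_add M F G) = l2_add N (T F) (T G)) \<and>
     (\<forall>c. \<forall>F\<in>L2 M. T (l2_scale M c F) = l2_scale N c (T F)) \<and>
     (\<exists>K. \<forall>F\<in>L2 M. l2_norm N (T F) \<le> K * l2_norm M F)}"

definition op_zero :: "'a measure \<Rightarrow> 'b measure \<Rightarrow> ('a, 'b) oper" where
  "op_zero M N = (\<lambda>F\<in>L2 M. l2_zero N)"

definition op_add :: "'a measure \<Rightarrow> 'b measure \<Rightarrow> ('a, 'b) oper \<Rightarrow> ('a, 'b) oper \<Rightarrow> ('a, 'b) oper"
  where "op_add M N S T = (\<lambda>F\<in>L2 M. l2_add N (S F) (T F))"

definition op_scale :: "'a measure \<Rightarrow> 'b measure \<Rightarrow> complex \<Rightarrow> ('a, 'b) oper \<Rightarrow> ('a, 'b) oper"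
  where "op_scale M N c T = (\<lambda>F\<in>L2 M. l2_scale N c (T F))"

definition op_subspace :: "'a measure \<Rightarrow> 'b measure \<Rightarrow> ('a, 'b) oper set \<Rightarrow> bool" where
  "op_subspace M N U \<longleftrightarrow> U \<subseteq> bounded_ops M N \<and> op_zero M N \<in> U \<and>
     (\<forall>S\<in>U. \<forall>T\<in>U. op_add M N S T \<in> U) \<and> (\<forall>c. \<forall>T\<in>U. op_scale M N c T \<in> U)"

text \<open>The ultraweak topology is the weak topology given by the functionals
  \<open>T \<mapsto> (\<Sum>k. \<langle>T x\<^sub>k, y\<^sub>k\<rangle>)\<close> with square summable sequences of vectors.\<close>

definition l2_seq :: "'a measure \<Rightarrow> (nat \<Rightarrow> 'a vec) \<Rightarrow> bool" where
  "l2_seq M xs \<longleftrightarrow> (\<forall>k. xs k \<in> L2 M) \<and> summable (\<lambda>k. (l2_norm M (xs k))\<^sup>2)"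

definition ultraweak_topology :: "'a measure \<Rightarrow> 'b measure \<Rightarrow> ('a, 'b) oper topology" where
  "ultraweak_topology M N = topology_generated_by
     {{T \<in> bounded_ops M N. (\<Sum>k. l2_inner N (T (xs k)) (ys k)) \<in> V} | xs ys V.
        l2_seq M xs \<and> l2_seq N ys \<and> open V}"


section \<open>Multiplication masas and bimodules\<close>

definition mult_op :: "'a measure \<Rightarrow> ('a \<Rightarrow> complex) \<Rightarrow> ('a, 'a) oper" where
  "mult_op M h = (\<lambda>F\<in>L2 M. ae_class M (\<lambda>x. h x * rep F x))"

definition mult_masa :: "'a measure \<Rightarrow> ('a, 'a) oper set" where
  "mult_masa M = mult_op M ` {h \<in> borel_measurable M. \<exists>C. AE x in M. cmod (h x) \<le> C}"

definition masa_bimodule :: "'a measure \<Rightarrow> 'b measure \<Rightarrow> ('a, 'b) oper set \<Rightarrow> bool" where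
  "masa_bimodule M N U \<longleftrightarrow> op_subspace M N U \<and>
     (\<forall>B\<in>mult_masa N. \<forall>T\<in>U. \<forall>A\<in>mult_masa M. compose (L2 M) B (compose (L2 M) T A) \<in> U)"

definition marginally_null :: "'a measure \<Rightarrow> 'b measure \<Rightarrow> ('a \<times> 'b) set \<Rightarrow> bool" where
  "marginally_null M N E \<longleftrightarrow>
     (\<exists>A\<in>null_sets M. \<exists>B\<in>null_sets N. E \<subseteq> (A \<times> space N) \<union> (space M \<times> B))"

definition M_max :: "'a measure \<Rightarrow> 'b measure \<Rightarrow> ('a \<times> 'b) set \<Rightarrow> ('a, 'b) oper set" where
  "M_max M N \<kappa> = {T \<in> bounded_ops M N. \<forall>\<alpha>\<in>sets M. \<forall>\<beta>\<in>sets N.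
     marginally_null M N ((\<alpha> \<times> \<beta>) \<inter> \<kappa>) \<longrightarrow>
     compose (L2 M) (mult_op N (indicator \<beta>)) (compose (L2 M) T (mult_op M (indicator \<alpha>)))
       = op_zero M N}"


section \<open>Projections and the map of an operator space\<close>

definition projections :: "'a measure \<Rightarrow> ('a, 'a) oper set" where
  "projections M = {P \<in> bounded_ops M M. compose (L2 M) P P = P \<and>
     (\<forall>F\<in>L2 M. \<forall>G\<in>L2 M. l2_inner M (P F) G = l2_inner M F (P G))}"

definition proj_onto :: "'a measure \<Rightarrow> 'a vec set \<Rightarrow> ('a, 'a) oper" where
  "proj_onto M V = (THE P. P \<in> projections M \<and> P ` L2 M = V)"

definition proj_le :: "'a measure \<Rightarrow> ('a, 'a) oper \<Rightarrow> ('a, 'a) oper \<Rightarrow> bool" where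
  "proj_le M P Q \<longleftrightarrow> P ` L2 M \<subseteq> Q ` L2 M"

definition proj_Sup :: "'a measure \<Rightarrow> ('a, 'a) oper set \<Rightarrow> ('a, 'a) oper" where
  "proj_Sup M \<P> = proj_onto M (closed_span M (\<Union>P\<in>\<P>. P ` L2 M))"

definition proj_compl :: "'a measure \<Rightarrow> ('a, 'a) oper \<Rightarrow> ('a, 'a) oper" where
  "proj_compl M P = (\<lambda>F\<in>L2 M. l2_diff M F (P F))"

definition Map_op ::
    "'a measure \<Rightarrow> 'b measure \<Rightarrow> ('a, 'b) oper set \<Rightarrow> ('a, 'a) oper \<Rightarrow> ('b, 'b) oper" where
  "Map_op M N U P = proj_onto N (closed_span N {S F | S F. S \<in> U \<and> F \<in> P ` L2 M})"

definition sup_preserving ::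
    "'a measure \<Rightarrow> 'b measure \<Rightarrow> (('a, 'a) oper \<Rightarrow> ('b, 'b) oper) \<Rightarrow> bool" where
  "sup_preserving M N \<phi> \<longleftrightarrow> \<phi> ` projections M \<subseteq> projections N \<and>
     \<phi> (op_zero M M) = op_zero N N \<and>
     (\<forall>\<P>\<subseteq>projections M. \<phi> (proj_Sup M \<P>) = proj_Sup N (\<phi> ` \<P>))"

definition S1 ::
    "'a measure \<Rightarrow> 'b measure \<Rightarrow> (('a, 'a) oper \<Rightarrow> ('b, 'b) oper) \<Rightarrow> ('a, 'a) oper set" where
  "S1 M N \<phi> = {proj_Sup M {P \<in> projections M. proj_le N (\<phi> P) Q} | Q. Q \<in> projections N}"

definition ortho_map ::
    "'a measure \<Rightarrow> 'b measure \<Rightarrow> (('a, 'a) oper \<Rightarrow> ('b, 'b) oper) \<Rightarrow> bool" where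
  "ortho_map M N \<phi> \<longleftrightarrow> sup_preserving M N \<phi> \<and>
     (\<forall>L\<in>S1 M N \<phi>. compose (L2 N) (\<phi> L) (\<phi> (proj_compl M L)) = op_zero N N)"

definition normalizing_bimodule :: "'a measure \<Rightarrow> 'b measure \<Rightarrow> ('a, 'b) oper set \<Rightarrow> bool" where
  "normalizing_bimodule M N U \<longleftrightarrow> masa_bimodule M N U \<and>
     closedin (ultraweak_topology M N) U \<and> ortho_map M N (Map_op M N U)"

definition reflexive :: "'a measure \<Rightarrow> 'b measure \<Rightarrow> ('a, 'b) oper set \<Rightarrow> bool" where
  "reflexive M N U \<longleftrightarrow> (\<exists>\<phi>. sup_preserving M N \<phi> \<and>
     U = {T \<in> bounded_ops M N. \<forall>P\<in>projections M.
       compose (L2 M) (proj_compl N (\<phi> P)) (compose (L2 M) T P) = op_zero M N})"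

definition thin :: "'a measure \<Rightarrow> 'b measure \<Rightarrow> ('a, 'b) oper set \<Rightarrow> bool" where
  "thin M N U \<longleftrightarrow> masa_bimodule M N U \<and> reflexive M N U \<and>
     {A \<in> bounded_ops M M. \<forall>T\<in>U. compose (L2 M) T A \<in> U} = mult_masa M \<and>
     {B \<in> bounded_ops N N. \<forall>T\<in>U. compose (L2 M) B T \<in> U} = mult_masa N"


section \<open>Point maps\<close>

definition preserves_null_sets :: "'a measure \<Rightarrow> 'b measure \<Rightarrow> ('a \<Rightarrow> 'b) \<Rightarrow> bool" where
  "preserves_null_sets M N f \<longleftrightarrow> (\<forall>\<beta>\<in>null_sets N. f -` \<beta> \<inter> space M \<in> null_sets M)"

definition almost_one_to_one :: "'a measure \<Rightarrow> ('a \<Rightarrow> 'b) \<Rightarrow> bool" where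
  "almost_one_to_one M f \<longleftrightarrow> (\<exists>A\<in>null_sets M. inj_on f (space M - A))"

text \<open>Up to null sets on both sides: discarding a null set of the domain must not enlarge the
  missed part of the codomain beyond a null set, so the property depends only on the almost
  everywhere class of \<open>f\<close>. Requiring only that \<open>space N - f ` space M\<close> be null would count the
  identity from \<open>[0,1]\<close>, with Lebesgue measure restricted to \<open>[0,1/2]\<close>, to \<open>[0,1]\<close> with Lebesgue
  measure as onto, and the operators supported on its graph do not form a thin bimodule.\<close>

definition almost_onto :: "'a measure \<Rightarrow> 'b measure \<Rightarrow> ('a \<Rightarrow> 'b) \<Rightarrow> bool" where
  "almost_onto M N f \<longleftrightarrow>
     (\<forall>A\<in>null_sets M. \<exists>B\<in>null_sets N. space N - f ` (space M - A) \<subseteq> B)"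

text \<open>The zero space between Hilbert spaces of dimension at most one. Every bounded operator on
  such a space is a multiplication operator, so the zero space is a thin normalizing bimodule; but
  it is not supported on a graph when, for instance, both spaces have dimension one.\<close>

definition degenerate :: "'a measure \<Rightarrow> 'b measure \<Rightarrow> ('a, 'b) oper set \<Rightarrow> bool" where
  "degenerate M N U \<longleftrightarrow> U = {op_zero M N} \<and>
     bounded_ops M M = mult_masa M \<and> bounded_ops N N = mult_masa N"

end

theory Submission
  imports Defs
begin

text \<open>
  Write \<open>P \<alpha>\<close> for the multiplication by the indicator of a measurable set \<open>\<alpha>\<close>, in the code \<open>Pr M \<alpha>\<close>.
  A bimodule \<open>U\<close> over the multiplication masas acts on sets: \<open>\<Phi> \<alpha>\<close> is the smallest set that
  carries all \<open>S F\<close> with \<open>S \<in> U\<close> and \<open>F\<close> supported on \<open>\<alpha>\<close>, and \<open>\<Theta> \<beta>\<close> is the largest set whose vectors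
  \<open>U\<close> maps into those supported on \<open>\<beta>\<close>. These sets exist modulo null sets because a closed subspace
  invariant under the masa is the range of some \<open>P \<alpha>\<close> (\<open>invariant_subspace\<close>), and \<open>\<Phi>\<close> is lower adjoint
  to \<open>\<Theta>\<close> (\<open>galois\<close>). A reflexive \<open>U\<close> consists of all bounded operators that map vectors supported on
  \<open>\<Theta> \<beta>\<close> to vectors supported on \<open>\<beta>\<close> (\<open>reflexive_in_U\<close>); the operators supported on the graph of \<open>f\<close>
  are described in the same way with the preimage of \<open>\<beta>\<close> under \<open>f\<close> instead (\<open>M_max_graph_iff\<close>). So the
  theorem compares \<open>\<Theta>\<close> with the preimages under a point map.

  Let \<open>U\<close> be normalizing and thin. The ortho-map condition says that \<open>\<Phi> \<alpha>\<close> and \<open>\<Phi>\<close> of the complement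
  of \<open>\<alpha>\<close> are disjoint if \<open>\<alpha>\<close> has the form \<open>\<Theta> \<beta>\<close>. The sets \<open>\<alpha>\<close> with this property form a \<open>\<sigma>\<close>-algebra,
  and an operator commuting with it can be absorbed by \<open>U\<close> on the right, so by thinness it is a
  multiplication operator. But conditional expectations commute with the \<open>\<sigma>\<close>-algebra and are
  multiplication operators only in the case of all measurable sets (\<open>subalgebra_full\<close>). With the same
  argument on the left, \<open>\<Phi>\<close> and \<open>\<Theta>\<close> are inverse isomorphisms of the measure algebras; that they
  neither kill a set nor miss one is where nondegeneracy enters, through rank one operators
  (\<open>kernel_null\<close>, \<open>range_full\<close>). Isomorphisms of measure algebras of standard spaces come from point maps
  (\<open>point_realization\<close>), which gives \<open>f\<close> and an almost everywhere inverse of it.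

  Conversely let \<open>U\<close> consist of the operators supported on the graph of \<open>f\<close>. Since \<open>f\<close> is almost
  injective, every measurable set is a preimage under \<open>f\<close> modulo null sets
  (\<open>injective_preimages_full\<close>), and since it is almost onto, \<open>f\<close> has an almost everywhere inverse \<open>g\<close>.
  Composition with \<open>g\<close>, weighted so as to be bounded (\<open>weighted_composition\<close>), is an injective
  operator in \<open>U\<close> whose range lives on the whole codomain. Sandwiching a multiplier of \<open>U\<close> between
  \<open>P \<alpha>\<close> and the projection of the complement, and using that \<open>U\<close> transports the decomposition along
  \<open>f\<close>, the off-diagonal corners of the multiplier vanish. So it commutes with all \<open>P \<alpha>\<close>, and by
  maximality of the masa (\<open>commutant_masa\<close>) it is a multiplication operator.

  The Hilbert space facts used, among them the completeness of \<open>L\<^sup>2\<close> and the existence of orthogonal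
  projections, are derived directly for classes of square integrable functions.
\<close>

section \<open>Square integrable functions and their classes\<close>

definition sqi :: "'a measure \<Rightarrow> ('a \<Rightarrow> complex) \<Rightarrow> bool" where
  "sqi M f \<longleftrightarrow> f \<in> borel_measurable M \<and> integrable M (\<lambda>x. (cmod (f x))\<^sup>2)"

lemma cmod_add_sq_le: "(cmod (a + b))\<^sup>2 \<le> 2 * (cmod a)\<^sup>2 + 2 * (cmod b)\<^sup>2"
proof -
  have "(cmod (a + b))\<^sup>2 \<le> (cmod a + cmod b)\<^sup>2"
    by (intro power_mono norm_triangle_ineq) auto
  also have "\<dots> \<le> 2 * (cmod a)\<^sup>2 + 2 * (cmod b)\<^sup>2"
    using sum_squares_bound[of "cmod a" "cmod b"] by (simp add: power2_sum)
  finally show ?thesis .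
qed

lemma sqi_add:
  assumes "sqi M f" "sqi M g"
  shows "sqi M (\<lambda>x. f x + g x)"
proof -
  have [measurable]: "f \<in> borel_measurable M" "g \<in> borel_measurable M"
    using assms by (auto simp: sqi_def)
  have "integrable M (\<lambda>x. 2 * (cmod (f x))\<^sup>2 + 2 * (cmod (g x))\<^sup>2)"
    using assms by (auto simp: sqi_def)
  then have "integrable M (\<lambda>x. (cmod (f x + g x))\<^sup>2)"
    by (rule Bochner_Integration.integrable_bound) (auto simp: cmod_add_sq_le)
  then show ?thesis
    by (simp add: sqi_def)
qed

lemma sqi_mult_bounded:
  assumes f: "sqi M f" and [measurable]: "h \<in> borel_measurable M" and C: "AE x in M. cmod (h x) \<le> C"
  shows "sqi M (\<lambda>x. h x * f x)"
proof -
  have [measurable]: "f \<in> borel_measurable M"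
    using f by (auto simp: sqi_def)
  have "integrable M (\<lambda>x. C\<^sup>2 * (cmod (f x))\<^sup>2)"
    using f by (auto simp: sqi_def)
  then have "integrable M (\<lambda>x. (cmod (h x * f x))\<^sup>2)"
  proof (rule Bochner_Integration.integrable_bound)
    show "AE x in M. norm ((cmod (h x * f x))\<^sup>2) \<le> norm (C\<^sup>2 * (cmod (f x))\<^sup>2)"
      using C by eventually_elim
        (auto simp: norm_mult power_mult_distrib intro!: mult_right_mono power_mono)
  qed measurable
  then show ?thesis
    by (simp add: sqi_def)
qed

lemma sqi_scale: "sqi M f \<Longrightarrow> sqi M (\<lambda>x. c * f x)"
  by (rule sqi_mult_bounded[where C = "cmod c"]) auto

lemma sqi_diff: "sqi M f \<Longrightarrow> sqi M g \<Longrightarrow> sqi M (\<lambda>x. f x - g x)"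
  using sqi_add[OF _ sqi_scale[of M g "-1"], of f] by simp

lemma sqi_cong_AE:
  assumes "sqi M f" "g \<in> borel_measurable M" "AE x in M. g x = f x"
  shows "sqi M g"
proof -
  have [measurable]: "f \<in> borel_measurable M" "g \<in> borel_measurable M"
    using assms by (auto simp: sqi_def)
  have "integrable M (\<lambda>x. (cmod (g x))\<^sup>2) \<longleftrightarrow> integrable M (\<lambda>x. (cmod (f x))\<^sup>2)"
    by (rule integrable_cong_AE) (use assms(3) in auto)
  then show ?thesis
    using assms by (simp add: sqi_def)
qed

lemma sqi_0: "sqi M (\<lambda>_. 0)"
  by (simp add: sqi_def)

lemma ae_class_cong:
  assumes "AE x in M. f x = g x"
  shows "ae_class M f = ae_class M g"
proof -
  have "(AE x in M. h x = f x) \<longleftrightarrow> (AE x in M. h x = g x)" for h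
    by (rule eventually_subst) (use assms in eventually_elim, simp)
  then show ?thesis
    by (simp add: ae_class_def)
qed

lemma rep_ae_class:
  assumes "f \<in> borel_measurable M"
  shows "rep (ae_class M f) \<in> borel_measurable M" "AE x in M. rep (ae_class M f) x = f x"
proof -
  have "f \<in> ae_class M f"
    using assms by (simp add: ae_class_def)
  then have "rep (ae_class M f) \<in> ae_class M f"
    unfolding rep_def by (rule someI[of "\<lambda>g. g \<in> ae_class M f"])
  then show "rep (ae_class M f) \<in> borel_measurable M" "AE x in M. rep (ae_class M f) x = f x"
    by (auto simp: ae_class_def)
qed

lemma ae_class_in_L2: "sqi M f \<Longrightarrow> ae_class M f \<in> L2 M"
  by (auto simp: L2_def sqi_def)

lemma rep_sqi:
  assumes "F \<in> L2 M"
  shows "sqi M (rep F)"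
proof -
  obtain f where f: "sqi M f" "F = ae_class M f"
    using assms by (auto simp: L2_def sqi_def)
  then have "f \<in> borel_measurable M"
    by (simp add: sqi_def)
  from sqi_cong_AE[OF f(1) rep_ae_class[OF this]] show ?thesis
    by (simp add: f(2))
qed

lemma rep_measurable [simp]: "F \<in> L2 M \<Longrightarrow> rep F \<in> borel_measurable M"
  using rep_sqi by (auto simp: sqi_def)

lemma rep_integrable: "F \<in> L2 M \<Longrightarrow> integrable M (\<lambda>x. (cmod (rep F x))\<^sup>2)"
  using rep_sqi by (auto simp: sqi_def)

lemma ae_class_rep: "F \<in> L2 M \<Longrightarrow> ae_class M (rep F) = F"
  unfolding L2_def by (auto intro!: ae_class_cong rep_ae_class)

lemma L2_eqI:
  assumes "F \<in> L2 M" "G \<in> L2 M" "AE x in M. rep F x = rep G x"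
  shows "F = G"
  using ae_class_cong[OF assms(3)] assms(1,2) by (simp add: ae_class_rep)

lemma rep_ae_class_L2: "sqi M f \<Longrightarrow> AE x in M. rep (ae_class M f) x = f x"
  by (rule rep_ae_class) (simp add: sqi_def)

lemma add_in: "F \<in> L2 M \<Longrightarrow> G \<in> L2 M \<Longrightarrow> l2_add M F G \<in> L2 M"
  unfolding l2_add_def by (intro ae_class_in_L2 sqi_add rep_sqi)

lemma diff_in: "F \<in> L2 M \<Longrightarrow> G \<in> L2 M \<Longrightarrow> l2_diff M F G \<in> L2 M"
  unfolding l2_diff_def by (intro ae_class_in_L2 sqi_diff rep_sqi)

lemma scale_in: "F \<in> L2 M \<Longrightarrow> l2_scale M c F \<in> L2 M"
  unfolding l2_scale_def by (intro ae_class_in_L2 sqi_scale rep_sqi)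

lemma zero_in: "l2_zero M \<in> L2 M"
  unfolding l2_zero_def by (intro ae_class_in_L2 sqi_0)

lemmas L2_in = add_in diff_in scale_in zero_in

lemma rep_add:
  "F \<in> L2 M \<Longrightarrow> G \<in> L2 M \<Longrightarrow> AE x in M. rep (l2_add M F G) x = rep F x + rep G x"
  unfolding l2_add_def by (intro rep_ae_class_L2 sqi_add rep_sqi)

lemma rep_diff:
  "F \<in> L2 M \<Longrightarrow> G \<in> L2 M \<Longrightarrow> AE x in M. rep (l2_diff M F G) x = rep F x - rep G x"
  unfolding l2_diff_def by (intro rep_ae_class_L2 sqi_diff rep_sqi)

lemma rep_scale: "F \<in> L2 M \<Longrightarrow> AE x in M. rep (l2_scale M c F) x = c * rep F x"
  unfolding l2_scale_def by (intro rep_ae_class_L2 sqi_scale rep_sqi)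

lemma rep_zero: "AE x in M. rep (l2_zero M) x = 0"
  unfolding l2_zero_def by (intro rep_ae_class_L2 sqi_0)

lemma L2_eq_iff: "F \<in> L2 M \<Longrightarrow> G \<in> L2 M \<Longrightarrow> F = G \<longleftrightarrow> (AE x in M. rep F x = rep G x)"
  using L2_eqI by auto

lemma eq_zero_iff: "F \<in> L2 M \<Longrightarrow> F = l2_zero M \<longleftrightarrow> (AE x in M. rep F x = 0)"
proof -
  assume F: "F \<in> L2 M"
  have "(AE x in M. rep F x = rep (l2_zero M) x) \<longleftrightarrow> (AE x in M. rep F x = 0)"
    by (rule eventually_subst) (use rep_zero[of M] in eventually_elim, simp)
  then show ?thesis
    using L2_eq_iff[OF F zero_in] by simp
qed

lemma l2_diff_eq_zero_iff:
  assumes "F \<in> L2 M" "G \<in> L2 M"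
  shows "l2_diff M F G = l2_zero M \<longleftrightarrow> F = G"
proof -
  have "(AE x in M. rep (l2_diff M F G) x = 0) \<longleftrightarrow> (AE x in M. rep F x = rep G x)"
    by (rule eventually_subst) (use rep_diff[OF assms] in eventually_elim, simp)
  then show ?thesis
    using eq_zero_iff[OF diff_in[OF assms]] L2_eq_iff[OF assms] by simp
qed

lemma l2_diff_conv:
  assumes "F \<in> L2 M" "G \<in> L2 M"
  shows "l2_diff M F G = l2_add M F (l2_scale M (-1) G)"
proof (rule L2_eqI)
  show "AE x in M. rep (l2_diff M F G) x = rep (l2_add M F (l2_scale M (-1) G)) x"
    using rep_diff[OF assms] rep_add[OF assms(1) scale_in[OF assms(2), of "-1"]] rep_scale[OF assms(2), of "-1"]
    by eventually_elim simp
qed (use assms in \<open>auto intro: L2_in\<close>)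

lemma l2_add_diff_cancel:
  assumes "F \<in> L2 M" "G \<in> L2 M"
  shows "l2_add M G (l2_diff M F G) = F"
proof (rule L2_eqI)
  show "AE x in M. rep (l2_add M G (l2_diff M F G)) x = rep F x"
    using rep_diff[OF assms] rep_add[OF assms(2) diff_in[OF assms]]
    by eventually_elim auto
qed (use assms in \<open>auto intro: L2_in\<close>)

lemma l2_scale_0: "F \<in> L2 M \<Longrightarrow> l2_scale M 0 F = l2_zero M"
  using rep_scale[of F M 0] by (subst eq_zero_iff) (auto intro: L2_in)

lemma l2_add_zero: "F \<in> L2 M \<Longrightarrow> l2_add M F (l2_zero M) = F"
proof (rule L2_eqI)
  assume F: "F \<in> L2 M"
  show "AE x in M. rep (l2_add M F (l2_zero M)) x = rep F x"
    using rep_add[OF F zero_in] rep_zero[of M] by eventually_elim auto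
qed (auto intro: L2_in)

lemma l2_diff_zero: "F \<in> L2 M \<Longrightarrow> l2_diff M F (l2_zero M) = F"
proof (rule L2_eqI)
  assume F: "F \<in> L2 M"
  show "AE x in M. rep (l2_diff M F (l2_zero M)) x = rep F x"
    using rep_diff[OF F zero_in] rep_zero[of M] by eventually_elim auto
qed (auto intro: L2_in)

section \<open>The inner product\<close>

lemma borel_measurable_cnj [measurable]: "cnj \<in> borel_measurable borel"
  by (intro borel_measurable_continuous_onI continuous_intros)

lemma sqi_integrable_prod:
  assumes "sqi M f" "sqi M g"
  shows "integrable M (\<lambda>x. f x * cnj (g x))"
proof -
  have [measurable]: "f \<in> borel_measurable M" "g \<in> borel_measurable M"
    using assms by (auto simp: sqi_def)
  have "integrable M (\<lambda>x. (cmod (f x))\<^sup>2 + (cmod (g x))\<^sup>2)"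
    using assms by (auto simp: sqi_def)
  then show ?thesis
  proof (rule Bochner_Integration.integrable_bound)
    have "norm (f x * cnj (g x)) \<le> norm ((cmod (f x))\<^sup>2 + (cmod (g x))\<^sup>2)" for x
      using sum_squares_bound[of "cmod (f x)" "cmod (g x)"]
        mult_nonneg_nonneg[OF norm_ge_zero[of "f x"] norm_ge_zero[of "g x"]]
      unfolding norm_mult complex_mod_cnj real_norm_def by linarith
    then show "AE x in M. norm (f x * cnj (g x)) \<le> norm ((cmod (f x))\<^sup>2 + (cmod (g x))\<^sup>2)"
      by simp
  qed measurable
qed

lemma inner_cong:
  assumes "sqi M f" "sqi M g" "F \<in> L2 M" "G \<in> L2 M"
    "AE x in M. rep F x = f x" "AE x in M. rep G x = g x"
  shows "l2_inner M F G = (LINT x|M. f x * cnj (g x))"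
  unfolding l2_inner_def
proof (rule integral_cong_AE)
  show "AE x in M. rep F x * cnj (rep G x) = f x * cnj (g x)"
    using assms(5,6) by eventually_elim simp
  have [measurable]: "f \<in> borel_measurable M" "g \<in> borel_measurable M"
    "rep F \<in> borel_measurable M" "rep G \<in> borel_measurable M"
    using assms by (auto simp: sqi_def)
  show "(\<lambda>x. rep F x * cnj (rep G x)) \<in> borel_measurable M"
    "(\<lambda>x. f x * cnj (g x)) \<in> borel_measurable M"
    by measurable
qed

lemma inner_add_left:
  assumes "F \<in> L2 M" "G \<in> L2 M" "H \<in> L2 M"
  shows "l2_inner M (l2_add M F G) H = l2_inner M F H + l2_inner M G H"
proof -
  have "l2_inner M (l2_add M F G) H = (LINT x|M. (rep F x + rep G x) * cnj (rep H x))"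
    by (rule inner_cong) (use assms in \<open>auto intro: sqi_add rep_sqi rep_add L2_in\<close>)
  also have "\<dots> = (LINT x|M. rep F x * cnj (rep H x) + rep G x * cnj (rep H x))"
    by (simp add: algebra_simps)
  also have "\<dots> = l2_inner M F H + l2_inner M G H"
    unfolding l2_inner_def by (intro Bochner_Integration.integral_add sqi_integrable_prod rep_sqi assms)
  finally show ?thesis .
qed

lemma inner_scale_left:
  assumes "F \<in> L2 M" "H \<in> L2 M"
  shows "l2_inner M (l2_scale M c F) H = c * l2_inner M F H"
proof -
  have "l2_inner M (l2_scale M c F) H = (LINT x|M. (c * rep F x) * cnj (rep H x))"
    by (rule inner_cong) (use assms in \<open>auto intro: sqi_scale rep_sqi rep_scale L2_in\<close>)
  also have "\<dots> = (LINT x|M. c * (rep F x * cnj (rep H x)))"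
    by (simp add: algebra_simps)
  also have "\<dots> = c * l2_inner M F H"
    unfolding l2_inner_def by (intro integral_mult_right_zero)
  finally show ?thesis .
qed

lemma inner_commute: "l2_inner M F G = cnj (l2_inner M G F)"
  unfolding l2_inner_def Bochner_Integration.integral_cnj[symmetric] by (simp add: mult.commute)

lemma inner_add_right:
  assumes "F \<in> L2 M" "G \<in> L2 M" "H \<in> L2 M"
  shows "l2_inner M H (l2_add M F G) = l2_inner M H F + l2_inner M H G"
  using inner_add_left[OF assms] inner_commute[of M H] by (metis complex_cnj_add)

lemma inner_scale_right:
  assumes "F \<in> L2 M" "H \<in> L2 M"
  shows "l2_inner M H (l2_scale M c F) = cnj c * l2_inner M H F"
  using inner_scale_left[OF assms] inner_commute[of M H] by (metis complex_cnj_mult)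

lemma inner_diff_left:
  assumes "F \<in> L2 M" "G \<in> L2 M" "H \<in> L2 M"
  shows "l2_inner M (l2_diff M F G) H = l2_inner M F H - l2_inner M G H"
  using assms by (simp add: l2_diff_conv inner_add_left inner_scale_left L2_in)

lemma inner_diff_right:
  assumes "F \<in> L2 M" "G \<in> L2 M" "H \<in> L2 M"
  shows "l2_inner M H (l2_diff M F G) = l2_inner M H F - l2_inner M H G"
  using assms by (simp add: l2_diff_conv inner_add_right inner_scale_right L2_in)

lemmas inner_simps = inner_add_left inner_add_right inner_scale_left inner_scale_right
  inner_diff_left inner_diff_right

lemma norm_sq: "(l2_norm M F)\<^sup>2 = (LINT x|M. (cmod (rep F x))\<^sup>2)"
  unfolding l2_norm_def by (rule real_sqrt_pow2) (rule Bochner_Integration.integral_nonneg, auto)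

lemma norm_nonneg: "0 \<le> l2_norm M F"
  unfolding l2_norm_def by (rule real_sqrt_ge_zero) (rule Bochner_Integration.integral_nonneg, auto)

lemma inner_self: "l2_inner M F F = of_real ((l2_norm M F)\<^sup>2)"
proof -
  have "l2_inner M F F = (LINT x|M. complex_of_real ((cmod (rep F x))\<^sup>2))"
    unfolding l2_inner_def complex_norm_square ..
  then show ?thesis
    by (simp only: norm_sq integral_complex_of_real)
qed

lemma norm_eq_0_iff:
  assumes "F \<in> L2 M"
  shows "l2_norm M F = 0 \<longleftrightarrow> F = l2_zero M"
proof -
  have "l2_norm M F = 0 \<longleftrightarrow> (LINT x|M. (cmod (rep F x))\<^sup>2) = 0"
    by (metis norm_sq zero_eq_power2)
  also have "\<dots> \<longleftrightarrow> (AE x in M. (cmod (rep F x))\<^sup>2 = 0)"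
    by (intro integral_nonneg_eq_0_iff_AE rep_integrable assms) auto
  finally show ?thesis
    using eq_zero_iff[OF assms] by simp
qed

lemma inner_zero_left: "F \<in> L2 M \<Longrightarrow> l2_inner M (l2_zero M) F = 0"
  using inner_scale_left[OF zero_in, of F M 0] l2_scale_0[OF zero_in, of M] by simp

lemma inner_zero_right: "F \<in> L2 M \<Longrightarrow> l2_inner M F (l2_zero M) = 0"
  using inner_zero_left inner_commute by (metis complex_cnj_zero)

lemma norm_zero: "l2_norm M (l2_zero M) = 0"
  using norm_eq_0_iff zero_in by blast

lemma norm_cong: "F \<in> L2 M \<Longrightarrow> sqi M f \<Longrightarrow> AE x in M. rep F x = f x \<Longrightarrow>
  (l2_norm M F)\<^sup>2 = (LINT x|M. (cmod (f x))\<^sup>2)"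
  unfolding norm_sq
  by (intro integral_cong_AE measurable_compose[OF rep_measurable, where g = "\<lambda>z. (cmod z)\<^sup>2"]
        measurable_compose[where f = f and g = "\<lambda>z. (cmod z)\<^sup>2"]) (auto simp: sqi_def)

lemma norm_add_sq_le:
  assumes "F \<in> L2 M" "G \<in> L2 M"
  shows "(l2_norm M (l2_add M F G))\<^sup>2 \<le> 2 * (l2_norm M F)\<^sup>2 + 2 * (l2_norm M G)\<^sup>2"
proof -
  have "(l2_norm M (l2_add M F G))\<^sup>2 = (LINT x|M. (cmod (rep F x + rep G x))\<^sup>2)"
    by (rule norm_cong) (use assms in \<open>auto intro: L2_in sqi_add rep_sqi rep_add\<close>)
  also have "\<dots> \<le> (LINT x|M. 2 * (cmod (rep F x))\<^sup>2 + 2 * (cmod (rep G x))\<^sup>2)"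
    using assms sqi_add[OF rep_sqi rep_sqi, OF assms]
    by (intro integral_mono Bochner_Integration.integrable_add integrable_mult_right rep_integrable)
      (auto simp: cmod_add_sq_le sqi_def)
  also have "\<dots> = 2 * (l2_norm M F)\<^sup>2 + 2 * (l2_norm M G)\<^sup>2"
    using assms by (simp add: norm_sq rep_integrable)
  finally show ?thesis .
qed

lemma norm_scale: "F \<in> L2 M \<Longrightarrow> (l2_norm M (l2_scale M c F))\<^sup>2 = (cmod c)\<^sup>2 * (l2_norm M F)\<^sup>2"
  by (subst norm_cong[OF scale_in sqi_scale[OF rep_sqi] rep_scale])
    (auto simp: norm_sq norm_mult power_mult_distrib)

lemma norm_diff_commute:
  assumes "F \<in> L2 M" "G \<in> L2 M"
  shows "l2_norm M (l2_diff M F G) = l2_norm M (l2_diff M G F)"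
proof -
  have "(l2_norm M (l2_diff M F G))\<^sup>2 = (l2_norm M (l2_diff M G F))\<^sup>2"
    using norm_cong[OF diff_in sqi_diff[OF rep_sqi rep_sqi] rep_diff, OF assms assms assms]
      norm_cong[OF diff_in sqi_diff[OF rep_sqi rep_sqi] rep_diff, OF assms(2,1) assms(2,1) assms(2,1)]
    by (simp add: norm_minus_commute)
  then show ?thesis
    using norm_nonneg by (metis power2_eq_imp_eq)
qed

lemma cauchy_schwarz:
  assumes "F \<in> L2 M" "G \<in> L2 M"
  shows "cmod (l2_inner M F G) \<le> l2_norm M F * l2_norm M G"
proof (cases "G = l2_zero M")
  case True
  then show ?thesis
    using assms by (simp add: inner_zero_right norm_zero)
next
  case False
  define n where "n = (l2_norm M G)\<^sup>2"
  define a where "a = l2_inner M F G"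
  have n: "n > 0"
    using False norm_eq_0_iff[OF assms(2)] by (simp add: n_def)
  have 1: "l2_inner M G F = cnj a"
    using inner_commute a_def by metis
  \<comment> \<open>The distance from \<open>F\<close> to its component along \<open>G\<close> is nonnegative.\<close>
  define H where "H = l2_diff M F (l2_scale M (a / of_real n) G)"
  have G: "l2_scale M (a / of_real n) G \<in> L2 M"
    using assms by (intro L2_in)
  have 2: "l2_inner M G G = of_real n"
    by (simp add: inner_self n_def)
  have "l2_inner M H H = l2_inner M F F - cnj (a / of_real n) * a
      - (a / of_real n) * (cnj a - cnj (a / of_real n) * of_real n)"
    unfolding H_def inner_diff_left[OF assms(1) G diff_in[OF assms(1) G]]
      inner_diff_right[OF assms(1) G assms(1)] inner_diff_right[OF assms(1) G G]
      inner_scale_right[OF assms(2) assms(1)] inner_scale_right[OF assms(2) G]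
      inner_scale_left[OF assms(2) assms(1)] inner_scale_left[OF assms(2) assms(2)] 1 2 a_def[symmetric]
    by (simp add: algebra_simps)
  also have "\<dots> = l2_inner M F F - a * cnj a / of_real n"
    using n by (simp add: field_simps)
  also have "\<dots> = of_real ((l2_norm M F)\<^sup>2) - of_real ((cmod a)\<^sup>2 / n)"
    by (simp only: inner_self complex_norm_square of_real_divide)
  finally have "l2_inner M H H = of_real ((l2_norm M F)\<^sup>2) - of_real ((cmod a)\<^sup>2 / n)" .
  then have "of_real ((l2_norm M H)\<^sup>2) = complex_of_real ((l2_norm M F)\<^sup>2 - (cmod a)\<^sup>2 / n)"
    by (simp only: inner_self of_real_diff)
  then have "(l2_norm M H)\<^sup>2 = (l2_norm M F)\<^sup>2 - (cmod a)\<^sup>2 / n"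
    by (simp only: of_real_eq_iff)
  then have "(cmod a)\<^sup>2 / n \<le> (l2_norm M F)\<^sup>2"
    by (metis diff_ge_0_iff_ge zero_le_power2)
  then have "(cmod a)\<^sup>2 \<le> (l2_norm M F * l2_norm M G)\<^sup>2"
    using n by (simp add: n_def power_mult_distrib field_simps)
  then show ?thesis
    unfolding a_def by (rule power2_le_imp_le) (simp add: norm_nonneg)
qed

lemma norm_diff_triangle:
  assumes F: "F \<in> L2 M" and G: "G \<in> L2 M" and L: "L \<in> L2 M"
  shows "l2_norm M (l2_diff M F L) \<le> l2_norm M (l2_diff M F G) + l2_norm M (l2_diff M G L)"
proof -
  let ?u = "l2_diff M F L" and ?v = "l2_diff M F G" and ?w = "l2_diff M G L"
  have i: "?u \<in> L2 M" "?v \<in> L2 M" "?w \<in> L2 M"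
    using F G L by (auto intro: L2_in)
  have u: "?u = l2_add M ?v ?w"
  proof (rule L2_eqI)
    show "AE x in M. rep ?u x = rep (l2_add M ?v ?w) x"
      using rep_diff[OF F L] rep_diff[OF F G] rep_diff[OF G L] rep_add[OF i(2,3)]
      by eventually_elim simp
  qed (use i in \<open>auto intro: L2_in\<close>)
  have "complex_of_real ((l2_norm M ?u)\<^sup>2) = of_real ((l2_norm M ?v)\<^sup>2) + of_real ((l2_norm M ?w)\<^sup>2)
      + (l2_inner M ?v ?w + l2_inner M ?w ?v)"
    unfolding inner_self[symmetric] by (subst (1 2) u) (simp add: inner_simps i L2_in)
  then have "(l2_norm M ?u)\<^sup>2 = (l2_norm M ?v)\<^sup>2 + (l2_norm M ?w)\<^sup>2
      + Re (l2_inner M ?v ?w + l2_inner M ?w ?v)"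
    by (metis Re_complex_of_real plus_complex.simps(1))
  also have "\<dots> \<le> (l2_norm M ?v)\<^sup>2 + (l2_norm M ?w)\<^sup>2 + 2 * (l2_norm M ?v * l2_norm M ?w)"
    using complex_Re_le_cmod[of "l2_inner M ?v ?w"] complex_Re_le_cmod[of "l2_inner M ?w ?v"]
      cauchy_schwarz[OF i(2,3)] cauchy_schwarz[OF i(3,2)] by (simp add: mult.commute)
  also have "\<dots> = (l2_norm M ?v + l2_norm M ?w)\<^sup>2"
    by (simp add: power2_sum)
  finally show ?thesis
    by (rule power2_le_imp_le) (simp add: norm_nonneg)
qed

section \<open>Completeness\<close>

text \<open>By monotone convergence the sum of the functions is integrable, hence almost everywhere finite.\<close>

lemma AE_summable:
  fixes h :: "nat \<Rightarrow> 'a \<Rightarrow> real"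
  assumes int: "\<And>k. integrable M (h k)" and nn: "\<And>k x. 0 \<le> h k x"
    and sum: "summable (\<lambda>k. LINT x|M. h k x)"
  shows "AE x in M. summable (\<lambda>k. h k x)"
proof -
  have [measurable]: "h k \<in> borel_measurable M" for k
    using int by auto
  have "(\<integral>\<^sup>+x. (\<Sum>k. ennreal (h k x)) \<partial>M) = (\<Sum>k. \<integral>\<^sup>+x. ennreal (h k x) \<partial>M)"
    by (rule nn_integral_suminf) measurable
  also have "\<dots> = (\<Sum>k. ennreal (LINT x|M. h k x))"
    using int nn by (simp add: nn_integral_eq_integral)
  also have "\<dots> < \<infinity>"
    using sum nn by (simp add: suminf_ennreal2 Bochner_Integration.integral_nonneg)
  finally have "AE x in M. (\<Sum>k. ennreal (h k x)) \<noteq> \<infinity>"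
    by (intro nn_integral_PInf_AE) auto
  then show ?thesis
    by eventually_elim (use nn in \<open>auto intro: summable_suminf_not_top\<close>)
qed

text \<open>Weighting the squared increments by \<open>2 ^ k\<close> keeps their integrals summable, and forces the
  increments themselves to be almost everywhere dominated by a geometric sequence.\<close>

lemma L2_complete:
  assumes F: "\<And>k. F k \<in> L2 M"
    and cauchy: "\<And>k j. k \<le> j \<Longrightarrow> (l2_norm M (l2_diff M (F j) (F k)))\<^sup>2 \<le> (1/4) ^ k"
  obtains G where "G \<in> L2 M" "\<And>k. (l2_norm M (l2_diff M G (F k)))\<^sup>2 \<le> (1/4) ^ k"
proof -
  let ?f = "\<lambda>k. rep (F k)"
  have [measurable]: "?f k \<in> borel_measurable M" for k
    using F by simp
  have int: "integrable M (\<lambda>x. (cmod (?f j x - ?f k x))\<^sup>2)" for j k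
    using sqi_diff[OF rep_sqi[OF F] rep_sqi[OF F], of j k] by (simp add: sqi_def)
  have bnd: "(LINT x|M. (cmod (?f j x - ?f k x))\<^sup>2) \<le> (1/4) ^ k" if "k \<le> j" for j k
    using cauchy[OF that]
      norm_cong[OF diff_in[OF F F] sqi_diff[OF rep_sqi[OF F] rep_sqi[OF F]] rep_diff[OF F F], of j k]
    by simp
  have "summable (\<lambda>k. LINT x|M. 2 ^ k * (cmod (?f (Suc k) x - ?f k x))\<^sup>2)"
  proof (rule summable_comparison_test')
    show "summable (\<lambda>k. (1/2::real) ^ k)"
      by (rule summable_geometric) simp
    fix k :: nat
    have "(LINT x|M. 2 ^ k * (cmod (?f (Suc k) x - ?f k x))\<^sup>2) \<le> 2 ^ k * (1/4) ^ k"
      using bnd[of k "Suc k"] by simp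
    also have "2 ^ k * (1/4) ^ k = (1/2::real) ^ k"
      by (simp add: power_mult_distrib[symmetric])
    finally show "norm (LINT x|M. 2 ^ k * (cmod (?f (Suc k) x - ?f k x))\<^sup>2) \<le> (1/2) ^ k"
      by (simp del: power_Suc)
  qed
  then have "AE x in M. summable (\<lambda>k. 2 ^ k * (cmod (?f (Suc k) x - ?f k x))\<^sup>2)"
    by (intro AE_summable) (auto intro: int)
  \<comment> \<open>The terms of a convergent series are eventually below 1, so the increments are below \<open>sqrt (1/2) ^ k\<close>.\<close>
  then have conv: "AE x in M. convergent (\<lambda>k. ?f k x)"
  proof eventually_elim
    case (elim x)
    then have "(\<lambda>k. 2 ^ k * (cmod (?f (Suc k) x - ?f k x))\<^sup>2) \<longlonglongrightarrow> 0"
      by (rule summable_LIMSEQ_zero)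
    then have "\<forall>\<^sub>F k in sequentially. 2 ^ k * (cmod (?f (Suc k) x - ?f k x))\<^sup>2 < 1"
      by (rule order_tendstoD) simp
    then have "\<forall>\<^sub>F k in sequentially. norm (?f (Suc k) x - ?f k x) \<le> (sqrt (1/2)) ^ k"
    proof eventually_elim
      case (elim k)
      then have "(cmod (?f (Suc k) x - ?f k x))\<^sup>2 \<le> (1/2) ^ k"
        by (simp add: field_simps power_one_over)
      also have "(1/2::real) ^ k = ((sqrt (1/2)) ^ k)\<^sup>2"
        by (simp add: power2_eq_square power_mult_distrib[symmetric])
      finally show ?case
        by (rule power2_le_imp_le) simp
    qed
    moreover have "summable (\<lambda>k. (sqrt (1/2)) ^ k)"
      by (rule summable_geometric) (simp add: real_sqrt_divide)
    ultimately have "summable (\<lambda>k. ?f (Suc k) x - ?f k x)"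
      by (rule summable_comparison_test_ev)
    then have "convergent (\<lambda>n. \<Sum>k<n. ?f (Suc k) x - ?f k x)"
      by (simp add: summable_iff_convergent)
    then have "convergent (\<lambda>n. ?f n x - ?f 0 x)"
      by (subst (asm) sum_lessThan_telescope)
    then show ?case
      using convergent_add[OF _ convergent_const[of "?f 0 x"]] by fastforce
  qed
  define g where "g = (\<lambda>x. lim (\<lambda>k. ?f k x))"
  have [measurable]: "g \<in> borel_measurable M"
    unfolding g_def by measurable
  have lim: "AE x in M. (\<lambda>k. ?f k x) \<longlonglongrightarrow> g x"
    using conv by eventually_elim (simp add: g_def convergent_LIMSEQ_iff)
  \<comment> \<open>Fatou's lemma carries the Cauchy estimate over to the pointwise limit.\<close>
  have fatou: "(\<integral>\<^sup>+x. ennreal ((cmod (g x - ?f k x))\<^sup>2) \<partial>M) \<le> ennreal ((1/4) ^ k)" for k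
  proof -
    have "(\<integral>\<^sup>+x. ennreal ((cmod (g x - ?f k x))\<^sup>2) \<partial>M)
        = (\<integral>\<^sup>+x. liminf (\<lambda>j. ennreal ((cmod (?f j x - ?f k x))\<^sup>2)) \<partial>M)"
    proof (rule nn_integral_cong_AE)
      show "AE x in M. ennreal ((cmod (g x - ?f k x))\<^sup>2)
          = liminf (\<lambda>j. ennreal ((cmod (?f j x - ?f k x))\<^sup>2))"
        using lim
      proof eventually_elim
        case (elim x)
        have "(\<lambda>j. ennreal ((cmod (?f j x - ?f k x))\<^sup>2)) \<longlonglongrightarrow> ennreal ((cmod (g x - ?f k x))\<^sup>2)"
          by (intro tendsto_ennrealI tendsto_power tendsto_norm tendsto_diff elim tendsto_const)
        then show ?case
          by (metis lim_imp_Liminf trivial_limit_sequentially)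
      qed
    qed
    also have "\<dots> \<le> liminf (\<lambda>j. \<integral>\<^sup>+x. ennreal ((cmod (?f j x - ?f k x))\<^sup>2) \<partial>M)"
      by (rule nn_integral_liminf) measurable
    also have "\<dots> \<le> liminf (\<lambda>j. ennreal ((1/4) ^ k))"
    proof (rule Liminf_mono)
      show "\<forall>\<^sub>F j in sequentially. (\<integral>\<^sup>+x. ennreal ((cmod (?f j x - ?f k x))\<^sup>2) \<partial>M) \<le> ennreal ((1/4) ^ k)"
        using eventually_ge_at_top[of k]
        by eventually_elim
          (simp add: nn_integral_eq_integral[OF int] bnd ennreal_leI)
    qed
    also have "\<dots> = ennreal ((1/4) ^ k)"
      by (simp add: Liminf_const)
    finally show ?thesis .
  qed
  have gk: "sqi M (\<lambda>x. g x - ?f k x)" for k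
    unfolding sqi_def
    using fatou[of k] by (auto intro!: integrableI_bounded simp: top_unique less_top[symmetric] 
        intro: le_less_trans)
  have g: "sqi M g"
    using sqi_add[OF gk[of 0] rep_sqi[OF F[of 0]]] by simp
  show thesis
  proof
    show G: "ae_class M g \<in> L2 M"
      using g by (rule ae_class_in_L2)
    fix k
    have "AE x in M. rep (l2_diff M (ae_class M g) (F k)) x = g x - ?f k x"
      using rep_diff[OF G F[of k]] rep_ae_class_L2[OF g] by eventually_elim simp
    then have "(l2_norm M (l2_diff M (ae_class M g) (F k)))\<^sup>2 = (LINT x|M. (cmod (g x - ?f k x))\<^sup>2)"
      by (intro norm_cong diff_in G F gk)
    also have "\<dots> \<le> (1/4) ^ k"
      using fatou[of k] gk[of k]
      by (subst (asm) nn_integral_eq_integral) (auto simp: sqi_def)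
    finally show "(l2_norm M (l2_diff M (ae_class M g) (F k)))\<^sup>2 \<le> (1/4) ^ k" .
  qed
qed

section \<open>Bounded operators and closed subspaces\<close>

lemma csub_L2: "l2_closed_subspace M (L2 M)"
  by (auto simp: l2_closed_subspace_def L2_in)

lemma csubD:
  assumes "l2_closed_subspace M V"
  shows "V \<subseteq> L2 M" "l2_zero M \<in> V" "F \<in> V \<Longrightarrow> G \<in> V \<Longrightarrow> l2_add M F G \<in> V"
    "F \<in> V \<Longrightarrow> l2_scale M c F \<in> V" "F \<in> V \<Longrightarrow> G \<in> V \<Longrightarrow> l2_diff M F G \<in> V"
proof -
  show V: "V \<subseteq> L2 M" "l2_zero M \<in> V" "F \<in> V \<Longrightarrow> G \<in> V \<Longrightarrow> l2_add M F G \<in> V" for F G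
    using assms by (auto simp: l2_closed_subspace_def)
  show s: "F \<in> V \<Longrightarrow> l2_scale M c F \<in> V" for c F
    using assms by (auto simp: l2_closed_subspace_def)
  show "F \<in> V \<Longrightarrow> G \<in> V \<Longrightarrow> l2_diff M F G \<in> V"
    using V s l2_diff_conv[of F M G] by (metis subsetD)
qed

lemma csub_closed:
  assumes "l2_closed_subspace M V" "F \<in> L2 M"
    and "\<And>e. e > 0 \<Longrightarrow> \<exists>G\<in>V. (l2_norm M (l2_diff M F G))\<^sup>2 < e"
  shows "F \<in> V"
proof -
  have "\<exists>G\<in>V. l2_norm M (l2_diff M F G) < e" if "e > 0" for e
    using assms(3)[of "e\<^sup>2"] that power2_less_imp_less[of _ e] by fastforce
  then show ?thesis
    using assms(1,2) unfolding l2_closed_subspace_def by blast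
qed

lemma csubI:
  assumes V: "V \<subseteq> L2 M" "l2_zero M \<in> V" "\<And>F G. F \<in> V \<Longrightarrow> G \<in> V \<Longrightarrow> l2_add M F G \<in> V"
      "\<And>c F. F \<in> V \<Longrightarrow> l2_scale M c F \<in> V"
    and closed: "\<And>F. F \<in> L2 M \<Longrightarrow> (\<And>e. e > 0 \<Longrightarrow> \<exists>G\<in>V. (l2_norm M (l2_diff M F G))\<^sup>2 < e) \<Longrightarrow> F \<in> V"
  shows "l2_closed_subspace M V"
  unfolding l2_closed_subspace_def
proof (intro conjI ballI allI impI)
  fix F assume F: "F \<in> L2 M" and *: "\<forall>e>0. \<exists>G\<in>V. l2_norm M (l2_diff M F G) < e"
  show "F \<in> V"
  proof (rule closed[OF F])
    fix e :: real assume "e > 0"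
    then obtain G where G: "G \<in> V" "l2_norm M (l2_diff M F G) < sqrt e"
      using * by (meson real_sqrt_gt_zero)
    have "(l2_norm M (l2_diff M F G))\<^sup>2 < (sqrt e)\<^sup>2"
      by (rule power_strict_mono[OF G(2) norm_nonneg]) simp
    then show "\<exists>G\<in>V. (l2_norm M (l2_diff M F G))\<^sup>2 < e"
      using G(1) \<open>e > 0\<close> by (intro bexI[of _ G]) auto
  qed
qed (use V in auto)

lemma closed_span_csub:
  assumes "S \<subseteq> L2 M"
  shows "l2_closed_subspace M (closed_span M S)"
proof -
  have *: "closed_span M S \<subseteq> L2 M"
    unfolding closed_span_def using assms csub_L2 by (intro hull_minimal) auto
  show ?thesis
  proof (rule csubI[OF *])
    fix F assume F: "F \<in> L2 M"
      and e: "\<And>e. e > 0 \<Longrightarrow> \<exists>G\<in>closed_span M S. (l2_norm M (l2_diff M F G))\<^sup>2 < e"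
    have "F \<in> V" if V: "l2_closed_subspace M V" "S \<subseteq> V" for V
    proof (rule csub_closed[OF V(1) F])
      have "closed_span M S \<subseteq> V"
        unfolding closed_span_def using V by (intro hull_minimal)
      then show "\<exists>G\<in>V. (l2_norm M (l2_diff M F G))\<^sup>2 < e" if "e > 0" for e
        using e[OF that] by auto
    qed
    then show "F \<in> closed_span M S"
      by (auto simp: closed_span_def hull_def)
  qed (auto simp: closed_span_def hull_def csubD)
qed

lemma closed_span_superset: "S \<subseteq> closed_span M S"
  unfolding closed_span_def by (rule hull_subset)

lemma closed_span_minimal: "S \<subseteq> V \<Longrightarrow> l2_closed_subspace M V \<Longrightarrow> closed_span M S \<subseteq> V"
  unfolding closed_span_def by (rule hull_minimal)

lemma bounded_opsD:
  assumes "T \<in> bounded_ops M N"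
  shows "F \<in> L2 M \<Longrightarrow> T F \<in> L2 N"
    "F \<in> L2 M \<Longrightarrow> G \<in> L2 M \<Longrightarrow> T (l2_add M F G) = l2_add N (T F) (T G)"
    "F \<in> L2 M \<Longrightarrow> T (l2_scale M c F) = l2_scale N c (T F)"
    "F \<in> L2 M \<Longrightarrow> G \<in> L2 M \<Longrightarrow> T (l2_diff M F G) = l2_diff N (T F) (T G)"
    "T (l2_zero M) = l2_zero N"
proof -
  show 1: "F \<in> L2 M \<Longrightarrow> T F \<in> L2 N" for F
    using assms by (auto simp: bounded_ops_def)
  show 2: "F \<in> L2 M \<Longrightarrow> G \<in> L2 M \<Longrightarrow> T (l2_add M F G) = l2_add N (T F) (T G)"
      "F \<in> L2 M \<Longrightarrow> T (l2_scale M c F) = l2_scale N c (T F)" for F G c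
    using assms by (auto simp: bounded_ops_def)
  show "F \<in> L2 M \<Longrightarrow> G \<in> L2 M \<Longrightarrow> T (l2_diff M F G) = l2_diff N (T F) (T G)"
    by (simp add: l2_diff_conv 1 2 L2_in)
  show "T (l2_zero M) = l2_zero N"
    using 2(2)[OF zero_in, of 0] 1[OF zero_in] by (simp add: l2_scale_0 zero_in)
qed

lemma op_boundE:
  assumes "T \<in> bounded_ops M N"
  obtains K where "K > 0" "\<And>F. F \<in> L2 M \<Longrightarrow> (l2_norm N (T F))\<^sup>2 \<le> K * (l2_norm M F)\<^sup>2"
proof -
  obtain K where K: "\<And>F. F \<in> L2 M \<Longrightarrow> l2_norm N (T F) \<le> K * l2_norm M F"
    using assms unfolding bounded_ops_def by blast
  have "(l2_norm N (T F))\<^sup>2 \<le> (K\<^sup>2 + 1) * (l2_norm M F)\<^sup>2" if "F \<in> L2 M" for F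
  proof -
    have "(l2_norm N (T F))\<^sup>2 \<le> (K * l2_norm M F)\<^sup>2"
      by (intro power_mono K that norm_nonneg)
    also have "\<dots> \<le> (K\<^sup>2 + 1) * (l2_norm M F)\<^sup>2"
      by (auto simp: power_mult_distrib algebra_simps)
    finally show ?thesis .
  qed
  then show thesis
    by (intro that[of "K\<^sup>2 + 1"]) (auto intro: add_nonneg_pos)
qed

lemma bounded_opsI:
  assumes "\<And>F. F \<in> L2 M \<Longrightarrow> T F \<in> L2 N" "T \<in> extensional (L2 M)"
    "\<And>F G. F \<in> L2 M \<Longrightarrow> G \<in> L2 M \<Longrightarrow> T (l2_add M F G) = l2_add N (T F) (T G)"
    "\<And>c F. F \<in> L2 M \<Longrightarrow> T (l2_scale M c F) = l2_scale N c (T F)"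
    and K: "0 \<le> K" "\<And>F. F \<in> L2 M \<Longrightarrow> (l2_norm N (T F))\<^sup>2 \<le> K * (l2_norm M F)\<^sup>2"
  shows "T \<in> bounded_ops M N"
proof -
  have "l2_norm N (T F) \<le> sqrt K * l2_norm M F" if "F \<in> L2 M" for F
  proof (rule power2_le_imp_le)
    show "(l2_norm N (T F))\<^sup>2 \<le> (sqrt K * l2_norm M F)\<^sup>2"
      using K(2)[OF that] K(1) by (simp add: power_mult_distrib)
  qed (simp add: K(1) norm_nonneg)
  then show ?thesis
    using assms unfolding bounded_ops_def by (auto simp: PiE_def)
qed

lemma op_eqI:
  assumes "S \<in> bounded_ops M N" "T \<in> bounded_ops M N" "\<And>F. F \<in> L2 M \<Longrightarrow> S F = T F"
  shows "S = T"
  by (rule extensionalityI[where A = "L2 M"]) (use assms in \<open>auto simp: bounded_ops_def PiE_def\<close>)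

lemma compose_in:
  assumes S: "S \<in> bounded_ops N L" and T: "T \<in> bounded_ops M N"
  shows "compose (L2 M) S T \<in> bounded_ops M L"
proof -
  obtain K K' where K: "K > 0" "\<And>F. F \<in> L2 M \<Longrightarrow> (l2_norm N (T F))\<^sup>2 \<le> K * (l2_norm M F)\<^sup>2"
    and K': "K' > 0" "\<And>F. F \<in> L2 N \<Longrightarrow> (l2_norm L (S F))\<^sup>2 \<le> K' * (l2_norm N F)\<^sup>2"
    using op_boundE[OF S] op_boundE[OF T] by metis
  have "(l2_norm L (S (T F)))\<^sup>2 \<le> K' * K * (l2_norm M F)\<^sup>2" if F: "F \<in> L2 M" for F
  proof -
    have "(l2_norm L (S (T F)))\<^sup>2 \<le> K' * (l2_norm N (T F))\<^sup>2"
      by (intro K' bounded_opsD[OF T] F)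
    also have "\<dots> \<le> K' * (K * (l2_norm M F)\<^sup>2)"
      using K(2)[OF F] K'(1) by simp
    finally show ?thesis
      by (simp add: mult_ac)
  qed
  then show ?thesis
    using K(1) K'(1)
    by (intro bounded_opsI[where K = "K' * K"])
      (auto simp: compose_def bounded_opsD[OF S] bounded_opsD[OF T] L2_in)
qed

lemma l2_scale_zero: "l2_scale M c (l2_zero M) = l2_zero M"
proof -
  have "AE x in M. rep (l2_scale M c (l2_zero M)) x = 0"
    using rep_scale[OF zero_in, of M c] rep_zero[of M] by eventually_elim simp
  then show ?thesis
    using eq_zero_iff[OF scale_in[OF zero_in]] by blast
qed

lemma op_zero_in: "op_zero M N \<in> bounded_ops M N"
  by (rule bounded_opsI[where K = 0])
    (auto simp: op_zero_def L2_in l2_add_zero norm_zero l2_scale_zero)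

lemma id_in: "(\<lambda>F\<in>L2 M. F) \<in> bounded_ops M M"
  by (rule bounded_opsI[where K = 1]) (auto simp: L2_in)

lemma compose_eq_zero_iff:
  assumes "S \<in> bounded_ops M N"
  shows "S = op_zero M N \<longleftrightarrow> (\<forall>F\<in>L2 M. S F = l2_zero N)"
proof
  assume "\<forall>F\<in>L2 M. S F = l2_zero N"
  then show "S = op_zero M N"
    by (intro op_eqI[OF assms op_zero_in]) (simp add: op_zero_def)
qed (simp add: op_zero_def)

lemma csub_preimage:
  assumes T: "T \<in> bounded_ops M N" and V: "l2_closed_subspace N V"
  shows "l2_closed_subspace M {F \<in> L2 M. T F \<in> V}"
proof (rule csubI)
  fix F assume F: "F \<in> L2 M"
    and lim: "\<And>e. e > 0 \<Longrightarrow> \<exists>G\<in>{F \<in> L2 M. T F \<in> V}. (l2_norm M (l2_diff M F G))\<^sup>2 < e"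
  obtain K where K: "K > 0" "\<And>F. F \<in> L2 M \<Longrightarrow> (l2_norm N (T F))\<^sup>2 \<le> K * (l2_norm M F)\<^sup>2"
    using op_boundE[OF T] by metis
  have "T F \<in> V"
  proof (rule csub_closed[OF V])
    fix e :: real assume "e > 0"
    then have "e / K > 0"
      using K(1) by simp
    from lim[OF this] obtain G where G: "G \<in> L2 M" "T G \<in> V" "(l2_norm M (l2_diff M F G))\<^sup>2 < e / K"
      by auto
    have "(l2_norm N (T (l2_diff M F G)))\<^sup>2 \<le> K * (l2_norm M (l2_diff M F G))\<^sup>2"
      using F G by (intro K diff_in)
    also have "\<dots> < e"
      using G(3) K(1) by (simp add: field_simps)
    finally show "\<exists>G\<in>V. (l2_norm N (l2_diff N (T F) G))\<^sup>2 < e"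
      using F G bounded_opsD(4)[OF T] by auto
  qed (use bounded_opsD[OF T] F in auto)
  then show "F \<in> {F \<in> L2 M. T F \<in> V}"
    using F by simp
qed (auto simp: L2_in bounded_opsD[OF T] csubD[OF V])

lemma csub_Inter:
  assumes "\<And>i. i \<in> I \<Longrightarrow> l2_closed_subspace M (V i)"
  shows "l2_closed_subspace M {F \<in> L2 M. \<forall>i\<in>I. F \<in> V i}"
proof (rule csubI)
  fix F assume F: "F \<in> L2 M"
    and lim: "\<And>e. e > 0 \<Longrightarrow> \<exists>G\<in>{F \<in> L2 M. \<forall>i\<in>I. F \<in> V i}. (l2_norm M (l2_diff M F G))\<^sup>2 < e"
  have "F \<in> V i" if i: "i \<in> I" for i
    by (rule csub_closed[OF assms[OF i] F]) (use lim i in blast)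
  then show "F \<in> {F \<in> L2 M. \<forall>i\<in>I. F \<in> V i}"
    using F by simp
qed (auto simp: L2_in intro: csubD[OF assms])

lemma norm_diff_sq_le:
  assumes "F \<in> L2 M" "G \<in> L2 M"
  shows "(l2_norm M (l2_diff M F G))\<^sup>2 \<le> 2 * (l2_norm M F)\<^sup>2 + 2 * (l2_norm M G)\<^sup>2"
  using norm_add_sq_le[OF assms(1) scale_in[OF assms(2)], of "-1"] norm_scale[OF assms(2), of "-1"]
  by (simp add: l2_diff_conv assms)

lemma op_diff_in:
  assumes S: "S \<in> bounded_ops M N" and T: "T \<in> bounded_ops M N"
  shows "(\<lambda>F\<in>L2 M. l2_diff N (S F) (T F)) \<in> bounded_ops M N"
proof -
  obtain K K' where K: "K > 0" "\<And>F. F \<in> L2 M \<Longrightarrow> (l2_norm N (T F))\<^sup>2 \<le> K * (l2_norm M F)\<^sup>2"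
    and K': "K' > 0" "\<And>F. F \<in> L2 M \<Longrightarrow> (l2_norm N (S F))\<^sup>2 \<le> K' * (l2_norm M F)\<^sup>2"
    using op_boundE[OF S] op_boundE[OF T] by metis
  note TD = bounded_opsD[OF S] bounded_opsD[OF T]
  show ?thesis
  proof (rule bounded_opsI[where K = "2 * K' + 2 * K"])
    fix F G assume FG: "F \<in> L2 M" "G \<in> L2 M"
    have "l2_diff N (l2_add N (S F) (S G)) (l2_add N (T F) (T G))
      = l2_add N (l2_diff N (S F) (T F)) (l2_diff N (S G) (T G))"
    proof (rule L2_eqI)
      have i: "S F \<in> L2 N" "S G \<in> L2 N" "T F \<in> L2 N" "T G \<in> L2 N"
        using FG TD by auto
      show "AE x in N. rep (l2_diff N (l2_add N (S F) (S G)) (l2_add N (T F) (T G))) x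
        = rep (l2_add N (l2_diff N (S F) (T F)) (l2_diff N (S G) (T G))) x"
        using rep_add[OF i(1,2)] rep_add[OF i(3,4)] rep_diff[OF i(1,3)] rep_diff[OF i(2,4)]
          rep_diff[OF add_in[OF i(1,2)] add_in[OF i(3,4)]]
          rep_add[OF diff_in[OF i(1,3)] diff_in[OF i(2,4)]]
        by eventually_elim simp
    qed (use FG in \<open>auto intro!: L2_in TD\<close>)
    then show "(\<lambda>F\<in>L2 M. l2_diff N (S F) (T F)) (l2_add M F G) =
        l2_add N ((\<lambda>F\<in>L2 M. l2_diff N (S F) (T F)) F) ((\<lambda>F\<in>L2 M. l2_diff N (S F) (T F)) G)"
      using FG by (simp add: TD L2_in)
  next
    fix c F assume F: "F \<in> L2 M"
    have "l2_diff N (l2_scale N c (S F)) (l2_scale N c (T F)) = l2_scale N c (l2_diff N (S F) (T F))"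
    proof (rule L2_eqI)
      have i: "S F \<in> L2 N" "T F \<in> L2 N"
        using F TD by auto
      show "AE x in N. rep (l2_diff N (l2_scale N c (S F)) (l2_scale N c (T F))) x
        = rep (l2_scale N c (l2_diff N (S F) (T F))) x"
        using rep_diff[OF i] rep_scale[OF i(1), of c] rep_scale[OF i(2), of c]
          rep_diff[OF scale_in[OF i(1)] scale_in[OF i(2)], of c c] rep_scale[OF diff_in[OF i], of c]
        by eventually_elim (simp add: right_diff_distrib)
    qed (use F in \<open>auto intro!: L2_in TD\<close>)
    then show "(\<lambda>F\<in>L2 M. l2_diff N (S F) (T F)) (l2_scale M c F) =
        l2_scale N c ((\<lambda>F\<in>L2 M. l2_diff N (S F) (T F)) F)"
      using F by (simp add: TD L2_in)
  next
    fix F assume F: "F \<in> L2 M"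
    have "(l2_norm N (l2_diff N (S F) (T F)))\<^sup>2 \<le> 2 * (l2_norm N (S F))\<^sup>2 + 2 * (l2_norm N (T F))\<^sup>2"
      using F by (intro norm_diff_sq_le TD)
    then show "(l2_norm N ((\<lambda>F\<in>L2 M. l2_diff N (S F) (T F)) F))\<^sup>2 \<le> (2 * K' + 2 * K) * (l2_norm M F)\<^sup>2"
      using K(2)[OF F] K'(2)[OF F] F by (simp add: algebra_simps)
  qed (use K(1) K'(1) in \<open>auto intro!: L2_in TD\<close>)
qed

lemma csub_zero: "l2_closed_subspace M {l2_zero M}"
proof (rule csubI)
  fix F assume F: "F \<in> L2 M"
    and lim: "\<And>e. e > 0 \<Longrightarrow> \<exists>G\<in>{l2_zero M}. (l2_norm M (l2_diff M F G))\<^sup>2 < e"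
  have "(l2_norm M F)\<^sup>2 = 0"
    using lim[of "(l2_norm M F)\<^sup>2"] F by (fastforce simp: l2_diff_zero)
  then show "F \<in> {l2_zero M}"
    using norm_eq_0_iff[OF F] by simp
qed (auto simp: L2_in l2_add_zero l2_scale_zero)

lemma csub_equalizer:
  assumes "S \<in> bounded_ops M N" "T \<in> bounded_ops M N"
  shows "l2_closed_subspace M {F \<in> L2 M. S F = T F}"
proof -
  have "{F \<in> L2 M. S F = T F} = {F \<in> L2 M. (\<lambda>F\<in>L2 M. l2_diff N (S F) (T F)) F \<in> {l2_zero N}}"
    using assms by (auto simp: l2_diff_eq_zero_iff bounded_opsD)
  then show ?thesis
    using csub_preimage[OF op_diff_in[OF assms] csub_zero] by simp
qed

section \<open>Orthogonal projections\<close>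

lemma parallelogram:
  assumes "F \<in> L2 M" "G \<in> L2 M" "H \<in> L2 M"
  shows "(l2_norm M (l2_diff M G H))\<^sup>2 =
    2 * (l2_norm M (l2_diff M F G))\<^sup>2 + 2 * (l2_norm M (l2_diff M F H))\<^sup>2
    - 4 * (l2_norm M (l2_diff M F (l2_scale M (1/2) (l2_add M G H))))\<^sup>2"
proof -
  have h: "sqi M (\<lambda>x. 1/2 * (rep G x + rep H x))" "l2_scale M (1/2) (l2_add M G H) \<in> L2 M"
    by (intro sqi_scale sqi_add rep_sqi L2_in assms)+
  have "AE x in M. rep (l2_diff M F (l2_scale M (1/2) (l2_add M G H))) x = rep F x - 1/2 * (rep G x + rep H x)"
    using rep_diff[OF assms(1) h(2)] rep_scale[OF add_in[OF assms(2,3)], of "1/2"] rep_add[OF assms(2,3)]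
    by eventually_elim simp
  then have 1: "(l2_norm M (l2_diff M F (l2_scale M (1/2) (l2_add M G H))))\<^sup>2
      = (LINT x|M. (cmod (rep F x - 1/2 * (rep G x + rep H x)))\<^sup>2)"
    by (intro norm_cong diff_in h sqi_diff rep_sqi assms)
  have 2: "(l2_norm M (l2_diff M A B))\<^sup>2 = (LINT x|M. (cmod (rep A x - rep B x))\<^sup>2)"
    "integrable M (\<lambda>x. (cmod (rep A x - rep B x))\<^sup>2)" if "A \<in> L2 M" "B \<in> L2 M" for A B
    using norm_cong[OF diff_in sqi_diff[OF rep_sqi rep_sqi] rep_diff, OF that that that]
      sqi_diff[OF rep_sqi rep_sqi, OF that]
    by (auto simp: sqi_def)
  have 3: "integrable M (\<lambda>x. (cmod (rep F x - 1/2 * (rep G x + rep H x)))\<^sup>2)"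
    using sqi_diff[OF rep_sqi[OF assms(1)] h(1)] by (simp add: sqi_def)
  have pt: "(cmod (g - h))\<^sup>2 = 2 * (cmod (f - g))\<^sup>2 + 2 * (cmod (f - h))\<^sup>2 - 4 * (cmod (f - 1/2 * (g + h)))\<^sup>2"
    for f g h
    unfolding cmod_power2 by (simp add: power2_eq_square field_simps)
  show ?thesis
    unfolding 1 2(1)[OF assms(2,3)] 2(1)[OF assms(1,2)] 2(1)[OF assms(1,3)]
      ext[OF pt[of "rep G x" "rep H x" "rep F x" for x]]
    using 2(2)[OF assms(1,2)] 2(2)[OF assms(1,3)] 3 by simp
qed

text \<open>A sequence of vectors of the subspace whose distances to \<open>F\<close> approach the infimum is Cauchy by
  the parallelogram identity; its limit is a nearest point, and the difference to a nearest point
  is orthogonal to the subspace.\<close>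

lemma orthogonal_decomposition:
  assumes V: "l2_closed_subspace M V" and F: "F \<in> L2 M"
  obtains G where "G \<in> V" "\<And>H. H \<in> V \<Longrightarrow> l2_inner M (l2_diff M F G) H = 0"
proof -
  define D where "D = (\<lambda>G. (l2_norm M (l2_diff M F G))\<^sup>2)"
  define d where "d = Inf (D ` V)"
  have VL: "G \<in> V \<Longrightarrow> G \<in> L2 M" for G
    using csubD(1)[OF V] by auto
  have bdd: "bdd_below (D ` V)"
    by (rule bdd_belowI[of _ 0]) (auto simp: D_def)
  have d_le: "d \<le> D G" if "G \<in> V" for G
    unfolding d_def using that by (intro cInf_lower bdd) auto
  have "\<exists>G\<in>V. D G < d + (1/4) ^ k / 4" for k :: nat
  proof -
    have "\<exists>x\<in>D ` V. x < d + (1/4) ^ k / 4"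
      unfolding d_def using csubD(2)[OF V] by (intro cInf_lessD) auto
    then show ?thesis
      by auto
  qed
  \<comment> \<open>By the parallelogram identity, excess \<open>(1/4) ^ k / 4\<close> bounds squared mutual distances by \<open>(1/4) ^ k\<close>.\<close>
  then obtain G where G: "\<And>k. G k \<in> V" "\<And>k. D (G k) < d + (1/4) ^ k / 4"
    by metis
  have "(l2_norm M (l2_diff M (G j) (G k)))\<^sup>2 \<le> (1/4) ^ k" if "k \<le> j" for j k
  proof -
    have "d \<le> D (l2_scale M (1/2) (l2_add M (G j) (G k)))"
      by (intro d_le csubD[OF V] G)
    moreover have "(1/4::real) ^ j \<le> (1/4) ^ k"
      using that by (intro power_decreasing) auto
    ultimately show ?thesis
      using parallelogram[OF F VL[OF G(1)] VL[OF G(1)], of j k] G(2)[of j] G(2)[of k]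
      unfolding D_def by linarith
  qed
  then obtain L where L: "L \<in> L2 M" "\<And>k. (l2_norm M (l2_diff M L (G k)))\<^sup>2 \<le> (1/4) ^ k"
    using L2_complete[of G M] VL G(1) by metis
  have small: "\<exists>k. (1/4) ^ k < e" if "e > 0" for e :: real
    using real_arch_pow_inv[OF that, of "1/4"] by simp
  have LV: "L \<in> V"
  proof (rule csub_closed[OF V L(1)])
    fix e :: real assume "e > 0"
    then obtain k where "(1/4) ^ k < e"
      using small by blast
    then show "\<exists>G\<in>V. (l2_norm M (l2_diff M L G))\<^sup>2 < e"
      using L(2)[of k] G(1)[of k] by (intro bexI[of _ "G k"]) auto
  qed
  have min: "D L \<le> d"
  proof -
    have key: "sqrt (D L) \<le> sqrt (D (G k)) + sqrt ((1/4)^k)" for k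
    proof -
      have "l2_norm M (l2_diff M (G k) L) \<le> sqrt ((1/4)^k)"
        using L(2)[of k] norm_diff_commute[OF L(1) VL[OF G(1)[of k]]] by (simp add: real_le_rsqrt)
      then show ?thesis
        using norm_diff_triangle[OF F VL[OF G(1)[of k]] L(1)] by (simp add: D_def norm_nonneg)
    qed
    have "(\<lambda>k. (1/4::real)^k) \<longlonglongrightarrow> 0"
      by (rule LIMSEQ_power_zero) simp
    then have 1: "(\<lambda>k. sqrt (d + (1/4)^k / 4) + sqrt ((1/4)^k)) \<longlonglongrightarrow> sqrt (d + 0 / 4) + sqrt 0"
      by (intro tendsto_intros) auto
    have "sqrt (D L) \<le> sqrt (d + (1/4)^k / 4) + sqrt ((1/4)^k)" for k
      using key[of k] real_sqrt_le_mono[OF less_imp_le[OF G(2)[of k]]] by linarith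
    then have "sqrt (D L) \<le> sqrt (d + 0 / 4) + sqrt 0"
      by (intro LIMSEQ_le_const[OF 1]) auto
    then show ?thesis
      by simp
  qed
  show thesis
  proof (rule that[OF LV])
    fix H assume H: "H \<in> V"
    let ?u = "l2_diff M F L"
    have i: "?u \<in> L2 M" "H \<in> L2 M"
      using F L(1) VL[OF H] by (auto intro: L2_in)
    define a where "a = l2_inner M ?u H"
    \<comment> \<open>The summand 1 keeps \<open>n\<close> positive for \<open>H = 0\<close>, and still lets the step \<open>c H\<close> decrease the distance.\<close>
    define n where "n = (l2_norm M H)\<^sup>2 + 1"
    have n: "n > 0"
      by (auto simp: n_def intro: add_nonneg_pos)
    define c where "c = a / of_real n"
    have hu: "l2_inner M H ?u = cnj a"
      using inner_commute a_def by metis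
    have sH: "l2_scale M c H \<in> L2 M"
      by (intro L2_in i)
    have "l2_add M L (l2_scale M c H) \<in> V"
      by (intro csubD[OF V] LV H)
    then have "D L \<le> D (l2_add M L (l2_scale M c H))"
      using min d_le order_trans by blast
    also have "l2_diff M F (l2_add M L (l2_scale M c H)) = l2_diff M ?u (l2_scale M c H)"
    proof (rule L2_eqI)
      show "AE x in M. rep (l2_diff M F (l2_add M L (l2_scale M c H))) x = rep (l2_diff M ?u (l2_scale M c H)) x"
        using rep_diff[OF F add_in[OF L(1) sH]] rep_add[OF L(1) sH] rep_diff[OF i(1) sH] rep_diff[OF F L(1)]
        by eventually_elim simp
    qed (use F L(1) sH in \<open>auto intro: L2_in\<close>)
    then have "D (l2_add M L (l2_scale M c H)) = (l2_norm M (l2_diff M ?u (l2_scale M c H)))\<^sup>2"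
      by (simp add: D_def)
    finally have le: "(l2_norm M ?u)\<^sup>2 \<le> (l2_norm M (l2_diff M ?u (l2_scale M c H)))\<^sup>2"
      by (simp add: D_def)
    have hh: "l2_inner M H H = of_real (n - 1)"
      by (simp add: inner_self n_def)
    have ca: "c * cnj a = of_real ((cmod a)\<^sup>2 / n)"
      by (simp only: c_def of_real_divide complex_norm_square times_divide_eq_left)
    have ca': "cnj c * a = of_real ((cmod a)\<^sup>2 / n)"
      by (simp add: c_def complex_norm_square[symmetric] mult.commute flip: of_real_power)
    have cc: "c * (cnj c * of_real (n - 1)) = of_real ((cmod a)\<^sup>2 / n * (n - 1) / n)"
      using ca' n unfolding c_def by (simp add: field_simps)
    have "complex_of_real ((l2_norm M (l2_diff M ?u (l2_scale M c H)))\<^sup>2)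
      = of_real ((l2_norm M ?u)\<^sup>2) - cnj c * a - (c * cnj a - c * (cnj c * of_real (n - 1)))"
      unfolding inner_self[symmetric] inner_diff_left[OF i(1) sH diff_in[OF i(1) sH]]
        inner_diff_right[OF i(1) sH i(1)] inner_diff_right[OF i(1) sH sH]
        inner_scale_right[OF i(2) i(1)] inner_scale_right[OF i(2) sH]
        inner_scale_left[OF i(2) i(1)] inner_scale_left[OF i(2) i(2)] hu hh a_def[symmetric]
      by (simp add: algebra_simps)
    then have "(l2_norm M (l2_diff M ?u (l2_scale M c H)))\<^sup>2
      = (l2_norm M ?u)\<^sup>2 - (cmod a)\<^sup>2 / n - ((cmod a)\<^sup>2 / n - (cmod a)\<^sup>2 / n * (n - 1) / n)"
      unfolding ca ca' cc by (simp only: of_real_diff[symmetric] of_real_eq_iff)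
    moreover have "(cmod a)\<^sup>2 / n * (n - 1) / n \<le> (cmod a)\<^sup>2 / n"
      using n by (simp add: field_simps)
    ultimately have "(cmod a)\<^sup>2 / n \<le> 0"
      using le by linarith
    then show "l2_inner M ?u H = 0"
      using n by (simp add: a_def[symmetric] divide_le_0_iff)
  qed
qed

text \<open>Orthogonality of \<open>F - G\<close> to a vector is expressed by equality of the inner products of \<open>F\<close> and
  \<open>G\<close> with it. The difference of two components in \<open>V\<close> of the same vector is orthogonal to itself.\<close>

lemma decomposition_unique:
  assumes V: "l2_closed_subspace M V" and G: "G \<in> V" and G': "G' \<in> V"
    and eq: "\<And>H. H \<in> V \<Longrightarrow> l2_inner M G H = l2_inner M G' H"
  shows "G = G'"
proof -
  have i: "G \<in> L2 M" "G' \<in> L2 M" and d: "l2_diff M G G' \<in> V"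
    using csubD(1)[OF V] G G' csubD(5)[OF V] by auto
  have "l2_inner M (l2_diff M G G') (l2_diff M G G') = 0"
    using eq[OF d] i by (simp add: inner_diff_left L2_in)
  then have "(l2_norm M (l2_diff M G G'))\<^sup>2 = 0"
    unfolding inner_self of_real_eq_0_iff .
  then have "l2_diff M G G' = l2_zero M"
    using norm_eq_0_iff[OF diff_in[OF i]] by simp
  then show ?thesis
    using l2_diff_eq_zero_iff[OF i] by blast
qed

lemma projectionD:
  assumes "P \<in> projections M"
  shows "P \<in> bounded_ops M M" "F \<in> L2 M \<Longrightarrow> P (P F) = P F"
    "F \<in> L2 M \<Longrightarrow> G \<in> L2 M \<Longrightarrow> l2_inner M (P F) G = l2_inner M F (P G)"
    "F \<in> L2 M \<Longrightarrow> P F \<in> L2 M"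
proof -
  show b: "P \<in> bounded_ops M M"
    and "F \<in> L2 M \<Longrightarrow> G \<in> L2 M \<Longrightarrow> l2_inner M (P F) G = l2_inner M F (P G)"
    using assms by (auto simp: projections_def)
  have "compose (L2 M) P P = P"
    using assms by (auto simp: projections_def)
  then show "F \<in> L2 M \<Longrightarrow> P (P F) = P F"
    by (metis compose_eq)
  show "F \<in> L2 M \<Longrightarrow> P F \<in> L2 M"
    using bounded_opsD(1)[OF b] .
qed

lemma projectionsI:
  assumes "P \<in> bounded_ops M M" "\<And>F. F \<in> L2 M \<Longrightarrow> P (P F) = P F"
    "\<And>F G. F \<in> L2 M \<Longrightarrow> G \<in> L2 M \<Longrightarrow> l2_inner M (P F) G = l2_inner M F (P G)"
  shows "P \<in> projections M"
proof -
  have "compose (L2 M) P P = P"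
    by (rule op_eqI[OF compose_in[OF assms(1,1)] assms(1)]) (simp add: compose_def assms(2))
  then show ?thesis
    using assms by (auto simp: projections_def)
qed

lemma proj_range_iff:
  assumes "P \<in> projections M"
  shows "F \<in> P ` L2 M \<longleftrightarrow> F \<in> L2 M \<and> P F = F"
proof
  assume "F \<in> L2 M \<and> P F = F"
  then show "F \<in> P ` L2 M"
    by (intro image_eqI[of F P F]) auto
qed (auto simp: projectionD[OF assms])

lemma proj_range_csub:
  assumes "P \<in> projections M"
  shows "l2_closed_subspace M (P ` L2 M)"
proof -
  have "P ` L2 M = {F \<in> L2 M. P F = (\<lambda>F\<in>L2 M. F) F}"
    using proj_range_iff[OF assms] by auto
  then show ?thesis
    using csub_equalizer[OF projectionD(1)[OF assms] id_in] by simp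
qed

lemma proj_inner:
  assumes "P \<in> projections M" "F \<in> L2 M" "H \<in> P ` L2 M"
  shows "l2_inner M (P F) H = l2_inner M F H"
  using assms projectionD(3)[OF assms(1)] proj_range_iff[OF assms(1)] by auto

lemma proj_eqI:
  assumes P: "P \<in> projections M" and Q: "Q \<in> projections M" and eq: "P ` L2 M = Q ` L2 M"
  shows "P = Q"
proof (rule op_eqI[OF projectionD(1)[OF P] projectionD(1)[OF Q]])
  fix F assume F: "F \<in> L2 M"
  show "P F = Q F"
    by (rule decomposition_unique[OF proj_range_csub[OF P]])
      (use eq F proj_inner[OF P F] proj_inner[OF Q F] in auto)
qed

text \<open>The component in \<open>V\<close> depends linearly on the vector because it is unique, and it is a
  contraction by the Cauchy--Schwarz inequality.\<close>

lemma projection_exists: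
  assumes V: "l2_closed_subspace M V"
  obtains P where "P \<in> projections M" "P ` L2 M = V"
proof -
  have "\<exists>G\<in>V. \<forall>H\<in>V. l2_inner M G H = l2_inner M F H" if F: "F \<in> L2 M" for F
  proof -
    obtain G where G: "G \<in> V" "\<And>H. H \<in> V \<Longrightarrow> l2_inner M (l2_diff M F G) H = 0"
      using orthogonal_decomposition[OF V F] by metis
    then have "l2_inner M G H = l2_inner M F H" if "H \<in> V" for H
      using inner_diff_left[OF F, of G H] csubD(1)[OF V] that by (auto simp: subset_iff)
    then show ?thesis
      using G(1) by auto
  qed
  then obtain g where g: "\<And>F. F \<in> L2 M \<Longrightarrow> g F \<in> V"
      "\<And>F H. F \<in> L2 M \<Longrightarrow> H \<in> V \<Longrightarrow> l2_inner M (g F) H = l2_inner M F H"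
    by metis
  have VL: "F \<in> V \<Longrightarrow> F \<in> L2 M" for F
    using csubD(1)[OF V] by auto
  define P where "P = (\<lambda>F\<in>L2 M. g F)"
  have fixed: "P F = F" if "F \<in> V" for F
    by (rule decomposition_unique[OF V]) (use that g VL in \<open>auto simp: P_def\<close>)
  have self: "l2_inner M (P F) G = l2_inner M F (P G)" if "F \<in> L2 M" "G \<in> L2 M" for F G
  proof -
    have "l2_inner M (g F) G = l2_inner M (g F) (g G)"
      using g(2)[OF that(2) g(1)[OF that(1)]] inner_commute by metis
    then show ?thesis
      using that g by (simp add: P_def)
  qed
  have "P \<in> bounded_ops M M"
  proof (rule bounded_opsI[where K = 1])
    fix F G assume FG: "F \<in> L2 M" "G \<in> L2 M"
    have "g (l2_add M F G) = l2_add M (g F) (g G)"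
      by (rule decomposition_unique[OF V])
        (use FG in \<open>auto simp: inner_simps g VL L2_in intro: csubD[OF V] g\<close>)
    then show "P (l2_add M F G) = l2_add M (P F) (P G)"
      using FG by (simp add: P_def L2_in)
  next
    fix c F assume F: "F \<in> L2 M"
    have "g (l2_scale M c F) = l2_scale M c (g F)"
      by (rule decomposition_unique[OF V])
        (use F in \<open>auto simp: inner_simps g VL L2_in intro: csubD[OF V] g\<close>)
    then show "P (l2_scale M c F) = l2_scale M c (P F)"
      using F by (simp add: P_def L2_in)
  next
    fix F assume F: "F \<in> L2 M"
    have "complex_of_real ((l2_norm M (g F))\<^sup>2) = l2_inner M F (g F)"
      using g(2)[OF F g(1)[OF F]] by (simp only: inner_self)
    then have "(l2_norm M (g F))\<^sup>2 = cmod (l2_inner M F (g F))"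
      by (metis norm_of_real abs_power2)
    also have "\<dots> \<le> l2_norm M F * l2_norm M (g F)"
      by (intro cauchy_schwarz F VL g)
    finally have "(l2_norm M (g F))\<^sup>2 \<le> l2_norm M F * l2_norm M (g F)" .
    then have "l2_norm M (g F) \<le> l2_norm M F"
      using norm_nonneg[of M "g F"] norm_nonneg[of M F]
      by (cases "l2_norm M (g F) = 0") (auto simp: power2_eq_square)
    then show "(l2_norm M (P F))\<^sup>2 \<le> 1 * (l2_norm M F)\<^sup>2"
      using F by (simp add: P_def power_mono norm_nonneg)
  qed (auto simp: P_def g VL)
  then have "P \<in> projections M"
  proof (rule projectionsI)
    show "P (P F) = P F" if "F \<in> L2 M" for F
      by (rule fixed) (simp add: P_def g that)
  qed (rule self)
  moreover have "P ` L2 M = V"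
  proof
    show "P ` L2 M \<subseteq> V"
      by (auto simp: P_def g)
    show "V \<subseteq> P ` L2 M"
      using fixed VL by (metis image_eqI subsetI)
  qed
  ultimately show thesis
    by (rule that)
qed

lemma proj_onto_unique: "P \<in> projections M \<Longrightarrow> P ` L2 M = V \<Longrightarrow> proj_onto M V = P"
  unfolding proj_onto_def by (rule the_equality) (auto intro: proj_eqI)

lemma proj_onto_correct:
  assumes "l2_closed_subspace M V"
  shows "proj_onto M V \<in> projections M" "proj_onto M V ` L2 M = V"
  using projection_exists[OF assms] proj_onto_unique by metis+

lemma proj_compl_in: "P \<in> bounded_ops M M \<Longrightarrow> proj_compl M P \<in> bounded_ops M M"
  using op_diff_in[OF id_in, of P M] by (simp add: proj_compl_def cong: restrict_cong)

text \<open>The equation \<open>Q\<^sup>\<bottom> T P = 0\<close> says that \<open>T\<close> maps the range of \<open>P\<close> into that of \<open>Q\<close>.\<close>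

lemma compl_compose_zero_iff:
  assumes Q: "Q \<in> projections N" and T: "T \<in> bounded_ops M N" and P: "P \<in> projections M"
  shows "compose (L2 M) (proj_compl N Q) (compose (L2 M) T P) = op_zero M N \<longleftrightarrow>
    T ` P ` L2 M \<subseteq> Q ` L2 N"
proof -
  have "compose (L2 M) (proj_compl N Q) (compose (L2 M) T P) \<in> bounded_ops M N"
    by (rule compose_in[OF proj_compl_in[OF projectionD(1)[OF Q]] compose_in[OF T projectionD(1)[OF P]]])
  note iff = compose_eq_zero_iff[OF this]
  have i: "T (P F) \<in> L2 N" "Q (T (P F)) \<in> L2 N" if "F \<in> L2 M" for F
    using that projectionD(4)[OF P] bounded_opsD(1)[OF T] projectionD(4)[OF Q] by auto
  have "compose (L2 M) (proj_compl N Q) (compose (L2 M) T P) F = l2_zero N \<longleftrightarrow> T (P F) \<in> Q ` L2 N"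
    if F: "F \<in> L2 M" for F
    using F i[OF F] l2_diff_eq_zero_iff[OF i[OF F]] proj_range_iff[OF Q, of "T (P F)"]
    by (auto simp: compose_def proj_compl_def)
  then show ?thesis
    unfolding iff by auto
qed

section \<open>Multiplication operators\<close>

definition ess_bounded :: "'a measure \<Rightarrow> ('a \<Rightarrow> complex) \<Rightarrow> bool" where
  "ess_bounded M h \<longleftrightarrow> h \<in> borel_measurable M \<and> (\<exists>C. AE x in M. cmod (h x) \<le> C)"

lemma mult_masa_iff: "A \<in> mult_masa M \<longleftrightarrow> (\<exists>h. ess_bounded M h \<and> A = mult_op M h)"
  by (auto simp: mult_masa_def ess_bounded_def)

lemma mult_sqi:
  assumes "ess_bounded M h" "F \<in> L2 M"
  shows "sqi M (\<lambda>x. h x * rep F x)"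
  using assms sqi_mult_bounded[OF rep_sqi] by (auto simp: ess_bounded_def)

lemma mult_op_L2: "ess_bounded M h \<Longrightarrow> F \<in> L2 M \<Longrightarrow> mult_op M h F \<in> L2 M"
  by (simp add: mult_op_def ae_class_in_L2 mult_sqi)

lemma rep_mult_op:
  "ess_bounded M h \<Longrightarrow> F \<in> L2 M \<Longrightarrow> AE x in M. rep (mult_op M h F) x = h x * rep F x"
  by (simp add: mult_op_def rep_ae_class_L2 mult_sqi)

lemma mult_op_eqI:
  assumes "ess_bounded M h" "F \<in> L2 M" "G \<in> L2 M" "AE x in M. rep G x = h x * rep F x"
  shows "mult_op M h F = G"
proof (rule L2_eqI)
  show "AE x in M. rep (mult_op M h F) x = rep G x"
    using rep_mult_op[OF assms(1,2)] assms(4) by eventually_elim simp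
qed (use assms mult_op_L2 in auto)

lemma mult_op_in:
  assumes h: "ess_bounded M h"
  shows "mult_op M h \<in> bounded_ops M M"
proof -
  obtain C where C: "AE x in M. cmod (h x) \<le> C"
    using h by (auto simp: ess_bounded_def)
  show ?thesis
  proof (rule bounded_opsI[where K = "C\<^sup>2"])
    fix F G assume FG: "F \<in> L2 M" "G \<in> L2 M"
    have "AE x in M. rep (l2_add M (mult_op M h F) (mult_op M h G)) x = h x * rep (l2_add M F G) x"
      using rep_mult_op[OF h FG(1)] rep_mult_op[OF h FG(2)] rep_add[OF FG]
        rep_add[OF mult_op_L2[OF h FG(1)] mult_op_L2[OF h FG(2)]]
      by eventually_elim (simp add: distrib_left)
    then show "mult_op M h (l2_add M F G) = l2_add M (mult_op M h F) (mult_op M h G)"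
      by (intro mult_op_eqI h L2_in mult_op_L2 FG)
  next
    fix c F assume F: "F \<in> L2 M"
    have "AE x in M. rep (l2_scale M c (mult_op M h F)) x = h x * rep (l2_scale M c F) x"
      using rep_mult_op[OF h F] rep_scale[OF F, of c] rep_scale[OF mult_op_L2[OF h F], of c]
      by eventually_elim simp
    then show "mult_op M h (l2_scale M c F) = l2_scale M c (mult_op M h F)"
      by (intro mult_op_eqI h L2_in mult_op_L2 F)
  next
    fix F assume F: "F \<in> L2 M"
    have "(l2_norm M (mult_op M h F))\<^sup>2 = (LINT x|M. (cmod (h x * rep F x))\<^sup>2)"
      by (intro norm_cong mult_op_L2 h F mult_sqi rep_mult_op)
    also have "\<dots> \<le> (LINT x|M. C\<^sup>2 * (cmod (rep F x))\<^sup>2)"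
    proof (rule integral_mono_AE)
      show "integrable M (\<lambda>x. (cmod (h x * rep F x))\<^sup>2)"
        using mult_sqi[OF h F] by (simp add: sqi_def)
      show "AE x in M. (cmod (h x * rep F x))\<^sup>2 \<le> C\<^sup>2 * (cmod (rep F x))\<^sup>2"
        using C by eventually_elim
          (auto simp: norm_mult power_mult_distrib intro!: mult_right_mono power_mono)
    qed (use rep_integrable[OF F] in auto)
    also have "\<dots> = C\<^sup>2 * (l2_norm M F)\<^sup>2"
      by (simp add: norm_sq)
    finally show "(l2_norm M (mult_op M h F))\<^sup>2 \<le> C\<^sup>2 * (l2_norm M F)\<^sup>2" .
  next
    show "mult_op M h \<in> extensional (L2 M)"
      by (simp add: mult_op_def)
  qed (auto simp: h mult_op_L2)
qed

lemma mult_op_cong_AE: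
  assumes "ess_bounded M h" "ess_bounded M k" "AE x in M. h x = k x"
  shows "mult_op M h = mult_op M k"
proof (rule op_eqI[OF mult_op_in mult_op_in, OF assms(1,2)])
  fix F assume F: "F \<in> L2 M"
  have "AE x in M. rep (mult_op M k F) x = h x * rep F x"
    using rep_mult_op[OF assms(2) F] assms(3) by eventually_elim simp
  then show "mult_op M h F = mult_op M k F"
    by (intro mult_op_eqI assms mult_op_L2 F)
qed

abbreviation Pr :: "'a measure \<Rightarrow> 'a set \<Rightarrow> ('a, 'a) oper" where
  "Pr M \<alpha> \<equiv> mult_op M (indicator \<alpha>)"

lemma ess_bounded_indicator: "\<alpha> \<in> sets M \<Longrightarrow> ess_bounded M (indicator \<alpha>)"
  unfolding ess_bounded_def by (intro conjI exI[of _ 1]) (auto simp: indicator_def)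

lemmas Pr_L2 = mult_op_L2[OF ess_bounded_indicator]
lemmas rep_Pr = rep_mult_op[OF ess_bounded_indicator]
lemmas Pr_in = mult_op_in[OF ess_bounded_indicator]
lemmas PrD = bounded_opsD[OF Pr_in]

lemma Pr_masa: "\<alpha> \<in> sets M \<Longrightarrow> Pr M \<alpha> \<in> mult_masa M"
  using ess_bounded_indicator mult_masa_iff by blast

lemma Pr_Pr:
  assumes "\<alpha> \<in> sets M" "\<beta> \<in> sets M" "F \<in> L2 M"
  shows "Pr M \<alpha> (Pr M \<beta> F) = Pr M (\<alpha> \<inter> \<beta>) F"
proof -
  have "AE x in M. rep (Pr M (\<alpha> \<inter> \<beta>) F) x = indicator \<alpha> x * rep (Pr M \<beta> F) x"
    using rep_Pr[OF assms(2,3)] rep_Pr[OF sets.Int[OF assms(1,2)] assms(3)]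
    by eventually_elim (simp add: indicator_inter_arith)
  then show ?thesis
    by (intro mult_op_eqI ess_bounded_indicator Pr_L2 assms sets.Int)
qed

lemma Pr_cong: "\<alpha> \<in> sets M \<Longrightarrow> \<beta> \<in> sets M \<Longrightarrow> AE x in M. x \<in> \<alpha> \<longleftrightarrow> x \<in> \<beta> \<Longrightarrow> Pr M \<alpha> = Pr M \<beta>"
  by (rule mult_op_cong_AE) (auto simp: ess_bounded_indicator indicator_def)

lemma Pr_projection:
  assumes a: "\<alpha> \<in> sets M"
  shows "Pr M \<alpha> \<in> projections M"
proof (rule projectionsI[OF Pr_in[OF a]])
  show "F \<in> L2 M \<Longrightarrow> Pr M \<alpha> (Pr M \<alpha> F) = Pr M \<alpha> F" for F
    using Pr_Pr[OF a a] by simp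
  fix F G assume FG: "F \<in> L2 M" "G \<in> L2 M"
  have s: "sqi M (\<lambda>x. indicator \<alpha> x * rep F x)" "sqi M (\<lambda>x. indicator \<alpha> x * rep G x)"
    using mult_sqi[OF ess_bounded_indicator[OF a]] FG by auto
  have "l2_inner M (Pr M \<alpha> F) G = (LINT x|M. (indicator \<alpha> x * rep F x) * cnj (rep G x))"
    by (rule inner_cong) (use FG s rep_Pr[OF a FG(1)] Pr_L2[OF a] in \<open>auto intro: rep_sqi\<close>)
  also have "\<dots> = (LINT x|M. rep F x * cnj (indicator \<alpha> x * rep G x))"
    by (intro Bochner_Integration.integral_cong) (auto simp: indicator_def)
  also have "\<dots> = l2_inner M F (Pr M \<alpha> G)"
    by (rule inner_cong[symmetric]) (use FG s rep_Pr[OF a FG(2)] Pr_L2[OF a] in \<open>auto intro: rep_sqi\<close>)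
  finally show "l2_inner M (Pr M \<alpha> F) G = l2_inner M F (Pr M \<alpha> G)" .
qed

lemma Pr_range_iff:
  assumes a: "\<alpha> \<in> sets M"
  shows "F \<in> Pr M \<alpha> ` L2 M \<longleftrightarrow> F \<in> L2 M \<and> (AE x in M. x \<notin> \<alpha> \<longrightarrow> rep F x = 0)"
proof -
  have "Pr M \<alpha> F = F \<longleftrightarrow> (AE x in M. x \<notin> \<alpha> \<longrightarrow> rep F x = 0)" if F: "F \<in> L2 M"
  proof -
    have "(AE x in M. rep (Pr M \<alpha> F) x = rep F x) \<longleftrightarrow> (AE x in M. x \<notin> \<alpha> \<longrightarrow> rep F x = 0)"
      by (rule eventually_subst)
        (use rep_Pr[OF a F] in eventually_elim, auto simp: indicator_def)
    then show ?thesis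
      using L2_eq_iff[OF Pr_L2[OF a F] F] by simp
  qed
  then show ?thesis
    using proj_range_iff[OF Pr_projection[OF a]] by blast
qed

lemma Pr_range_fixed:
  "\<alpha> \<in> sets M \<Longrightarrow> F \<in> Pr M \<alpha> ` L2 M \<Longrightarrow> Pr M \<alpha> F = F"
  using proj_range_iff[OF Pr_projection] by blast

lemma Pr_compl:
  assumes a: "\<alpha> \<in> sets M"
  shows "proj_compl M (Pr M \<alpha>) = Pr M (space M - \<alpha>)"
proof (rule op_eqI[OF proj_compl_in[OF Pr_in[OF a]] Pr_in[OF sets.compl_sets[OF a]]])
  fix F assume F: "F \<in> L2 M"
  note c = sets.compl_sets[OF a]
  have "AE x in M. rep (l2_diff M F (Pr M \<alpha> F)) x = indicator (space M - \<alpha>) x * rep F x"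
    using rep_diff[OF F Pr_L2[OF a F]] rep_Pr[OF a F] AE_space
    by eventually_elim (auto simp: indicator_def)
  then have "Pr M (space M - \<alpha>) F = l2_diff M F (Pr M \<alpha> F)"
    by (intro mult_op_eqI ess_bounded_indicator c L2_in Pr_L2 a F)
  then show "proj_compl M (Pr M \<alpha>) F = Pr M (space M - \<alpha>) F"
    using F by (simp add: proj_compl_def)
qed

lemma Pr_split:
  assumes a: "\<alpha> \<in> sets M" and F: "F \<in> L2 M"
  shows "l2_add M (Pr M \<alpha> F) (Pr M (space M - \<alpha>) F) = F"
proof -
  have "Pr M (space M - \<alpha>) F = l2_diff M F (Pr M \<alpha> F)"
    using Pr_compl[OF a] F by (metis proj_compl_def restrict_apply')
  then show ?thesis
    using l2_add_diff_cancel[OF F Pr_L2[OF a F]] by simp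
qed

lemma Pr_eq_zero_iff:
  assumes a: "\<alpha> \<in> sets M" and F: "F \<in> L2 M"
  shows "Pr M \<alpha> F = l2_zero M \<longleftrightarrow> (AE x in M. x \<in> \<alpha> \<longrightarrow> rep F x = 0)"
proof -
  have "(AE x in M. rep (Pr M \<alpha> F) x = 0) \<longleftrightarrow> (AE x in M. x \<in> \<alpha> \<longrightarrow> rep F x = 0)"
    by (rule eventually_subst) (use rep_Pr[OF a F] in eventually_elim, auto simp: indicator_def)
  then show ?thesis
    using eq_zero_iff[OF Pr_L2[OF a F]] by simp
qed

lemma Pr_zero_iff_compl_range:
  assumes a: "\<alpha> \<in> sets M" and F: "F \<in> L2 M"
  shows "Pr M \<alpha> F = l2_zero M \<longleftrightarrow> F \<in> Pr M (space M - \<alpha>) ` L2 M"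
proof -
  have "(AE x in M. x \<in> \<alpha> \<longrightarrow> rep F x = 0) \<longleftrightarrow> (AE x in M. x \<notin> space M - \<alpha> \<longrightarrow> rep F x = 0)"
    by (rule eventually_subst) (use AE_space in eventually_elim, auto)
  then show ?thesis
    using Pr_eq_zero_iff[OF a F] Pr_range_iff[OF sets.compl_sets[OF a]] F by simp
qed

lemma Pr_null: "\<alpha> \<in> null_sets M \<Longrightarrow> F \<in> L2 M \<Longrightarrow> Pr M \<alpha> F = l2_zero M"
  using AE_not_in[of \<alpha> M] by (subst Pr_eq_zero_iff) (auto elim: eventually_mono)

lemma Pr_space: "F \<in> L2 M \<Longrightarrow> Pr M (space M) F = F"
  by (rule mult_op_eqI) (auto simp: ess_bounded_indicator)

text \<open>If a bounded operator \<open>T\<close> annihilates the functions supported off \<open>\<alpha>\<close>, then it only sees the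
  part of a vector on \<open>\<alpha>\<close>.\<close>

lemma op_Pr_absorb:
  assumes T: "T \<in> bounded_ops M N" and a: "\<alpha> \<in> sets M" and F: "F \<in> L2 M"
    and z: "T (Pr M (space M - \<alpha>) F) = l2_zero N"
  shows "T (Pr M \<alpha> F) = T F"
proof -
  have c: "space M - \<alpha> \<in> sets M"
    using a by auto
  have "T F = T (l2_add M (Pr M \<alpha> F) (Pr M (space M - \<alpha>) F))"
    using Pr_split[OF a F] by simp
  also have "\<dots> = l2_add N (T (Pr M \<alpha> F)) (l2_zero N)"
    using bounded_opsD(2)[OF T Pr_L2[OF a F] Pr_L2[OF c F]] z by simp
  finally show ?thesis
    using l2_add_zero[of "T (Pr M \<alpha> F)" N] bounded_opsD(1)[OF T Pr_L2[OF a F]] by simp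
qed

lemma Pr_absorb:
  assumes a: "\<alpha> \<in> sets M" and F: "F \<in> L2 M"
    and z: "Pr M (space M - \<alpha>) F = l2_zero M"
  shows "Pr M \<alpha> F = F"
  using Pr_split[OF a F] z l2_add_zero[OF Pr_L2[OF a F]] by simp

section \<open>Cyclic vectors and the multiplication masa\<close>

text \<open>A strictly positive square integrable function is a cyclic vector for the multiplication
  operators; it exists since the measure is \<open>\<sigma>\<close>-finite.\<close>

definition cyclic :: "'a measure \<Rightarrow> ('a \<Rightarrow> real) \<Rightarrow> 'a vec \<Rightarrow> bool" where
  "cyclic M w W \<longleftrightarrow> w \<in> borel_measurable M \<and> (\<forall>x. w x > 0) \<and> W \<in> L2 M \<and>
     (AE x in M. rep W x = of_real (w x))"

lemma cyclic_exists:
  assumes "sigma_finite_measure M"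
  obtains w W where "cyclic M w W"
proof -
  obtain w :: "'a \<Rightarrow> real" where w [measurable]: "w \<in> borel_measurable M"
      "\<And>x. w x > 0" "\<And>x. w x \<le> 1" "integrable M w"
    using sigma_finite_measure.obtain_positive_integrable_function[OF assms] by metis
  have "integrable M (\<lambda>x. (w x)\<^sup>2)"
  proof (rule Bochner_Integration.integrable_bound[OF w(4)])
    have "(w x)\<^sup>2 \<le> w x" for x
      using w(2,3)[of x] by (simp add: power2_eq_square mult_left_le)
    then show "AE x in M. norm ((w x)\<^sup>2) \<le> norm (w x)"
      using w(2) by (intro AE_I2) (simp add: less_imp_le)
  qed measurable
  then have "sqi M (\<lambda>x. of_real (w x))"
    by (simp add: sqi_def)
  then have "cyclic M w (ae_class M (\<lambda>x. of_real (w x)))"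
    using w(1,2) rep_ae_class_L2 by (auto simp: cyclic_def ae_class_in_L2)
  then show thesis
    by (rule that)
qed

lemma rep_Pr_cyclic:
  assumes "cyclic M w W" "\<alpha> \<in> sets M"
  shows "AE x in M. rep (Pr M \<alpha> W) x = indicator \<alpha> x * of_real (w x)"
proof -
  have W: "W \<in> L2 M" and "AE x in M. rep W x = of_real (w x)"
    using assms(1) by (auto simp: cyclic_def)
  from this(2) rep_Pr[OF assms(2) W] show ?thesis
    by eventually_elim simp
qed

lemma Pr_cyclic_zero_iff:
  assumes "cyclic M w W" "\<alpha> \<in> sets M"
  shows "Pr M \<alpha> W = l2_zero M \<longleftrightarrow> \<alpha> \<in> null_sets M"
proof -
  have W: "W \<in> L2 M" and w: "AE x in M. rep W x = of_real (w x)" "\<And>x. w x \<noteq> 0"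
    using assms(1) by (auto simp: cyclic_def less_imp_neq[THEN not_sym])
  have "(AE x in M. x \<in> \<alpha> \<longrightarrow> rep W x = 0) \<longleftrightarrow> (AE x in M. x \<notin> \<alpha>)"
    by (rule eventually_subst) (use w(1) in eventually_elim, simp add: w(2))
  then show ?thesis
    using Pr_eq_zero_iff[OF assms(2) W] AE_iff_null_sets[OF assms(2)] by simp
qed

lemma orthogonal_cyclic:
  assumes M: "sigma_finite_measure M" and c: "cyclic M w W" and G: "G \<in> L2 M"
    and orth: "\<And>\<alpha>. \<alpha> \<in> sets M \<Longrightarrow> l2_inner M (Pr M \<alpha> W) G = 0"
  shows "G = l2_zero M"
proof -
  have W: "W \<in> L2 M" and wpos: "\<And>x. w x > 0" and w: "AE x in M. rep W x = of_real (w x)"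
    using c by (auto simp: cyclic_def)
  have "AE x in M. rep W x * cnj (rep G x) = 0"
  proof (rule sigma_finite_measure.density_zero[OF M])
    show "integrable M (\<lambda>x. rep W x * cnj (rep G x))"
      by (intro sqi_integrable_prod rep_sqi W G)
    fix \<alpha> assume a: "\<alpha> \<in> sets M"
    have "0 = (LINT x|M. (indicator \<alpha> x * rep W x) * cnj (rep G x))"
      using orth[OF a] inner_cong[OF mult_sqi[OF ess_bounded_indicator[OF a] W] rep_sqi[OF G]
          Pr_L2[OF a W] G rep_Pr[OF a W]] by simp
    also have "\<dots> = set_lebesgue_integral M \<alpha> (\<lambda>x. rep W x * cnj (rep G x))"
      unfolding set_lebesgue_integral_def
      by (intro Bochner_Integration.integral_cong) (auto simp: indicator_def)
    finally show "set_lebesgue_integral M \<alpha> (\<lambda>x. rep W x * cnj (rep G x)) = 0"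
      by simp
  qed
  then have "AE x in M. rep G x = 0"
    using w by eventually_elim (use wpos in \<open>auto simp: less_imp_neq[THEN not_sym]\<close>)
  then show ?thesis
    using eq_zero_iff[OF G] by blast
qed

text \<open>The orthogonal component in \<open>V\<close> of any vector differs from it by a vector orthogonal to all
  \<open>Pr M \<alpha> W\<close>, whose product with \<open>w\<close> integrates to zero over each measurable set.\<close>

lemma cyclic_total:
  assumes M: "sigma_finite_measure M" and c: "cyclic M w W" and V: "l2_closed_subspace M V"
    and sub: "\<And>\<alpha>. \<alpha> \<in> sets M \<Longrightarrow> Pr M \<alpha> W \<in> V"
  shows "V = L2 M"
proof
  show "V \<subseteq> L2 M"
    using csubD(1)[OF V] .
  show "L2 M \<subseteq> V"
  proof
    fix F assume F: "F \<in> L2 M"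
    obtain G where G: "G \<in> V" "\<And>H. H \<in> V \<Longrightarrow> l2_inner M (l2_diff M F G) H = 0"
      using orthogonal_decomposition[OF V F] by metis
    have GL: "G \<in> L2 M"
      using G(1) csubD(1)[OF V] by auto
    have "l2_diff M F G = l2_zero M"
    proof (rule orthogonal_cyclic[OF M c diff_in[OF F GL]])
      fix \<alpha> assume "\<alpha> \<in> sets M"
      then have "l2_inner M (l2_diff M F G) (Pr M \<alpha> W) = 0"
        by (intro G(2) sub)
      then show "l2_inner M (Pr M \<alpha> W) (l2_diff M F G) = 0"
        using inner_commute by (metis complex_cnj_zero)
    qed
    then show "F \<in> V"
      using l2_diff_eq_zero_iff[OF F GL] G(1) by simp
  qed
qed

text \<open>Comparing integrals over the set where \<open>\<bar>f\<bar>\<^sup>2\<close> exceeds \<open>K w\<^sup>2\<close> is how an operator bound becomes a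
  pointwise bound.\<close>

lemma norm_indicator_le_imp_null:
  assumes "sqi M f" and [measurable]: "\<alpha> \<in> sets M" and K: "\<And>x. x \<in> \<alpha> \<Longrightarrow> K * (w x)\<^sup>2 < (cmod (f x))\<^sup>2"
    and w: "integrable M (\<lambda>x. (w x)\<^sup>2)"
    and le: "(LINT x|M. indicator \<alpha> x * (cmod (f x))\<^sup>2) \<le> K * (LINT x|M. indicator \<alpha> x * (w x)\<^sup>2)"
  shows "\<alpha> \<in> null_sets M"
proof -
  have 1: "integrable M (\<lambda>x. indicator \<alpha> x * (cmod (f x))\<^sup>2)"
      "integrable M (\<lambda>x. indicator \<alpha> x * (w x)\<^sup>2)"
    using assms(1) w by (auto simp: sqi_def intro!: integrable_real_mult_indicator
      simp: mult.commute[of "indicator _ _ :: real"])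
  let ?g = "\<lambda>x. indicator \<alpha> x * (cmod (f x))\<^sup>2 - K * (indicator \<alpha> x * (w x)\<^sup>2)"
  have nn: "?g x \<ge> 0" for x
    using K[of x] by (auto simp: indicator_def)
  have int: "integrable M ?g"
    using 1 by auto
  have "(LINT x|M. ?g x) = 0"
    using 1 le Bochner_Integration.integral_nonneg[of M ?g] nn by simp
  then have "AE x in M. ?g x = 0"
    using integral_nonneg_eq_0_iff_AE[OF int] nn by simp
  then have "AE x in M. x \<notin> \<alpha>"
    by eventually_elim (use K in \<open>fastforce simp: indicator_def split: if_splits\<close>)
  then show ?thesis
    using AE_iff_null_sets[of \<alpha> M] by simp
qed

text \<open>An operator \<open>A\<close> commuting with all \<open>Pr M \<alpha>\<close> is multiplication by \<open>A W / W\<close>: the two agree on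
  the vectors \<open>Pr M \<alpha> W\<close>, and the quotient is essentially bounded since \<open>A\<close> is bounded.\<close>

lemma commutant_masa:
  assumes M: "sigma_finite_measure M" and A: "A \<in> bounded_ops M M"
    and comm: "\<And>\<alpha> F. \<alpha> \<in> sets M \<Longrightarrow> F \<in> L2 M \<Longrightarrow> A (Pr M \<alpha> F) = Pr M \<alpha> (A F)"
  shows "A \<in> mult_masa M"
proof -
  obtain w W where c: "cyclic M w W"
    using cyclic_exists[OF M] by metis
  then have W: "W \<in> L2 M" and wpos: "\<And>x. w x > 0" and w: "AE x in M. rep W x = of_real (w x)"
    and [measurable]: "w \<in> borel_measurable M"
    by (auto simp: cyclic_def)
  have AW: "A W \<in> L2 M"
    using bounded_opsD(1)[OF A W] .
  have [measurable]: "rep (A W) \<in> borel_measurable M" "rep W \<in> borel_measurable M"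
    using AW W by auto
  have wint: "integrable M (\<lambda>x. (w x)\<^sup>2)"
  proof -
    have "integrable M (\<lambda>x. (w x)\<^sup>2) \<longleftrightarrow> integrable M (\<lambda>x. (cmod (rep W x))\<^sup>2)"
      by (rule integrable_cong_AE) (use w in auto)
    then show ?thesis
      using rep_integrable[OF W] by simp
  qed
  obtain K where K: "K > 0" "\<And>F. F \<in> L2 M \<Longrightarrow> (l2_norm M (A F))\<^sup>2 \<le> K * (l2_norm M F)\<^sup>2"
    using op_boundE[OF A] by metis
  define h where "h = (\<lambda>x. rep (A W) x / of_real (w x))"
  have [measurable]: "h \<in> borel_measurable M"
    unfolding h_def by measurable
  define \<alpha> where "\<alpha> = {x \<in> space M. K * (w x)\<^sup>2 < (cmod (rep (A W) x))\<^sup>2}"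
  have a [measurable]: "\<alpha> \<in> sets M"
    unfolding \<alpha>_def by measurable
  have "\<alpha> \<in> null_sets M"
  proof (rule norm_indicator_le_imp_null[OF rep_sqi[OF AW] a _ wint])
    have *: "(cmod (indicator \<alpha> x * z))\<^sup>2 = indicator \<alpha> x * (cmod z)\<^sup>2" for x z
      by (auto simp: indicator_def)
    have "(LINT x|M. indicator \<alpha> x * (cmod (rep (A W) x))\<^sup>2) = (l2_norm M (Pr M \<alpha> (A W)))\<^sup>2"
      using norm_cong[OF Pr_L2[OF a AW] mult_sqi[OF ess_bounded_indicator[OF a] AW] rep_Pr[OF a AW]]
      by (simp add: *)
    also have "\<dots> \<le> K * (l2_norm M (Pr M \<alpha> W))\<^sup>2"
      using K(2)[OF Pr_L2[OF a W]] comm[OF a W] by simp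
    also have "(l2_norm M (Pr M \<alpha> W))\<^sup>2 = (LINT x|M. indicator \<alpha> x * (cmod (rep W x))\<^sup>2)"
      using norm_cong[OF Pr_L2[OF a W] mult_sqi[OF ess_bounded_indicator[OF a] W] rep_Pr[OF a W]]
      by (simp add: *)
    also have "\<dots> = (LINT x|M. indicator \<alpha> x * (w x)\<^sup>2)"
      by (rule integral_cong_AE) (use w in auto)
    finally show "(LINT x|M. indicator \<alpha> x * (cmod (rep (A W) x))\<^sup>2) \<le> K * (LINT x|M. indicator \<alpha> x * (w x)\<^sup>2)" .
  qed (auto simp: \<alpha>_def)
  then have "AE x in M. (cmod (rep (A W) x))\<^sup>2 \<le> K * (w x)\<^sup>2"
    by (rule AE_not_in[THEN eventually_elim2[OF _ AE_space]]) (auto simp: \<alpha>_def)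
  then have "AE x in M. cmod (h x) \<le> sqrt K"
  proof eventually_elim
    case (elim x)
    have "(cmod (h x))\<^sup>2 \<le> (sqrt K)\<^sup>2"
      using elim wpos[of x] K(1) by (simp add: h_def norm_divide power_divide field_simps)
    then show ?case
      by (rule power2_le_imp_le) (use K in simp)
  qed
  then have h: "ess_bounded M h"
    by (auto simp: ess_bounded_def)
  have "{F \<in> L2 M. A F = mult_op M h F} = L2 M"
  proof (rule cyclic_total[OF M c csub_equalizer[OF A mult_op_in[OF h]]])
    fix \<beta> assume b: "\<beta> \<in> sets M"
    have "AE x in M. rep (Pr M \<beta> (A W)) x = h x * rep (Pr M \<beta> W) x"
      using rep_Pr[OF b AW] rep_Pr_cyclic[OF c b]
    proof eventually_elim
      case (elim x)
      then show ?case
        using wpos[of x] by (simp add: h_def)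
    qed
    then have "mult_op M h (Pr M \<beta> W) = Pr M \<beta> (A W)"
      by (intro mult_op_eqI h Pr_L2 b W AW)
    then show "Pr M \<beta> W \<in> {F \<in> L2 M. A F = mult_op M h F}"
      using comm[OF b W] Pr_L2[OF b W] by simp
  qed
  then have "A = mult_op M h"
    by (intro op_eqI[OF A mult_op_in[OF h]]) blast
  then show ?thesis
    using h mult_masa_iff by blast
qed

lemma masa_commute:
  assumes "A \<in> mult_masa M" "\<alpha> \<in> sets M" "F \<in> L2 M"
  shows "A (Pr M \<alpha> F) = Pr M \<alpha> (A F)"
proof -
  obtain h where h: "ess_bounded M h" "A = mult_op M h"
    using assms(1) mult_masa_iff by blast
  note AF = mult_op_L2[OF h(1) assms(3)]
  have "AE x in M. rep (Pr M \<alpha> (A F)) x = h x * rep (Pr M \<alpha> F) x"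
    using rep_Pr[OF assms(2,3)] rep_Pr[OF assms(2) AF] rep_mult_op[OF h(1) assms(3)]
    unfolding h(2) by eventually_elim simp
  then show ?thesis
    unfolding h(2) by (intro mult_op_eqI h Pr_L2 AF assms)
qed

text \<open>As \<open>Pr M \<alpha>\<close> is selfadjoint, the orthogonal complement of the range is invariant as well.\<close>

lemma proj_commute:
  assumes P: "P \<in> projections M" and a: "\<alpha> \<in> sets M" and F: "F \<in> L2 M"
    and inv: "\<And>H. H \<in> P ` L2 M \<Longrightarrow> Pr M \<alpha> H \<in> P ` L2 M"
  shows "P (Pr M \<alpha> F) = Pr M \<alpha> (P F)"
proof (rule decomposition_unique[OF proj_range_csub[OF P]])
  show "P (Pr M \<alpha> F) \<in> P ` L2 M" "Pr M \<alpha> (P F) \<in> P ` L2 M"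
    using Pr_L2[OF a F] inv F by auto
  fix H assume H: "H \<in> P ` L2 M"
  then have HL: "H \<in> L2 M"
    using proj_range_iff[OF P] by blast
  note s = projectionD(3)[OF Pr_projection[OF a]]
  have "l2_inner M (P (Pr M \<alpha> F)) H = l2_inner M (Pr M \<alpha> F) H"
    by (rule proj_inner[OF P Pr_L2[OF a F] H])
  also have "\<dots> = l2_inner M F (Pr M \<alpha> H)"
    by (rule s[OF F HL])
  also have "\<dots> = l2_inner M (P F) (Pr M \<alpha> H)"
    by (rule proj_inner[OF P F inv[OF H], symmetric])
  also have "\<dots> = l2_inner M (Pr M \<alpha> (P F)) H"
    by (rule s[OF projectionD(4)[OF P F] HL, symmetric])
  finally show "l2_inner M (P (Pr M \<alpha> F)) H = l2_inner M (Pr M \<alpha> (P F)) H" .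
qed

text \<open>The projection onto an invariant subspace commutes with the masa, so it is multiplication by an
  idempotent function, the indicator of a set.\<close>

lemma invariant_subspace:
  assumes M: "sigma_finite_measure M" and V: "l2_closed_subspace M V"
    and inv: "\<And>\<alpha> F. \<alpha> \<in> sets M \<Longrightarrow> F \<in> V \<Longrightarrow> Pr M \<alpha> F \<in> V"
  obtains \<alpha> where "\<alpha> \<in> sets M" "V = Pr M \<alpha> ` L2 M"
proof -
  obtain P where P: "P \<in> projections M" "P ` L2 M = V"
    using projection_exists[OF V] by metis
  have "P \<in> mult_masa M"
    using P inv by (intro commutant_masa[OF M projectionD(1)[OF P(1)]] proj_commute) auto
  then obtain h where h: "ess_bounded M h" "P = mult_op M h"
    using mult_masa_iff by blast
  have [measurable]: "h \<in> borel_measurable M"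
    using h(1) by (simp add: ess_bounded_def)
  obtain w W where c: "cyclic M w W"
    using cyclic_exists[OF M] by metis
  then have W: "W \<in> L2 M" and wpos: "\<And>x. w x > 0" and w: "AE x in M. rep W x = of_real (w x)"
    by (auto simp: cyclic_def)
  have "AE x in M. rep (mult_op M h (mult_op M h W)) x = rep (mult_op M h W) x"
    using projectionD(2)[OF P(1) W] h(2) by simp
  then have "AE x in M. h x * (h x * of_real (w x)) = h x * of_real (w x)"
    using rep_mult_op[OF h(1) W] rep_mult_op[OF h(1) mult_op_L2[OF h(1) W]] w
    by eventually_elim simp
  then have "AE x in M. h x = indicator {x \<in> space M. h x = 1} x"
    using AE_space
  proof eventually_elim
    case (elim x)
    then have "h x * h x = h x"
      using wpos[of x] by simp
    then show ?case
      using elim(2) by (auto simp: indicator_def)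
  qed
  moreover have "{x \<in> space M. h x = 1} \<in> sets M"
    by measurable
  ultimately have "P = Pr M {x \<in> space M. h x = 1}"
    unfolding h(2) by (intro mult_op_cong_AE h ess_bounded_indicator)
  then show thesis
    using that[of "{x \<in> space M. h x = 1}"] P(2) by auto
qed

text \<open>Vectors of the form \<open>u w\<close>, with \<open>u\<close> measurable for a sub-\<open>\<sigma>\<close>-algebra, form a closed subspace
  since \<open>L\<^sup>2\<close>-limits are almost everywhere limits along a fast sequence.\<close>

lemma csub_subalgebra_functions:
  assumes c: "cyclic M w W"
  shows "l2_closed_subspace M {F \<in> L2 M. \<exists>u\<in>borel_measurable A. AE x in M. rep F x = u x * of_real (w x)}"
    (is "l2_closed_subspace M ?V")
proof (rule csubI)
  have VI: "F \<in> ?V" if "F \<in> L2 M" "u \<in> borel_measurable A" "AE x in M. rep F x = u x * of_real (w x)" for F u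
    using that by blast
  show "?V \<subseteq> L2 M"
    by blast
  have "AE x in M. rep (l2_zero M) x = 0 * of_real (w x)"
    using rep_zero[of M] by simp
  then show "l2_zero M \<in> ?V"
    by (rule VI[OF zero_in, rotated]) simp
  show "l2_add M F G \<in> ?V" if FG: "F \<in> ?V" "G \<in> ?V" for F G
  proof -
    obtain u v where uv: "u \<in> borel_measurable A" "AE x in M. rep F x = u x * of_real (w x)"
      "v \<in> borel_measurable A" "AE x in M. rep G x = v x * of_real (w x)" and i: "F \<in> L2 M" "G \<in> L2 M"
      using FG by blast
    have "AE x in M. rep (l2_add M F G) x = (u x + v x) * of_real (w x)"
      using uv(2,4) rep_add[OF i] by eventually_elim (simp add: distrib_right)
    then show ?thesis
      by (rule VI[OF add_in[OF i], rotated]) (rule borel_measurable_add[OF uv(1,3)])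
  qed
  show "l2_scale M d F \<in> ?V" if F: "F \<in> ?V" for F d
  proof -
    obtain u where u: "u \<in> borel_measurable A" "AE x in M. rep F x = u x * of_real (w x)" and i: "F \<in> L2 M"
      using F by blast
    have "AE x in M. rep (l2_scale M d F) x = (d * u x) * of_real (w x)"
      using u(2) rep_scale[OF i, of d] by eventually_elim simp
    then show ?thesis
      by (rule VI[OF scale_in[OF i], rotated]) (use u(1) in measurable)
  qed
  fix F assume F: "F \<in> L2 M" and lim: "\<And>e. e > 0 \<Longrightarrow> \<exists>G\<in>?V. (l2_norm M (l2_diff M F G))\<^sup>2 < e"
  have "\<forall>k. \<exists>G. G \<in> ?V \<and> (l2_norm M (l2_diff M F G))\<^sup>2 < (1/2) ^ k"
    using lim[of "(1/2) ^ k" for k] by fastforce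
  then obtain G where "\<forall>k. G k \<in> ?V \<and> (l2_norm M (l2_diff M F (G k)))\<^sup>2 < (1/2) ^ k"
    by (rule choice[THEN exE])
  then have G: "\<And>k. G k \<in> ?V" "\<And>k. (l2_norm M (l2_diff M F (G k)))\<^sup>2 < (1/2) ^ k"
    by blast+
  have GL: "G k \<in> L2 M" for k
    using G(1)[of k] by simp
  have "\<forall>k. \<exists>u. u \<in> borel_measurable A \<and> (AE x in M. rep (G k) x = u x * of_real (w x))"
    using G(1) by blast
  then obtain u where "\<forall>k. u k \<in> borel_measurable A \<and> (AE x in M. rep (G k) x = u k x * of_real (w x))"
    by (rule choice[THEN exE])
  then have u: "\<And>k. u k \<in> borel_measurable A" "\<And>k. AE x in M. rep (G k) x = u k x * of_real (w x)"
    by blast+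
  have wpos: "\<And>x. w x > 0"
    using c by (auto simp: cyclic_def)
  have "AE x in M. summable (\<lambda>k. (cmod (rep F x - rep (G k) x))\<^sup>2)"
  proof (rule AE_summable)
    fix k
    show "integrable M (\<lambda>x. (cmod (rep F x - rep (G k) x))\<^sup>2)"
      using sqi_diff[OF rep_sqi[OF F] rep_sqi[OF GL]] by (simp add: sqi_def)
  next
    have "(LINT x|M. (cmod (rep F x - rep (G k) x))\<^sup>2) \<le> (1/2) ^ k" for k
      using G(2)[of k] norm_cong[OF diff_in[OF F GL] sqi_diff[OF rep_sqi[OF F] rep_sqi[OF GL]] rep_diff[OF F GL]]
      by simp
    then show "summable (\<lambda>k. LINT x|M. (cmod (rep F x - rep (G k) x))\<^sup>2)"
      by (intro summable_comparison_test'[OF summable_geometric[of "1/2::real"]]) auto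
  qed simp
  then have "AE x in M. (\<lambda>k. rep (G k) x) \<longlonglongrightarrow> rep F x"
  proof eventually_elim
    case (elim x)
    have "(\<lambda>k. (cmod (rep F x - rep (G k) x))\<^sup>2) \<longlonglongrightarrow> 0"
      using elim by (rule summable_LIMSEQ_zero)
    then have "(\<lambda>k. sqrt ((cmod (rep F x - rep (G k) x))\<^sup>2)) \<longlonglongrightarrow> sqrt 0"
      by (rule tendsto_real_sqrt)
    then have "(\<lambda>k. rep F x - rep (G k) x) \<longlonglongrightarrow> 0"
      by (simp add: tendsto_norm_zero_iff)
    then have "(\<lambda>k. rep F x - (rep F x - rep (G k) x)) \<longlonglongrightarrow> rep F x - 0"
      by (intro tendsto_diff tendsto_const)
    then show ?case
      by simp
  qed
  moreover have "AE x in M. \<forall>k. rep (G k) x = u k x * of_real (w x)"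
    using u(2) by (simp add: AE_all_countable)
  ultimately have "AE x in M. rep F x = lim (\<lambda>k. u k x) * of_real (w x)"
  proof eventually_elim
    case (elim x)
    then have "(\<lambda>k. u k x * of_real (w x) / of_real (w x)) \<longlonglongrightarrow> rep F x / of_real (w x)"
      using wpos[of x] by (intro tendsto_divide) auto
    then have "lim (\<lambda>k. u k x) = rep F x / of_real (w x)"
      using wpos[of x] by (simp add: limI)
    then show ?case
      using wpos[of x] by simp
  qed
  moreover have "(\<lambda>x. lim (\<lambda>k. u k x)) \<in> borel_measurable A"
    using u(1) by measurable
  ultimately show "F \<in> ?V"
    using VI[OF F] by blast
qed

text \<open>Only the algebra of all measurable sets has a commutant inside the multiplication masa: for a
  sub-\<open>\<sigma>\<close>-algebra, the projection onto the closed span of the vectors \<open>Pr M \<gamma> W\<close> with \<open>\<gamma>\<close> in it (a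
  conditional expectation) commutes with it and fixes \<open>W\<close>, so it is a multiplication operator only
  if it is the identity. Then every \<open>Pr M \<alpha> W\<close> has the form \<open>u w\<close> with \<open>u\<close> measurable for the
  sub-\<open>\<sigma>\<close>-algebra, and \<open>\<alpha>\<close> is almost the set where \<open>u = 1\<close>.\<close>

lemma subalgebra_full:
  assumes M: "sigma_finite_measure M" and sub: "space A = space M" "sets A \<subseteq> sets M"
    and comm: "\<And>T. T \<in> bounded_ops M M \<Longrightarrow>
      (\<And>\<alpha> F. \<alpha> \<in> sets A \<Longrightarrow> F \<in> L2 M \<Longrightarrow> T (Pr M \<alpha> F) = Pr M \<alpha> (T F)) \<Longrightarrow> T \<in> mult_masa M"
    and a: "\<alpha> \<in> sets M"
  obtains \<beta> where "\<beta> \<in> sets A" "AE x in M. x \<in> \<alpha> \<longleftrightarrow> x \<in> \<beta>"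
proof -
  have AM: "\<And>\<gamma>. \<gamma> \<in> sets A \<Longrightarrow> \<gamma> \<in> sets M" and sp: "space A = space M"
    using sub by auto
  obtain w W where c: "cyclic M w W"
    using cyclic_exists[OF M] by metis
  then have W: "W \<in> L2 M" and wpos: "\<And>x. w x > 0" and w: "AE x in M. rep W x = of_real (w x)"
    by (auto simp: cyclic_def)
  define S where "S = {Pr M \<gamma> W | \<gamma>. \<gamma> \<in> sets A}"
  have SL: "S \<subseteq> L2 M"
    using Pr_L2[OF AM W] by (auto simp: S_def)
  define V where "V = closed_span M S"
  have V: "l2_closed_subspace M V"
    unfolding V_def by (rule closed_span_csub[OF SL])
  have SV: "Pr M \<gamma> W \<in> V" if "\<gamma> \<in> sets A" for \<gamma>
    using closed_span_superset[of S M] that by (auto simp: V_def S_def)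
  have inv: "Pr M \<gamma> F \<in> V" if g: "\<gamma> \<in> sets A" and "F \<in> V" for \<gamma> F
  proof -
    have "V \<subseteq> {F \<in> L2 M. Pr M \<gamma> F \<in> V}"
      unfolding V_def
    proof (rule closed_span_minimal)
      show "l2_closed_subspace M {F \<in> L2 M. Pr M \<gamma> F \<in> closed_span M S}"
        using csub_preimage[OF Pr_in[OF AM[OF g]] V] by (simp add: V_def)
      show "S \<subseteq> {F \<in> L2 M. Pr M \<gamma> F \<in> closed_span M S}"
      proof
        fix F assume "F \<in> S"
        then obtain \<delta> where d: "\<delta> \<in> sets A" "F = Pr M \<delta> W"
          by (auto simp: S_def)
        then show "F \<in> {F \<in> L2 M. Pr M \<gamma> F \<in> closed_span M S}"
          using SV[OF sets.Int[OF g d(1)]] Pr_Pr[OF AM[OF g] AM[OF d(1)] W] Pr_L2[OF AM[OF d(1)] W]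
          by (simp add: V_def)
      qed
    qed
    then show ?thesis
      using that(2) by auto
  qed
  obtain P where P: "P \<in> projections M" "P ` L2 M = V"
    using projection_exists[OF V] by metis
  have masa: "P \<in> mult_masa M"
  proof (rule comm[OF projectionD(1)[OF P(1)]])
    show "P (Pr M \<gamma> F) = Pr M \<gamma> (P F)" if "\<gamma> \<in> sets A" "F \<in> L2 M" for \<gamma> F
      by (rule proj_commute[OF P(1) AM[OF that(1)] that(2)]) (use inv that P(2) in auto)
  qed
  have "P W = W"
    using SV[OF sets.top] Pr_space[OF W] P proj_range_iff[OF P(1), of W] by (simp add: sp)
  then have "P (Pr M \<alpha> W) = Pr M \<alpha> W"
    using masa_commute[OF masa a W] by simp
  then have "Pr M \<alpha> W \<in> V"
    using P proj_range_iff[OF P(1), of "Pr M \<alpha> W"] Pr_L2[OF a W] by simp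
  moreover have "V \<subseteq> {F \<in> L2 M. \<exists>u\<in>borel_measurable A. AE x in M. rep F x = u x * of_real (w x)}"
    unfolding V_def
  proof (rule closed_span_minimal[OF _ csub_subalgebra_functions[OF c]])
    show "S \<subseteq> {F \<in> L2 M. \<exists>u\<in>borel_measurable A. AE x in M. rep F x = u x * of_real (w x)}"
    proof
      fix F assume "F \<in> S"
      then obtain \<delta> where d: "\<delta> \<in> sets A" "F = Pr M \<delta> W"
        by (auto simp: S_def)
      show "F \<in> {F \<in> L2 M. \<exists>u\<in>borel_measurable A. AE x in M. rep F x = u x * of_real (w x)}"
        using rep_Pr_cyclic[OF c AM[OF d(1)]] Pr_L2[OF AM[OF d(1)] W] d
        by (intro CollectI conjI bexI[of _ "indicator \<delta>"]) auto
    qed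
  qed
  ultimately obtain u where u: "u \<in> borel_measurable A" "AE x in M. rep (Pr M \<alpha> W) x = u x * of_real (w x)"
    by auto
  have "AE x in M. x \<in> \<alpha> \<longleftrightarrow> x \<in> {x \<in> space A. u x = 1}"
    using u(2) rep_Pr_cyclic[OF c a] AE_space
  proof eventually_elim
    case (elim x)
    then have "indicator \<alpha> x = u x"
      using wpos[of x] by simp
    then show ?case
      using elim(3) sp by (auto simp: indicator_def split: if_splits)
  qed
  moreover have "{x \<in> space A. u x = 1} \<in> sets A"
    using u(1) by measurable
  ultimately show thesis
    using that by blast
qed

section \<open>Rank one operators\<close>

lemma rank_one_in:
  assumes "G \<in> L2 M" "H \<in> L2 N"
  shows "(\<lambda>F\<in>L2 M. l2_scale N (l2_inner M F G) H) \<in> bounded_ops M N"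
proof (rule bounded_opsI[where K = "(l2_norm M G)\<^sup>2 * (l2_norm N H)\<^sup>2"])
  fix F F' assume F: "F \<in> L2 M" "F' \<in> L2 M"
  have "l2_scale N (a + b) H = l2_add N (l2_scale N a H) (l2_scale N b H)" for a b
  proof (rule L2_eqI)
    show "AE x in N. rep (l2_scale N (a + b) H) x = rep (l2_add N (l2_scale N a H) (l2_scale N b H)) x"
      using rep_scale[OF assms(2), of "a + b"] rep_scale[OF assms(2), of a] rep_scale[OF assms(2), of b]
        rep_add[OF scale_in[OF assms(2)] scale_in[OF assms(2)], of a b]
      by eventually_elim (simp add: distrib_right)
  qed (use assms in \<open>auto intro: L2_in\<close>)
  then show "(\<lambda>F\<in>L2 M. l2_scale N (l2_inner M F G) H) (l2_add M F F') =
      l2_add N ((\<lambda>F\<in>L2 M. l2_scale N (l2_inner M F G) H) F) ((\<lambda>F\<in>L2 M. l2_scale N (l2_inner M F G) H) F')"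
    using F assms by (simp add: inner_simps L2_in)
next
  fix c F assume F: "F \<in> L2 M"
  have "l2_scale N (c * a) H = l2_scale N c (l2_scale N a H)" for a
  proof (rule L2_eqI)
    show "AE x in N. rep (l2_scale N (c * a) H) x = rep (l2_scale N c (l2_scale N a H)) x"
      using rep_scale[OF assms(2), of "c * a"] rep_scale[OF assms(2), of a]
        rep_scale[OF scale_in[OF assms(2)], of c a]
      by eventually_elim simp
  qed (use assms in \<open>auto intro: L2_in\<close>)
  then show "(\<lambda>F\<in>L2 M. l2_scale N (l2_inner M F G) H) (l2_scale M c F) =
      l2_scale N c ((\<lambda>F\<in>L2 M. l2_scale N (l2_inner M F G) H) F)"
    using F assms by (simp add: inner_simps L2_in)
next
  fix F assume F: "F \<in> L2 M"
  have "(cmod (l2_inner M F G))\<^sup>2 \<le> (l2_norm M F * l2_norm M G)\<^sup>2"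
    by (intro power_mono cauchy_schwarz F assms) simp
  then have "(cmod (l2_inner M F G))\<^sup>2 * (l2_norm N H)\<^sup>2 \<le> (l2_norm M F * l2_norm M G)\<^sup>2 * (l2_norm N H)\<^sup>2"
    by (rule mult_right_mono) simp
  then show "(l2_norm N ((\<lambda>F\<in>L2 M. l2_scale N (l2_inner M F G) H) F))\<^sup>2
      \<le> (l2_norm M G)\<^sup>2 * (l2_norm N H)\<^sup>2 * (l2_norm M F)\<^sup>2"
    using F by (simp add: norm_scale[OF assms(2)] power_mult_distrib mult_ac)
qed (use assms in \<open>auto intro: L2_in\<close>)

text \<open>A rank one operator from functions supported off \<open>\<alpha>\<close> to functions supported on \<open>\<alpha>\<close> does not
  commute with \<open>Pr M \<alpha>\<close>, unless it vanishes.\<close>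

lemma rank_one_not_masa:
  assumes M: "sigma_finite_measure M" and a: "\<alpha> \<in> sets M"
    and masa: "\<And>A. A \<in> bounded_ops M M \<Longrightarrow> (\<And>F. F \<in> L2 M \<Longrightarrow> Pr M \<alpha> (A F) = A F) \<Longrightarrow>
      (\<And>F. F \<in> L2 M \<Longrightarrow> A (Pr M \<alpha> F) = l2_zero M) \<Longrightarrow> A \<in> mult_masa M"
  shows "\<alpha> \<in> null_sets M \<or> space M - \<alpha> \<in> null_sets M"
proof -
  obtain w W where c: "cyclic M w W"
    using cyclic_exists[OF M] by metis
  then have W: "W \<in> L2 M"
    by (auto simp: cyclic_def)
  have ca: "space M - \<alpha> \<in> sets M"
    using a by auto
  let ?G = "Pr M (space M - \<alpha>) W" and ?H = "Pr M \<alpha> W"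
  note i = Pr_L2[OF ca W] Pr_L2[OF a W]
  define A where "A = (\<lambda>F\<in>L2 M. l2_scale M (l2_inner M F ?G) ?H)"
  have A: "A \<in> bounded_ops M M"
    unfolding A_def by (intro rank_one_in i)
  have 1: "Pr M \<alpha> (A F) = A F" if "F \<in> L2 M" for F
    using that i PrD(3)[OF a i(2)] Pr_Pr[OF a a W] by (simp add: A_def)
  have 2: "A (Pr M \<alpha> F) = l2_zero M" if F: "F \<in> L2 M" for F
  proof -
    have "l2_inner M (Pr M \<alpha> F) ?G = l2_inner M F (Pr M \<alpha> ?G)"
      by (rule projectionD(3)[OF Pr_projection[OF a] F i(1)])
    also have "Pr M \<alpha> ?G = l2_zero M"
      using Pr_Pr[OF a ca W] Pr_null[of "{}" M W] W by (simp add: Diff_disjoint)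
    finally show ?thesis
      using F i Pr_L2[OF a F] by (simp add: A_def inner_zero_right l2_scale_0)
  qed
  have "A ?G = l2_zero M"
    using masa_commute[OF masa[OF A 1 2] a i(1)] 1[OF i(1)] 2[OF i(1)] by simp
  then have "l2_scale M (of_real ((l2_norm M ?G)\<^sup>2)) ?H = l2_zero M"
    using i by (simp only: A_def restrict_apply' inner_self)
  then have "(l2_norm M (l2_scale M (of_real ((l2_norm M ?G)\<^sup>2)) ?H))\<^sup>2 = 0"
    by (simp add: norm_zero)
  then have "l2_norm M ?G = 0 \<or> l2_norm M ?H = 0"
    unfolding norm_scale[OF i(2)] by simp
  then show ?thesis
    using norm_eq_0_iff[OF i(1)] norm_eq_0_iff[OF i(2)] Pr_cyclic_zero_iff[OF c ca] Pr_cyclic_zero_iff[OF c a]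
    by blast
qed

section \<open>Coding a standard space by sequences of zeros and ones\<close>

text \<open>Coordinate \<open>prod_encode (n, k)\<close> of the code of a point records whether the point lies in the
  ball of radius \<open>(1/2) ^ k\<close> around the \<open>n\<close>-th point of a dense sequence.\<close>

definition ball_code :: "('a \<Rightarrow> 'a \<Rightarrow> real) \<Rightarrow> (nat \<Rightarrow> 'a) \<Rightarrow> 'a \<Rightarrow> nat \<Rightarrow> real" where
  "ball_code d p x i = (case prod_decode i of (n, k) \<Rightarrow> if d x (p n) < (1/2) ^ k then 1 else 0)"

text \<open>The filters of basic balls that converge to a point: the conditions express, in terms of
  centres and radii only, that the balls marked by \<open>z\<close> are arbitrarily small, closed under formal
  enlargement, shrink strictly inside each other, and pairwise formally meet.\<close>

definition ball_codes :: "('a \<Rightarrow> 'a \<Rightarrow> real) \<Rightarrow> (nat \<Rightarrow> 'a) \<Rightarrow> (nat \<Rightarrow> real) set" where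
  "ball_codes d p = {z. (\<forall>i. z i = 0 \<or> z i = 1) \<and>
     (\<forall>k. \<exists>n. z (prod_encode (n, k)) = 1) \<and>
     (\<forall>n k m l. z (prod_encode (n, k)) = 1 \<longrightarrow> d (p n) (p m) + (1/2) ^ k \<le> (1/2) ^ l \<longrightarrow>
        z (prod_encode (m, l)) = 1) \<and>
     (\<forall>n k. z (prod_encode (n, k)) = 1 \<longrightarrow>
        (\<exists>m l. z (prod_encode (m, l)) = 1 \<and> d (p n) (p m) + (1/2) ^ l < (1/2) ^ k)) \<and>
     (\<forall>n k m l. z (prod_encode (n, k)) = 1 \<longrightarrow> z (prod_encode (m, l)) = 1 \<longrightarrow>
        d (p n) (p m) < (1/2) ^ k + (1/2) ^ l)}"

lemma ball_code_encode: "ball_code d p x (prod_encode (n, k)) = (if d x (p n) < (1/2) ^ k then 1 else 0)"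
  by (simp add: ball_code_def)

lemma half_power_small:
  fixes e :: real
  assumes "e > 0"
  obtains k where "2 * (1/2) ^ k \<le> e"
proof -
  obtain k where "(1/2) ^ k < e / 2"
    using real_arch_pow_inv[of "e / 2" "1/2"] assms by auto
  then show thesis
    by (intro that[of k]) simp
qed

lemma coordinate_measurable [measurable]: "(\<lambda>z :: nat \<Rightarrow> real. z i) \<in> borel_measurable borel"
  by (intro borel_measurable_continuous_onI continuous_on_product_coordinates)

lemma ball_codes_borel: "ball_codes d p \<in> sets borel"
proof -
  have "{z \<in> space borel. (\<forall>i. z i = 0 \<or> z i = 1) \<and>
     (\<forall>k. \<exists>n. z (prod_encode (n, k)) = 1) \<and>
     (\<forall>n k m l. z (prod_encode (n, k)) = 1 \<longrightarrow> d (p n) (p m) + (1/2) ^ k \<le> (1/2) ^ l \<longrightarrow>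
        z (prod_encode (m, l)) = 1) \<and>
     (\<forall>n k. z (prod_encode (n, k)) = 1 \<longrightarrow>
        (\<exists>m l. z (prod_encode (m, l)) = 1 \<and> d (p n) (p m) + (1/2) ^ l < (1/2) ^ k)) \<and>
     (\<forall>n k m l. z (prod_encode (n, k)) = 1 \<longrightarrow> z (prod_encode (m, l)) = 1 \<longrightarrow>
        d (p n) (p m) < (1/2) ^ k + (1/2) ^ l)} \<in> sets (borel :: (nat \<Rightarrow> real) measure)"
    by measurable
  then show ?thesis
    by (simp add: ball_codes_def)
qed

lemma (in Metric_space) ball_code_in:
  assumes p: "\<And>n. p n \<in> M" and dense: "\<And>x e. x \<in> M \<Longrightarrow> e > 0 \<Longrightarrow> \<exists>n. d x (p n) < e"
    and x: "x \<in> M"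
  shows "ball_code d p x \<in> ball_codes d p"
proof -
  have "\<exists>n. d x (p n) < (1/2) ^ k" for k :: nat
    using dense[OF x, of "(1/2) ^ k"] by simp
  moreover have "d x (p m) < (1/2) ^ l"
    if "d x (p n) < (1/2) ^ k" "d (p n) (p m) + (1/2) ^ k \<le> (1/2) ^ l" for n k m l
    using triangle[OF x p[of n] p[of m]] that by linarith
  moreover have "\<exists>m l. d x (p m) < (1/2) ^ l \<and> d (p n) (p m) + (1/2) ^ l < (1/2) ^ k"
    if *: "d x (p n) < (1/2) ^ k" for n k
  proof -
    obtain l where l: "2 * (1/2) ^ l \<le> (1/2) ^ k - d x (p n)"
      using half_power_small[of "(1/2) ^ k - d x (p n)"] * by auto
    obtain m where m: "d x (p m) < (1/2) ^ l"
      using dense[OF x, of "(1/2) ^ l"] by auto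
    show ?thesis
      using triangle[OF p[of n] x p[of m]] commute[of x "p n"] l m by (intro exI[of _ m] exI[of _ l]) simp
  qed
  moreover have "d (p n) (p m) < (1/2) ^ k + (1/2) ^ l"
    if "d x (p n) < (1/2) ^ k" "d x (p m) < (1/2) ^ l" for n k m l
    using triangle[OF p[of n] x p[of m]] commute[of x "p n"] that by linarith
  moreover have "ball_code d p x (prod_encode (n, k)) = 1 \<longleftrightarrow> d x (p n) < (1/2) ^ k" for n k
    by (simp add: ball_code_encode)
  moreover have "ball_code d p x i = 0 \<or> ball_code d p x i = 1" for i
    by (simp add: ball_code_def split: prod.split)
  ultimately show ?thesis
    unfolding ball_codes_def by (intro CollectI conjI allI impI) metis+
qed

text \<open>The centres of the marked balls of radius \<open>(1/2) ^ k\<close> form a Cauchy sequence, since marked balls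
  formally meet. Its limit lies in the closure of each marked ball, and strict shrinking places it
  in the open ball; closure under formal enlargement marks every ball around the limit.\<close>

lemma (in Metric_space) ball_code_onto:
  assumes p: "\<And>n. p n \<in> M" and dense: "\<And>x e. x \<in> M \<Longrightarrow> e > 0 \<Longrightarrow> \<exists>n. d x (p n) < e"
    and compl: "mcomplete" and z: "z \<in> ball_codes d p"
  obtains y where "y \<in> M" "z = ball_code d p y"
proof -
  have 1: "\<And>i. z i = 0 \<or> z i = 1" and 2: "\<And>k. \<exists>n. z (prod_encode (n, k)) = 1"
    and 3: "\<And>n k m l. z (prod_encode (n, k)) = 1 \<Longrightarrow> d (p n) (p m) + (1/2) ^ k \<le> (1/2) ^ l \<Longrightarrow>
        z (prod_encode (m, l)) = 1"
    and 4: "\<And>n k. z (prod_encode (n, k)) = 1 \<Longrightarrow>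
        (\<exists>m l. z (prod_encode (m, l)) = 1 \<and> d (p n) (p m) + (1/2) ^ l < (1/2) ^ k)"
    and 5: "\<And>n k m l. z (prod_encode (n, k)) = 1 \<Longrightarrow> z (prod_encode (m, l)) = 1 \<Longrightarrow>
        d (p n) (p m) < (1/2) ^ k + (1/2) ^ l"
    using z unfolding ball_codes_def by blast+
  obtain c where c: "\<And>k. z (prod_encode (c k, k)) = 1"
    using 2 by metis
  define q where "q = (\<lambda>k. p (c k))"
  have "MCauchy q"
    unfolding MCauchy_def
  proof (intro conjI allI impI)
    show "range q \<subseteq> M"
      using p by (auto simp: q_def)
    fix e :: real assume "e > 0"
    then obtain k where k: "2 * (1/2) ^ k \<le> e"
      using half_power_small by blast
    have "d (q i) (q j) < e" if "k \<le> i" "k \<le> j" for i j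
    proof -
      have "(1/2::real) ^ i \<le> (1/2) ^ k" "(1/2::real) ^ j \<le> (1/2) ^ k"
        using that by (auto intro: power_decreasing)
      then show ?thesis
        using 5[OF c[of i] c[of j]] k unfolding q_def by linarith
    qed
    then show "\<exists>N. \<forall>n n'. N \<le> n \<longrightarrow> N \<le> n' \<longrightarrow> d (q n) (q n') < e"
      by blast
  qed
  then obtain y where "limitin mtopology q y sequentially"
    using compl by (auto simp: mcomplete_def)
  then have y: "y \<in> M" and lim: "\<And>e. e > 0 \<Longrightarrow> \<forall>\<^sub>F j in sequentially. d (q j) y < e"
    unfolding limitin_metric by (auto elim: eventually_mono)
  have le: "d y (p n) \<le> (1/2) ^ k" if "z (prod_encode (n, k)) = 1" for n k
  proof (rule field_le_epsilon)
    fix e :: real assume e: "e > 0"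
    then obtain l where l: "2 * (1/2) ^ l \<le> e"
      using half_power_small by blast
    have "\<forall>\<^sub>F j in sequentially. d (q j) y < e / 2 \<and> j \<ge> l"
      using lim[of "e / 2"] e eventually_ge_at_top[of l] by (auto intro: eventually_conj)
    then obtain j where j: "d (q j) y < e / 2" "j \<ge> l"
      using eventually_happens'[OF sequentially_bot] by blast
    have "(1/2::real) ^ j \<le> (1/2) ^ l"
      using j(2) by (auto intro: power_decreasing)
    then show "d y (p n) \<le> (1/2) ^ k + e"
      using triangle[OF y p[of "c j"] p[of n]] commute[of y "p (c j)"] 5[OF c[of j] that] j(1) l
      unfolding q_def by linarith
  qed
  have "z (prod_encode (n, k)) = 1 \<longleftrightarrow> d y (p n) < (1/2) ^ k" for n k
  proof
    assume "z (prod_encode (n, k)) = 1"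
    then obtain m l where m: "z (prod_encode (m, l)) = 1" "d (p n) (p m) + (1/2) ^ l < (1/2) ^ k"
      using 4 by blast
    then show "d y (p n) < (1/2) ^ k"
      using le[OF m(1)] triangle[OF y p[of m] p[of n]] commute[of "p m" "p n"] by linarith
  next
    assume "d y (p n) < (1/2) ^ k"
    then obtain j where j: "2 * (1/2) ^ j \<le> (1/2) ^ k - d y (p n)"
      using half_power_small[of "(1/2) ^ k - d y (p n)"] by auto
    have "d (p (c j)) (p n) + (1/2) ^ j \<le> (1/2) ^ k"
      using le[OF c[of j]] triangle[OF p[of "c j"] y p[of n]] commute[of y "p (c j)"] j by linarith
    then show "z (prod_encode (n, k)) = 1"
      using 3[OF c[of j]] by blast
  qed
  then have *: "z (prod_encode (n, k)) = ball_code d p y (prod_encode (n, k))" for n k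
    using 1[of "prod_encode (n, k)"] by (auto simp: ball_code_encode)
  have "z i = ball_code d p y i" for i
    using *[of "fst (prod_decode i)" "snd (prod_decode i)"] by simp
  then show thesis
    using that[OF y] by blast
qed

lemma sigma_sets_image_borel:
  assumes inj: "inj_on e X" and X: "e ` X \<in> sets B" and G: "\<And>V. V \<in> G \<Longrightarrow> e ` V \<in> sets B"
    and GX: "G \<subseteq> Pow X" and A: "A \<in> sigma_sets X G"
  shows "e ` A \<in> sets B"
  using A
proof (induction rule: sigma_sets.induct)
  case (Compl a)
  have "a \<subseteq> X"
    using sigma_sets_into_sp[OF GX Compl.hyps] .
  then have "e ` (X - a) = e ` X - e ` a"
    using inj by (auto simp: inj_on_def)
  then show ?case
    using X Compl.IH by auto
qed (auto simp: G image_UN)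

text \<open>By completeness the codes of points form the Borel set of convergent filters of balls. The image
  of an open set is cut out of it by the basic balls that the open set contains, and images under
  the injective code commute with complements and unions.\<close>

lemma standard_code:
  fixes M :: "'a measure"
  assumes "standard_measure_space M"
  obtains e :: "'a \<Rightarrow> nat \<Rightarrow> real"
    where "inj_on e (space M)" "\<And>x i. e x i = 0 \<or> e x i = 1" "e \<in> borel_measurable M"
      "\<And>A. A \<in> sets M \<Longrightarrow> e ` A \<in> sets borel"
proof (cases "space M = {}")
  case True
  show thesis
  proof (rule that[of "\<lambda>_ _. 0"])
    fix A assume "A \<in> sets M"
    then have "A = {}"
      using True sets.sets_into_space by blast
    then show "(\<lambda>_ _. 0) ` A \<in> sets borel"
      by simp
  qed (auto simp: True)
next
  case False
  obtain T where T: "completely_metrizable_space T" "second_countable T" "topspace T = space M"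
      "sets M = sigma_sets (space M) {V. openin T V}"
    using assms by (auto simp: standard_measure_space_def)
  obtain X d where "Metric_space X d" and compl: "Metric_space.mcomplete X d"
      and T_eq: "T = Metric_space.mtopology X d"
    using T(1) by (auto simp: completely_metrizable_space_def)
  then interpret Metric_space X d
    by simp
  have X: "X = space M"
    using T(3) T_eq by simp
  have "separable_space T"
    using T(2) by (rule second_countable_imp_separable_space)
  then obtain D where D: "countable D" "D \<subseteq> X" "T closure_of D = X"
    using T_eq by (auto simp: separable_space_def)
  then have "D \<noteq> {}"
    using False X by auto
  define p where "p = from_nat_into D"
  have rp: "range p = D"
    unfolding p_def using \<open>D \<noteq> {}\<close> D(1) by (rule range_from_nat_into)
  have p: "p n \<in> X" for n
    using rp D(2) by auto
  have dense: "\<exists>n. d x (p n) < e" if x: "x \<in> X" and e: "e > 0" for x e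
  proof -
    have "x \<in> T closure_of D"
      using D(3) x by simp
    then obtain y where "y \<in> D" "y \<in> mball x e"
      using e unfolding T_eq metric_closure_of by blast
    then show ?thesis
      using rp by auto
  qed
  let ?e = "ball_code d p"
  have e01: "?e x i = 0 \<or> ?e x i = 1" for x i
    by (auto simp: ball_code_def split: prod.splits)
  have img: "?e ` X = ball_codes d p"
    using ball_code_in[OF p dense] ball_code_onto[OF p dense compl] by blast
  have inj: "inj_on ?e X"
  proof (rule inj_onI, rule ccontr)
    fix x y assume xy: "x \<in> X" "y \<in> X" "?e x = ?e y" "x \<noteq> y"
    then have "d x y > 0"
      by simp
    then obtain k where k: "2 * (1/2) ^ k \<le> d x y"
      using half_power_small by blast
    obtain n where n: "d x (p n) < (1/2) ^ k"
      using dense[OF xy(1), of "(1/2) ^ k"] by auto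
    then have "d y (p n) < (1/2) ^ k"
      using fun_cong[OF xy(3), of "prod_encode (n, k)"] by (simp add: ball_code_encode split: if_splits)
    then show False
      using triangle[OF xy(1) p[of n] xy(2)] n k commute[of y "p n"] by linarith
  qed
  have ball: "{x \<in> X. ?e x i = 1} \<in> sets M" for i
  proof -
    obtain n k where i: "i = prod_encode (n, k)"
      by (metis prod_decode_inverse surj_pair)
    have "{x \<in> X. ?e x i = 1} = mball (p n) ((1/2) ^ k)"
      using p commute by (auto simp: i ball_code_encode)
    moreover have "openin T (mball (p n) ((1/2) ^ k))"
      unfolding T_eq by (rule openin_mball)
    ultimately show ?thesis
      by (simp add: T(4))
  qed
  have meas: "?e \<in> borel_measurable M"
  proof (rule measurable_coordinatewise_then_product)
    fix i
    have "?e x i = (if ?e x i = 1 then 1 else 0)" for x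
      using e01[of x i] by auto
    then have "(\<lambda>x. ?e x i) = (\<lambda>x. if ?e x i = 1 then 1 else 0)"
      by (rule ext)
    moreover have "(\<lambda>x. if ?e x i = 1 then 1 else 0 :: real) \<in> borel_measurable M"
      using ball[of i] unfolding X by (intro measurable_If) auto
    ultimately show "(\<lambda>x. ?e x i) \<in> borel_measurable M"
      by simp
  qed
  show thesis
  proof (rule that[of ?e])
    fix A assume "A \<in> sets M"
    then have "A \<in> sigma_sets X {V. openin T V}"
      using T(4) X by simp
    then show "?e ` A \<in> sets borel"
    proof (rule sigma_sets_image_borel[OF inj, rotated 3])
      show "?e ` X \<in> sets borel"
        unfolding img by (rule ball_codes_borel)
      show "{V. openin T V} \<subseteq> Pow X"
        using openin_subset[of T] T(3) X by auto
      fix V assume "V \<in> {V. openin T V}"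
      then have V: "V \<subseteq> X" "\<And>x. x \<in> V \<Longrightarrow> \<exists>r>0. mball x r \<subseteq> V"
        unfolding T_eq openin_mtopology by auto
      let ?I = "{(n, k). mball (p n) ((1/2) ^ k) \<subseteq> V}"
      have "?e ` V = ball_codes d p \<inter> (\<Union>(n, k)\<in>?I. {z. z (prod_encode (n, k)) = 1})"
      proof (intro equalityI subsetI)
        fix z assume "z \<in> ?e ` V"
        then obtain x where x: "x \<in> V" "z = ?e x"
          by auto
        then have xX: "x \<in> X"
          using V(1) by auto
        obtain r where r: "r > 0" "mball x r \<subseteq> V"
          using V(2)[OF x(1)] by auto
        obtain k where k: "2 * (1/2) ^ k \<le> r"
          using half_power_small[OF r(1)] by blast
        obtain n where n: "d x (p n) < (1/2) ^ k"
          using dense[OF xX, of "(1/2) ^ k"] by auto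
        have "mball (p n) ((1/2) ^ k) \<subseteq> mball x r"
        proof
          fix y assume y: "y \<in> mball (p n) ((1/2) ^ k)"
          then show "y \<in> mball x r"
            using triangle[OF xX p[of n], of y] n k xX by auto
        qed
        then have "(n, k) \<in> ?I"
          using r(2) by auto
        moreover have "z (prod_encode (n, k)) = 1"
          using n x(2) by (simp add: ball_code_encode)
        moreover have "z \<in> ball_codes d p"
          using img xX x(2) by blast
        ultimately show "z \<in> ball_codes d p \<inter> (\<Union>(n, k)\<in>?I. {z. z (prod_encode (n, k)) = 1})"
          by blast
      next
        fix z assume z: "z \<in> ball_codes d p \<inter> (\<Union>(n, k)\<in>?I. {z. z (prod_encode (n, k)) = 1})"
        then obtain n k where nk: "mball (p n) ((1/2) ^ k) \<subseteq> V" "z (prod_encode (n, k)) = 1"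
          by auto
        obtain x where x: "x \<in> X" "z = ?e x"
          using z img by blast
        then have "d x (p n) < (1/2) ^ k"
          using nk(2) by (simp add: ball_code_encode split: if_splits)
        then have "x \<in> V"
          using nk(1) x(1) p[of n] commute[of x "p n"] by auto
        then show "z \<in> ?e ` V"
          using x(2) by blast
      qed
      also have "\<dots> \<in> sets borel"
      proof (intro sets.Int ball_codes_borel sets.countable_UN')
        show "countable ?I"
          by simp
        show "(\<lambda>(n, k). {z :: nat \<Rightarrow> real. z (prod_encode (n, k)) = 1}) ` ?I \<subseteq> sets borel"
        proof -
          have "{z \<in> space (borel :: (nat \<Rightarrow> real) measure). z i = 1} \<in> sets borel" for i
            by measurable
          then show ?thesis
            by (auto simp: image_subset_iff)
        qed
      qed
      finally show "?e ` V \<in> sets borel" .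
    qed
  qed (use inj e01 meas X in auto)
qed

section \<open>Point realizations\<close>

text \<open>Countably many sets, given by the coordinates of the code, separate the points of \<open>N\<close>.\<close>

lemma AE_eq_if_preimages_eq:
  assumes N: "standard_measure_space N" and f: "f \<in> measurable M N" and g: "g \<in> measurable M N"
    and eq: "\<And>\<beta>. \<beta> \<in> sets N \<Longrightarrow> AE x in M. f x \<in> \<beta> \<longleftrightarrow> g x \<in> \<beta>"
  shows "AE x in M. f x = g x"
proof -
  obtain e :: "'a \<Rightarrow> nat \<Rightarrow> real" where e: "inj_on e (space N)" "\<And>x i. e x i = 0 \<or> e x i = 1"
      "e \<in> borel_measurable N"
    using standard_code[OF N] by metis
  have "AE x in M. e (f x) i = e (g x) i" for i
  proof -
    have "{y \<in> space N. e y i = 1} \<in> sets N"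
      using measurable_compose[OF e(3) coordinate_measurable[of i]] by measurable
    from eq[OF this] AE_space show ?thesis
    proof eventually_elim
      case (elim x)
      then have "e (f x) i = 1 \<longleftrightarrow> e (g x) i = 1"
        using measurable_space[OF f] measurable_space[OF g] by simp
      then show ?case
        using e(2) by metis
    qed
  qed
  then have "AE x in M. \<forall>i. e (f x) i = e (g x) i"
    by (simp add: AE_all_countable)
  then show ?thesis
    using AE_space
  proof eventually_elim
    case (elim x)
    then have "e (f x) = e (g x)"
      by auto
    then show ?case
      using inj_onD[OF e(1)] measurable_space[OF f elim(2)] measurable_space[OF g elim(2)] by blast
  qed
qed

lemma sets_borel_fun: "sets (borel :: (nat \<Rightarrow> real) measure)
    = sigma_sets UNIV {{z. z i \<in> A} | i A. A \<in> sets borel}"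
proof -
  have "sets (borel :: (nat \<Rightarrow> real) measure) = sets (Pi\<^sub>M UNIV (\<lambda>_. borel))"
    by (rule sets_PiM_equal_borel[symmetric])
  also have "\<dots> = sigma_sets UNIV {{z. z i \<in> A} | i A. A \<in> sets borel}"
    unfolding sets_PiM_single by (simp add: PiE_def)
  finally show ?thesis .
qed

text \<open>A homomorphism modulo null sets from the measurable sets of a standard space is induced by a
  point map: reading off the coordinates of the codes from the homomorphism gives a map into the
  sequences, and almost every value of it is the code of a point.\<close>

lemma point_realization:
  assumes N: "standard_measure_space N" and ne: "space N \<noteq> {}"
    and \<theta>: "\<And>\<beta>. \<beta> \<in> sets N \<Longrightarrow> \<theta> \<beta> \<in> sets M"
    and full: "AE x in M. x \<in> \<theta> (space N)"
    and compl: "\<And>\<beta>. \<beta> \<in> sets N \<Longrightarrow> AE x in M. x \<in> \<theta> (space N - \<beta>) \<longleftrightarrow> x \<notin> \<theta> \<beta>"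
    and union: "\<And>B :: nat \<Rightarrow> _. (\<And>i. B i \<in> sets N) \<Longrightarrow> AE x in M. x \<in> \<theta> (\<Union>i. B i) \<longleftrightarrow> (\<exists>i. x \<in> \<theta> (B i))"
  obtains f where "f \<in> measurable M N" "\<And>\<beta>. \<beta> \<in> sets N \<Longrightarrow> AE x in M. f x \<in> \<beta> \<longleftrightarrow> x \<in> \<theta> \<beta>"
proof -
  obtain e :: "'a \<Rightarrow> nat \<Rightarrow> real" where e: "inj_on e (space N)" "\<And>x i. e x i = 0 \<or> e x i = 1"
      "e \<in> borel_measurable N" "\<And>A. A \<in> sets N \<Longrightarrow> e ` A \<in> sets borel"
    using standard_code[OF N] by metis
  let ?B = "\<lambda>i. {y \<in> space N. e y i = 1}"
  have B: "?B i \<in> sets N" for i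
    using measurable_compose[OF e(3) coordinate_measurable[of i]] by measurable
  have empty: "AE x in M. x \<notin> \<theta> {}"
    using compl[OF sets.top] full by eventually_elim simp
  define \<psi> where "\<psi> = (\<lambda>x i. indicator (\<theta> (?B i)) x :: real)"
  have \<psi>: "\<psi> \<in> borel_measurable M"
    unfolding \<psi>_def
    by (rule measurable_coordinatewise_then_product) (intro borel_measurable_indicator \<theta> B)
  have pre: "e -` C \<inter> space N \<in> sets N" if "C \<in> sets borel" for C
    using measurable_sets[OF e(3) that] .
  have key: "AE x in M. \<psi> x \<in> C \<longleftrightarrow> x \<in> \<theta> (e -` C \<inter> space N)" if "C \<in> sets borel" for C
    using that unfolding sets_borel_fun
  proof (induction rule: sigma_sets.induct)
    case (Basic C)
    then obtain i A where C: "C = {z. z i \<in> A}"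
      by blast
    \<comment> \<open>Since codes take the values 0 and 1 only, the preimage depends on which of them belong to \<open>A\<close>.\<close>
    have e_iff: "e y i \<in> A \<longleftrightarrow> (if e y i = 1 then 1 \<in> A else 0 \<in> A)" for y
      using e(2)[of y i] by auto
    have \<psi>_iff: "\<psi> x i \<in> A \<longleftrightarrow> (if x \<in> \<theta> (?B i) then 1 \<in> A else 0 \<in> A)" for x
      by (simp add: \<psi>_def indicator_def)
    have pre_eq: "e -` C \<inter> space N =
        (if 1 \<in> A then if 0 \<in> A then space N else ?B i else if 0 \<in> A then space N - ?B i else {})"
      unfolding C using e_iff by auto
    show ?case
      unfolding pre_eq using full empty compl[OF B[of i]]
      by eventually_elim (simp add: C \<psi>_iff)
  next
    case Empty
    then show ?case
      using empty by simp
  next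
    case (Compl C)
    have "C \<in> sets borel"
      using Compl.hyps unfolding sets_borel_fun .
    moreover have "e -` (UNIV - C) \<inter> space N = space N - (e -` C \<inter> space N)"
      by auto
    moreover have "\<psi> x \<in> UNIV - C \<longleftrightarrow> \<psi> x \<notin> C" for x
      by simp
    ultimately show ?case
      using eventually_elim2[OF Compl.IH compl[OF pre[of C]], where R = "\<lambda>x. \<psi> x \<notin> C \<longleftrightarrow>
        x \<in> \<theta> (space N - (e -` C \<inter> space N))"] by simp
  next
    case (Union C)
    have "C i \<in> sets borel" for i
      using Union.hyps unfolding sets_borel_fun .
    then have u1: "AE x in M. x \<in> \<theta> (\<Union>i. e -` C i \<inter> space N) \<longleftrightarrow> (\<exists>i. x \<in> \<theta> (e -` C i \<inter> space N))"
      by (intro union pre)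
    have u2: "AE x in M. \<forall>i. \<psi> x \<in> C i \<longleftrightarrow> x \<in> \<theta> (e -` C i \<inter> space N)"
      using Union.IH by (simp add: AE_all_countable)
    have eq: "e -` (\<Union>i. C i) \<inter> space N = (\<Union>i. e -` C i \<inter> space N)"
      by auto
    show ?case
      unfolding eq using u1 u2 by eventually_elim simp
  qed
  have key': "AE x in M. \<psi> x \<in> e ` \<beta> \<longleftrightarrow> x \<in> \<theta> \<beta>" if b: "\<beta> \<in> sets N" for \<beta>
  proof -
    have "e -` (e ` \<beta>) \<inter> space N = \<beta>"
      using sets.sets_into_space[OF b] inj_onD[OF e(1)] by auto
    then show ?thesis
      using key[OF e(4)[OF b]] by simp
  qed
  obtain y0 where y0: "y0 \<in> space N"
    using ne by auto
  define f where "f = (\<lambda>x. if \<psi> x \<in> e ` space N then inv_into (space N) e (\<psi> x) else y0)"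
  have f_iff: "f x \<in> \<beta> \<longleftrightarrow> (if \<psi> x \<in> e ` space N then \<psi> x \<in> e ` \<beta> else y0 \<in> \<beta>)" if b: "\<beta> \<in> sets N" for x \<beta>
  proof (cases "\<psi> x \<in> e ` space N")
    case True
    then obtain y where y: "y \<in> space N" "\<psi> x = e y"
      by auto
    then have "f x = y"
      using e(1) by (simp add: f_def)
    moreover have "e y \<in> e ` \<beta> \<longleftrightarrow> y \<in> \<beta>"
      using sets.sets_into_space[OF b] inj_onD[OF e(1)] y(1) by auto
    ultimately show ?thesis
      using True y by simp
  qed (simp add: f_def)
  have "f \<in> measurable M N"
  proof (rule measurableI)
    show "f x \<in> space N" for x
      unfolding f_def using y0 by (auto intro: inv_into_into)
    fix \<beta> assume b: "\<beta> \<in> sets N"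
    have [measurable]: "\<psi> \<in> borel_measurable M" "e ` space N \<in> sets borel" "e ` \<beta> \<in> sets borel"
      using \<psi> e(4) b by auto
    have "f -` \<beta> \<inter> space M = {x \<in> space M. if \<psi> x \<in> e ` space N then \<psi> x \<in> e ` \<beta> else y0 \<in> \<beta>}"
      unfolding vimage_def f_iff[OF b] by blast
    also have "\<dots> \<in> sets M"
      by measurable
    finally show "f -` \<beta> \<inter> space M \<in> sets M" .
  qed
  moreover have "AE x in M. f x \<in> \<beta> \<longleftrightarrow> x \<in> \<theta> \<beta>" if b: "\<beta> \<in> sets N" for \<beta>
    using key'[OF b] key'[OF sets.top] full by eventually_elim (simp add: f_iff[OF b])
  ultimately show thesis
    by (rule that)
qed

lemma AE_nonsingular:
  assumes f: "f \<in> measurable M N" and null: "preserves_null_sets M N f" and P: "AE y in N. P y"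
  shows "AE x in M. P (f x)"
proof -
  obtain \<beta> where b: "\<And>y. y \<in> space N - \<beta> \<Longrightarrow> P y" "\<beta> \<in> null_sets N"
    using AE_E3[OF P] by blast
  have "f -` \<beta> \<inter> space M \<in> null_sets M"
    using null b(2) by (auto simp: preserves_null_sets_def)
  from AE_not_in[OF this] AE_space show ?thesis
  proof eventually_elim
    case (elim x)
    then show ?case
      using b(1)[of "f x"] measurable_space[OF f, of x] by blast
  qed
qed

text \<open>Two point maps that induce mutually inverse maps of measurable sets, modulo null sets, are
  mutually inverse almost everywhere, since the measurable sets separate points countably.\<close>

lemma inverse_point_maps:
  assumes M: "standard_measure_space M" and f: "f \<in> measurable M N" and g: "g \<in> measurable N M"
    and null: "preserves_null_sets M N f"
    and \<eta>: "\<And>\<alpha>. \<alpha> \<in> sets M \<Longrightarrow> \<eta> \<alpha> \<in> sets N"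
    and g\<eta>: "\<And>\<alpha>. \<alpha> \<in> sets M \<Longrightarrow> AE y in N. g y \<in> \<alpha> \<longleftrightarrow> y \<in> \<eta> \<alpha>"
    and inv: "\<And>\<alpha>. \<alpha> \<in> sets M \<Longrightarrow> AE x in M. f x \<in> \<eta> \<alpha> \<longleftrightarrow> x \<in> \<alpha>"
  shows "AE x in M. g (f x) = x"
proof -
  have "AE x in M. g (f x) = (\<lambda>x. x) x"
  proof (rule AE_eq_if_preimages_eq[OF M measurable_compose[OF f g], where g = "\<lambda>x. x"])
    fix \<alpha> assume a: "\<alpha> \<in> sets M"
    show "AE x in M. g (f x) \<in> \<alpha> \<longleftrightarrow> x \<in> \<alpha>"
      using AE_nonsingular[OF f null g\<eta>[OF a]] inv[OF a] by eventually_elim simp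
  qed simp
  then show ?thesis .
qed

text \<open>Regularity and Radon--Nikodym densities are applied to finite measures with the same null sets.\<close>

lemma finite_equivalent_measure:
  assumes "sigma_finite_measure M"
  obtains v :: "'a \<Rightarrow> real" where "v \<in> borel_measurable M" "\<And>x. v x > 0"
    "finite_measure (density M (\<lambda>x. ennreal (v x)))" "null_sets (density M (\<lambda>x. ennreal (v x))) = null_sets M"
proof -
  obtain v :: "'a \<Rightarrow> real" where v [measurable]: "v \<in> borel_measurable M" "\<And>x. v x > 0" "integrable M v"
    using sigma_finite_measure.obtain_positive_integrable_function[OF assms] by metis
  have "finite_measure (density M (\<lambda>x. ennreal (v x)))"
  proof (rule finite_measureI)
    have "emeasure (density M (\<lambda>x. ennreal (v x))) (space (density M (\<lambda>x. ennreal (v x)))) = (\<integral>\<^sup>+x. ennreal (v x) \<partial>M)"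
      by (simp add: emeasure_density cong: nn_integral_cong)
    also have "\<dots> < \<infinity>"
      using v(2,3) by (subst nn_integral_eq_integral) (auto intro: less_imp_le)
    finally show "emeasure (density M (\<lambda>x. ennreal (v x))) (space (density M (\<lambda>x. ennreal (v x)))) \<noteq> \<infinity>"
      by simp
  qed
  moreover have "null_sets (density M (\<lambda>x. ennreal (v x))) = null_sets M"
  proof (rule set_eqI)
    fix \<alpha>
    have "\<alpha> \<in> null_sets (density M (\<lambda>x. ennreal (v x))) \<longleftrightarrow>
      \<alpha> \<in> sets M \<and> (AE x in M. x \<in> \<alpha> \<longrightarrow> ennreal (v x) = 0)"
      by (rule null_sets_density_iff) measurable
    also have "\<dots> \<longleftrightarrow> \<alpha> \<in> sets M \<and> (AE x in M. x \<notin> \<alpha>)"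
    proof -
      have "\<not> v x \<le> 0" for x
        using v(2)[of x] by simp
      then show ?thesis
        by (simp add: ennreal_eq_0_iff)
    qed
    also have "\<dots> \<longleftrightarrow> \<alpha> \<in> null_sets M"
      using AE_iff_null_sets[of \<alpha> M] by auto
    finally show "\<alpha> \<in> null_sets (density M (\<lambda>x. ennreal (v x))) \<longleftrightarrow> \<alpha> \<in> null_sets M" .
  qed
  ultimately show thesis
    using that v(1,2) by blast
qed

text \<open>A Lusin--Souslin theorem modulo null sets. After coding both spaces by sequences, the graph of
  \<open>f\<close> over \<open>\<alpha>\<close> is a Borel set, hence filled up to a null set by countably many compact sets, and the
  projections of these onto the second coordinate are compact as well. By injectivity off \<open>A\<close>, almost
  every point whose value lies in these projections belongs to \<open>\<alpha>\<close>.\<close>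

lemma injective_preimages_full:
  fixes M :: "'a measure" and N :: "'b measure"
  assumes M: "standard_measure_space M" and N: "standard_measure_space N"
    and f: "f \<in> measurable M N" and A: "A \<in> null_sets M" and inj: "inj_on f (space M - A)"
    and a: "\<alpha> \<in> sets M"
  obtains \<beta> where "\<beta> \<in> sets N" "AE x in M. f x \<in> \<beta> \<longleftrightarrow> x \<in> \<alpha>"
proof -
  obtain e :: "'a \<Rightarrow> nat \<Rightarrow> real" where e: "inj_on e (space M)" "e \<in> borel_measurable M"
      "\<And>A. A \<in> sets M \<Longrightarrow> e ` A \<in> sets borel"
    using standard_code[OF M] by metis
  obtain c :: "'b \<Rightarrow> nat \<Rightarrow> real" where c: "inj_on c (space N)" "c \<in> borel_measurable N"
    using standard_code[OF N] by metis
  obtain v :: "'a \<Rightarrow> real" where v: "finite_measure (density M (\<lambda>x. ennreal (v x)))"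
      "null_sets (density M (\<lambda>x. ennreal (v x))) = null_sets M"
    using finite_equivalent_measure M by (metis standard_measure_space_def)
  define M' where "M' = density M (\<lambda>x. ennreal (v x))"
  have M': "finite_measure M'" "null_sets M' = null_sets M" "sets M' = sets M" "space M' = space M"
    using v by (auto simp: M'_def)
  have cf: "(\<lambda>x. c (f x)) \<in> borel_measurable M"
    by (rule measurable_compose[OF f c(2)])
  define h where "h = (\<lambda>x. (e x, c (f x)))"
  have h: "h \<in> measurable M' borel"
    unfolding h_def borel_prod[symmetric]
    by (intro measurable_Pair) (use e(2) cf M'(3) in \<open>auto cong: measurable_cong_sets\<close>)
  define \<mu> where "\<mu> = distr M' borel h"
  have \<mu>: "sets \<mu> = sets borel" "finite_measure \<mu>"
    using finite_measure.finite_measure_distr[OF M'(1) h] by (auto simp: \<mu>_def)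
  define F where "F = (\<lambda>z. if z \<in> e ` space M then c (f (inv_into (space M) e z)) else (\<lambda>_. 0))"
  have F: "F (e x) = c (f x)" if "x \<in> space M" for x
    using that e(1) by (simp add: F_def)
  have F_meas [measurable]: "F \<in> borel_measurable borel"
  proof (rule measurableI)
    fix C :: "(nat \<Rightarrow> real) set" assume C: "C \<in> sets borel"
    have *: "{x \<in> space M. c (f x) \<in> C} \<in> sets M"
      using measurable_sets[OF cf C] by (simp add: vimage_def Int_def conj_commute)
    have "F -` C \<inter> space borel = e ` {x \<in> space M. c (f x) \<in> C} \<union> (if (\<lambda>_. 0) \<in> C then - e ` space M else {})"
      using F by (fastforce simp: F_def split: if_splits)
    also have "\<dots> \<in> sets borel"
      using e(3)[OF *] e(3)[OF sets.top] by auto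
    finally show "F -` C \<inter> space borel \<in> sets borel" .
  qed simp
  define B where "B = h ` (\<alpha> - A)"
  have aA: "\<alpha> - A \<in> sets M" "\<alpha> - A \<subseteq> space M"
    using a A sets.sets_into_space[OF a] by auto
  \<comment> \<open>The graph condition is phrased through the distance, a measurable function of the pair.\<close>
  have "B = {p \<in> space (borel \<Otimes>\<^sub>M borel). fst p \<in> e ` (\<alpha> - A) \<and> dist (F (fst p)) (snd p) = 0}"
  proof (intro equalityI subsetI)
    fix p assume "p \<in> {p \<in> space (borel \<Otimes>\<^sub>M borel). fst p \<in> e ` (\<alpha> - A) \<and> dist (F (fst p)) (snd p) = 0}"
    then obtain x where x: "x \<in> \<alpha> - A" "fst p = e x" "F (e x) = snd p"
      by auto
    then have "p = h x"
      using F[of x] aA(2) by (auto simp: h_def prod_eq_iff)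
    then show "p \<in> B"
      using x(1) by (auto simp: B_def)
  qed (use F aA(2) in \<open>auto simp: B_def h_def space_pair_measure\<close>)
  also have "\<dots> \<in> sets (borel \<Otimes>\<^sub>M borel)"
  proof -
    note [measurable] = e(3)[OF aA(1)]
    show ?thesis
      by measurable
  qed
  finally have B: "B \<in> sets borel"
    unfolding borel_prod .
  have fin: "emeasure \<mu> (space \<mu>) \<noteq> \<infinity>"
    using finite_measure.emeasure_finite[OF \<mu>(2), of "space \<mu>"] by simp
  have reg: "emeasure \<mu> B = (SUP K\<in>{K. K \<subseteq> B \<and> compact K}. emeasure \<mu> K)"
    by (rule inner_regular[OF \<mu>(1) fin B])
  have "{K. K \<subseteq> B \<and> compact K} \<noteq> {}"
    by blast
  from ennreal_SUP_countable_SUP[OF this, of "emeasure \<mu>"]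
  obtain s :: "nat \<Rightarrow> ennreal" where s: "range s \<subseteq> emeasure \<mu> ` {K. K \<subseteq> B \<and> compact K}"
      "(SUP K\<in>{K. K \<subseteq> B \<and> compact K}. emeasure \<mu> K) = (SUP i. s i)"
    by blast
  have "\<exists>K. K \<subseteq> B \<and> compact K \<and> s i = emeasure \<mu> K" for i
    using subsetD[OF s(1) rangeI[of s i]] by auto
  then obtain K where K: "\<And>i. K i \<subseteq> B" "\<And>i. compact (K i)" "\<And>i. s i = emeasure \<mu> (K i)"
    by metis
  have Kb: "K i \<in> sets borel" for i
    using K(2) by (intro borel_compact)
  define L where "L = (\<Union>i. K i)"
  have L: "L \<in> sets borel" "L \<subseteq> B"
    using Kb K(1) by (auto simp: L_def)
  have "emeasure \<mu> B \<le> emeasure \<mu> L"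
    unfolding reg s(2) K(3) using Kb \<mu>(1) by (intro SUP_least emeasure_mono) (auto simp: L_def)
  moreover have "emeasure \<mu> L \<le> emeasure \<mu> B"
    using L(2) B \<mu>(1) by (intro emeasure_mono) auto
  ultimately have "emeasure \<mu> B = emeasure \<mu> L"
    by (rule antisym)
  moreover have Lfin: "emeasure \<mu> L \<noteq> \<infinity>"
    using finite_measure.emeasure_finite[OF \<mu>(2), of L] by simp
  moreover have "emeasure \<mu> (B - L) = emeasure \<mu> B - emeasure \<mu> L"
    by (rule emeasure_Diff[OF Lfin _ _ L(2)]) (simp_all add: \<mu>(1) B L(1))
  ultimately have "emeasure \<mu> (B - L) = 0"
    by (simp add: diff_eq_0_iff_ennreal)
  then have "emeasure M' (h -` (B - L) \<inter> space M') = 0"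
    using emeasure_distr[OF h, of "B - L"] B L by (simp add: \<mu>_def)
  moreover have "h -` (B - L) \<inter> space M' \<in> sets M'"
    using B L by (intro measurable_sets[OF h]) auto
  ultimately have "h -` (B - L) \<inter> space M' \<in> null_sets M'"
    by (rule null_setsI)
  then have nullBL: "h -` (B - L) \<inter> space M' \<in> null_sets M"
    unfolding M'(2) .
  define \<beta> where "\<beta> = c -` (\<Union>i. snd ` K i) \<inter> space N"
  have "compact (snd ` K i)" for i
    by (intro compact_continuous_image K continuous_intros)
  then have "(\<Union>i. snd ` K i) \<in> sets borel"
    by (intro sets.countable_UN) (auto intro: borel_compact)
  then have b: "\<beta> \<in> sets N"
    unfolding \<beta>_def by (rule measurable_sets[OF c(2)])
  have "AE x in M. f x \<in> \<beta> \<longleftrightarrow> x \<in> \<alpha>"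
    using AE_not_in[OF nullBL] AE_not_in[OF A] AE_space
  proof eventually_elim
    case (elim x)
    show ?case
    proof
      assume "x \<in> \<alpha>"
      then have "h x \<in> B"
        using elim by (auto simp: B_def)
      then have "h x \<in> L"
        using elim M'(4) by auto
      then obtain i where "h x \<in> K i"
        by (auto simp: L_def)
      then have "c (f x) \<in> snd ` K i"
        by (auto simp: h_def image_iff intro!: bexI)
      then show "f x \<in> \<beta>"
        using measurable_space[OF f elim(3)] by (auto simp: \<beta>_def)
    next
      assume "f x \<in> \<beta>"
      then obtain i k where k: "k \<in> K i" "c (f x) = snd k"
        by (auto simp: \<beta>_def)
      then obtain x' where x': "x' \<in> \<alpha> - A" "k = h x'"
        using K(1)[of i] by (auto simp: B_def)
      then have sp: "x' \<in> space M - A"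
        using aA(2) by auto
      have "c (f x) = c (f x')"
        using k(2) x'(2) by (simp add: h_def)
      then have "f x = f x'"
        using inj_onD[OF c(1)] measurable_space[OF f elim(3)] measurable_space[OF f, of x'] sp by auto
      then have "x = x'"
        using inj_onD[OF inj] sp elim(2,3) by auto
      then show "x \<in> \<alpha>"
        using x'(1) by simp
    qed
  qed
  with b show thesis
    by (rule that)
qed

section \<open>Weighted composition operators\<close>

text \<open>For a nonsingular map \<open>g\<close> the composition \<open>F \<mapsto> F \<circ> g\<close> becomes bounded after multiplication by a
  strictly positive weight: if \<open>r\<close> is the density of the image under \<open>g\<close> of the finite measure with
  density \<open>v\<close>, the weight with square \<open>v / (1 + r \<circ> g)\<close> makes it a contraction.\<close>

lemma weighted_composition:
  assumes M: "sigma_finite_measure M" and N: "sigma_finite_measure N"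
    and g: "g \<in> measurable N M" and null: "preserves_null_sets N M g"
  obtains T c where "T \<in> bounded_ops M N" "\<And>y :: 'b. (c y :: real) > 0"
    "\<And>F. F \<in> L2 M \<Longrightarrow> AE y in N. rep (T F) y = of_real (c y) * rep F (g y)"
proof -
  obtain v :: "'b \<Rightarrow> real" where v [measurable]: "v \<in> borel_measurable N" "\<And>x. v x > 0"
      "finite_measure (density N (\<lambda>x. ennreal (v x)))"
      "null_sets (density N (\<lambda>x. ennreal (v x))) = null_sets N"
    using finite_equivalent_measure[OF N] by metis
  note [measurable] = g
  define N' where "N' = density N (\<lambda>x. ennreal (v x))"
  have N': "sets N' = sets N" "space N' = space N" "null_sets N' = null_sets N"
    using v by (auto simp: N'_def)
  have g': "g \<in> measurable N' M"
    using g N'(1) by (simp cong: measurable_cong_sets)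
  define Q where "Q = distr N' M g"
  have "finite_measure Q"
    unfolding Q_def using v(3) g' by (intro finite_measure.finite_measure_distr) (auto simp: N'_def)
  then have Qfin: "emeasure Q (space M) \<noteq> \<infinity>"
    using finite_measure.emeasure_finite[of Q] by simp
  have "absolutely_continuous M Q"
    unfolding absolutely_continuous_def
  proof
    fix \<alpha> assume a: "\<alpha> \<in> null_sets M"
    then have "g -` \<alpha> \<inter> space N \<in> null_sets N'"
      using null N' by (auto simp: preserves_null_sets_def)
    then show "\<alpha> \<in> null_sets Q"
      using a g' N'(2) by (simp add: Q_def null_sets_distr_iff null_setsD2)
  qed
  then obtain r where r [measurable]: "r \<in> borel_measurable M" and rQ: "density M r = Q"
    using sigma_finite_measure.Radon_Nikodym[OF M, of Q] by (auto simp: Q_def)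
  have "(\<integral>\<^sup>+x. r x \<partial>M) = emeasure Q (space M)"
    using rQ emeasure_density[of r M "space M"] by (simp cong: nn_integral_cong)
  then have rfin: "AE x in M. r x \<noteq> \<infinity>"
    using Qfin by (intro nn_integral_PInf_AE) auto
  define r' where "r' = (\<lambda>x. enn2real (r x))"
  have [measurable]: "r' \<in> borel_measurable M"
    unfolding r'_def by measurable
  define c where "c = (\<lambda>y. sqrt (v y / (1 + r' (g y))))"
  have r'0: "0 \<le> r' x" for x
    by (simp add: r'_def)
  have cpos: "c y > 0" for y
    using v(2)[of y] r'0[of "g y"] by (simp add: c_def)
  have [measurable]: "c \<in> borel_measurable N"
    unfolding c_def by measurable
  have contr: "(\<integral>\<^sup>+y. ennreal ((cmod (of_real (c y) * u (g y)))\<^sup>2) \<partial>N) \<le> (\<integral>\<^sup>+x. ennreal ((cmod (u x))\<^sup>2) \<partial>M)"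
    if [measurable]: "u \<in> borel_measurable M" for u :: "'a \<Rightarrow> complex"
  proof -
    have "(\<integral>\<^sup>+y. ennreal ((cmod (of_real (c y) * u (g y)))\<^sup>2) \<partial>N)
      = (\<integral>\<^sup>+y. ennreal (v y) * ennreal ((cmod (u (g y)))\<^sup>2 / (1 + r' (g y))) \<partial>N)"
    proof (intro nn_integral_cong)
      fix y
      have "(c y)\<^sup>2 = v y / (1 + r' (g y))"
        using v(2)[of y] r'0[of "g y"] by (simp add: c_def)
      then have "(cmod (of_real (c y) * u (g y)))\<^sup>2 = v y * ((cmod (u (g y)))\<^sup>2 / (1 + r' (g y)))"
        by (simp add: norm_mult power_mult_distrib)
      then show "ennreal ((cmod (of_real (c y) * u (g y)))\<^sup>2)
          = ennreal (v y) * ennreal ((cmod (u (g y)))\<^sup>2 / (1 + r' (g y)))"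
        using v(2)[of y] r'0[of "g y"] by (simp only:) (intro ennreal_mult; simp)
    qed
    also have "\<dots> = (\<integral>\<^sup>+y. ennreal ((cmod (u (g y)))\<^sup>2 / (1 + r' (g y))) \<partial>N')"
      unfolding N'_def by (rule nn_integral_density[symmetric]) measurable
    also have "\<dots> = (\<integral>\<^sup>+x. ennreal ((cmod (u x))\<^sup>2 / (1 + r' x)) \<partial>Q)"
      unfolding Q_def by (rule nn_integral_distr[symmetric, OF g']) measurable
    also have "\<dots> = (\<integral>\<^sup>+x. r x * ennreal ((cmod (u x))\<^sup>2 / (1 + r' x)) \<partial>M)"
      unfolding rQ[symmetric] by (rule nn_integral_density) measurable
    also have "\<dots> \<le> (\<integral>\<^sup>+x. ennreal ((cmod (u x))\<^sup>2) \<partial>M)"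
    proof (rule nn_integral_mono_AE)
      show "AE x in M. r x * ennreal ((cmod (u x))\<^sup>2 / (1 + r' x)) \<le> ennreal ((cmod (u x))\<^sup>2)"
        using rfin
      proof eventually_elim
        case (elim x)
        then have "r x = ennreal (r' x)"
          by (simp add: r'_def less_top)
        then have "r x * ennreal ((cmod (u x))\<^sup>2 / (1 + r' x)) = ennreal (r' x * ((cmod (u x))\<^sup>2 / (1 + r' x)))"
          using r'0[of x] by (simp only:) (intro ennreal_mult[symmetric]; simp)
        also have "\<dots> \<le> ennreal ((cmod (u x))\<^sup>2)"
          using r'0[of x] by (intro ennreal_leI) (simp add: field_simps)
        finally show ?case .
      qed
    qed
    finally show ?thesis .
  qed
  have sq: "sqi N (\<lambda>y. of_real (c y) * rep F (g y))" and
    le: "(LINT y|N. (cmod (of_real (c y) * rep F (g y)))\<^sup>2) \<le> (l2_norm M F)\<^sup>2" if F: "F \<in> L2 M" for F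
  proof -
    have [measurable]: "rep F \<in> borel_measurable M"
      using F by simp
    have 1: "(\<integral>\<^sup>+y. ennreal ((cmod (of_real (c y) * rep F (g y)))\<^sup>2) \<partial>N) \<le> ennreal ((l2_norm M F)\<^sup>2)"
      using contr[of "rep F"] nn_integral_eq_integral[OF rep_integrable[OF F]] by (simp add: norm_sq)
    have int: "integrable N (\<lambda>y. (cmod (of_real (c y) * rep F (g y)))\<^sup>2)"
    proof (rule integrableI_bounded)
      show "(\<integral>\<^sup>+y. ennreal (norm ((cmod (of_real (c y) * rep F (g y)))\<^sup>2)) \<partial>N) < \<infinity>"
        using 1 by (simp add: le_less_trans)
    qed measurable
    then show "sqi N (\<lambda>y. of_real (c y) * rep F (g y))"
      by (simp add: sqi_def)
    have "ennreal (LINT y|N. (cmod (of_real (c y) * rep F (g y)))\<^sup>2) \<le> ennreal ((l2_norm M F)\<^sup>2)"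
      using 1 nn_integral_eq_integral[OF int] by simp
    then show "(LINT y|N. (cmod (of_real (c y) * rep F (g y)))\<^sup>2) \<le> (l2_norm M F)\<^sup>2"
      by (subst (asm) ennreal_le_iff) auto
  qed
  define T where "T = (\<lambda>F\<in>L2 M. ae_class N (\<lambda>y. of_real (c y) * rep F (g y)))"
  have TL: "T F \<in> L2 N" if "F \<in> L2 M" for F
    using that by (simp add: T_def ae_class_in_L2 sq)
  have rT: "AE y in N. rep (T F) y = of_real (c y) * rep F (g y)" if "F \<in> L2 M" for F
    using that rep_ae_class_L2[OF sq[OF that]] by (simp add: T_def)
  have "T \<in> bounded_ops M N"
  proof (rule bounded_opsI[where K = 1])
    fix F G assume FG: "F \<in> L2 M" "G \<in> L2 M"
    show "T (l2_add M F G) = l2_add N (T F) (T G)"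
    proof (rule L2_eqI[OF TL[OF add_in[OF FG]] add_in[OF TL[OF FG(1)] TL[OF FG(2)]]])
      show "AE y in N. rep (T (l2_add M F G)) y = rep (l2_add N (T F) (T G)) y"
        using rT[OF FG(1)] rT[OF FG(2)] rT[OF add_in[OF FG]] rep_add[OF TL[OF FG(1)] TL[OF FG(2)]]
          AE_nonsingular[OF g null rep_add[OF FG]]
        by eventually_elim (simp add: distrib_left)
    qed
  next
    fix d F assume F: "F \<in> L2 M"
    show "T (l2_scale M d F) = l2_scale N d (T F)"
    proof (rule L2_eqI[OF TL[OF scale_in[OF F]] scale_in[OF TL[OF F]]])
      show "AE y in N. rep (T (l2_scale M d F)) y = rep (l2_scale N d (T F)) y"
        using rT[OF F] rT[OF scale_in[OF F, of d]] rep_scale[OF TL[OF F], of d]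
          AE_nonsingular[OF g null rep_scale[OF F, of d]]
        by eventually_elim simp
    qed
  next
    fix F assume F: "F \<in> L2 M"
    show "(l2_norm N (T F))\<^sup>2 \<le> 1 * (l2_norm M F)\<^sup>2"
      using norm_cong[OF TL[OF F] sq[OF F] rT[OF F]] le[OF F] by simp
  next
    show "T \<in> extensional (L2 M)"
      by (simp add: T_def)
  qed (simp_all add: TL)
  then show thesis
    using that cpos rT by blast
qed

section \<open>The action of a normalizing bimodule on measurable sets\<close>

text \<open>The range of \<open>Pr M \<alpha>\<close> consists of the vectors that vanish almost everywhere off \<open>\<alpha>\<close>.\<close>

abbreviation supp :: "'a measure \<Rightarrow> 'a set \<Rightarrow> 'a vec set" where
  "supp M \<alpha> \<equiv> Pr M \<alpha> ` L2 M"

lemma supp_le_iff: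
  assumes M: "sigma_finite_measure M" and a: "\<alpha> \<in> sets M" and b: "\<beta> \<in> sets M"
  shows "supp M \<alpha> \<subseteq> supp M \<beta> \<longleftrightarrow> (AE x in M. x \<in> \<alpha> \<longrightarrow> x \<in> \<beta>)"
proof
  assume le: "supp M \<alpha> \<subseteq> supp M \<beta>"
  obtain w W where c: "cyclic M w W"
    using cyclic_exists[OF M] by metis
  then have W: "W \<in> L2 M" and wpos: "\<And>x. w x > 0"
    by (auto simp: cyclic_def)
  have "Pr M \<alpha> W \<in> supp M \<beta>"
    using le W by blast
  then have "AE x in M. x \<notin> \<beta> \<longrightarrow> rep (Pr M \<alpha> W) x = 0"
    using Pr_range_iff[OF b] by blast
  then show "AE x in M. x \<in> \<alpha> \<longrightarrow> x \<in> \<beta>"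
    using rep_Pr_cyclic[OF c a]
  proof eventually_elim
    case (elim x)
    then show ?case
      using wpos[of x] by (auto simp: indicator_def)
  qed
next
  assume le: "AE x in M. x \<in> \<alpha> \<longrightarrow> x \<in> \<beta>"
  show "supp M \<alpha> \<subseteq> supp M \<beta>"
  proof
    fix F assume "F \<in> supp M \<alpha>"
    then have F: "F \<in> L2 M" "AE x in M. x \<notin> \<alpha> \<longrightarrow> rep F x = 0"
      using Pr_range_iff[OF a] by blast+
    have "AE x in M. x \<notin> \<beta> \<longrightarrow> rep F x = 0"
      using F(2) le by eventually_elim blast
    then show "F \<in> supp M \<beta>"
      using Pr_range_iff[OF b] F(1) by blast
  qed
qed

lemma mult_masa_bounded: "A \<in> mult_masa M \<Longrightarrow> A \<in> bounded_ops M M"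
  by (auto simp: mult_masa_iff mult_op_in)

lemma supp_L2: "\<alpha> \<in> sets M \<Longrightarrow> F \<in> supp M \<alpha> \<Longrightarrow> F \<in> L2 M"
  using Pr_range_iff by blast

lemma supp_disjoint:
  assumes a: "\<alpha> \<in> sets M" and F: "F \<in> supp M \<alpha>" "F \<in> supp M (space M - \<alpha>)"
  shows "F = l2_zero M"
proof -
  have "Pr M \<alpha> F = l2_zero M"
    using Pr_zero_iff_compl_range[OF a supp_L2[OF a F(1)]] F(2) by blast
  then show ?thesis
    using Pr_range_fixed[OF a F(1)] by simp
qed

lemma supp_empty: "F \<in> supp M {} \<longleftrightarrow> F = l2_zero M"
proof
  assume "F \<in> supp M {}"
  then show "F = l2_zero M"
    using Pr_null[of "{}" M] by auto
next
  assume "F = l2_zero M"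
  then show "F \<in> supp M {}"
    using csubD(2)[OF proj_range_csub[OF Pr_projection[of "{}" M]]] by simp
qed

lemma supp_space: "supp M (space M) = L2 M"
proof
  show "supp M (space M) \<subseteq> L2 M"
    using Pr_L2[OF sets.top, of _ M] by blast
  show "L2 M \<subseteq> supp M (space M)"
    using Pr_space[of _ M] by (metis image_eqI subsetI)
qed

locale normalizing =
  fixes M :: "'x measure" and N :: "'y measure" and U :: "('x, 'y) oper set"
  assumes standard_M: "standard_measure_space M" and standard_N: "standard_measure_space N"
    and normalizing_U: "normalizing_bimodule M N U"
begin

lemma sigma_finite_M: "sigma_finite_measure M" and sigma_finite_N: "sigma_finite_measure N"
  using standard_M standard_N by (auto simp: standard_measure_space_def)

lemma bimodule: "masa_bimodule M N U"
  using normalizing_U by (simp add: normalizing_bimodule_def)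

lemma U_bounded: "T \<in> U \<Longrightarrow> T \<in> bounded_ops M N" and U_zero: "op_zero M N \<in> U"
  using bimodule by (auto simp: masa_bimodule_def op_subspace_def)

lemmas U_L2 = bounded_opsD(1)[OF U_bounded]

lemma U_compose_right:
  assumes T: "T \<in> U" and A: "A \<in> mult_masa M"
  shows "compose (L2 M) T A \<in> U"
proof -
  have Ab: "A \<in> bounded_ops M M"
    using A by (rule mult_masa_bounded)
  have "compose (L2 M) (Pr N (space N)) (compose (L2 M) T A) = compose (L2 M) T A"
    by (rule op_eqI[OF compose_in[OF Pr_in[OF sets.top] compose_in[OF U_bounded[OF T] Ab]]
          compose_in[OF U_bounded[OF T] Ab]])
      (simp add: compose_def Pr_space U_L2[OF T] bounded_opsD(1)[OF Ab])
  moreover have "compose (L2 M) (Pr N (space N)) (compose (L2 M) T A) \<in> U"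
    using bimodule T A Pr_masa[OF sets.top, of N] by (auto simp: masa_bimodule_def)
  ultimately show ?thesis
    by simp
qed

lemma U_compose_left:
  assumes T: "T \<in> U" and B: "B \<in> mult_masa N"
  shows "compose (L2 M) B T \<in> U"
proof -
  have Bb: "B \<in> bounded_ops N N"
    using B by (rule mult_masa_bounded)
  have "compose (L2 M) B (compose (L2 M) T (Pr M (space M))) = compose (L2 M) B T"
    by (rule op_eqI[OF compose_in[OF Bb compose_in[OF U_bounded[OF T] Pr_in[OF sets.top]]]
          compose_in[OF Bb U_bounded[OF T]]])
      (simp add: compose_def Pr_space)
  moreover have "compose (L2 M) B (compose (L2 M) T (Pr M (space M))) \<in> U"
    using bimodule T B Pr_masa[OF sets.top, of M] by (auto simp: masa_bimodule_def)
  ultimately show ?thesis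
    by simp
qed

abbreviation \<phi> :: "('x, 'x) oper \<Rightarrow> ('y, 'y) oper" where
  "\<phi> \<equiv> Map_op M N U"

lemma \<phi>_sup_preserving: "sup_preserving M N \<phi>"
  using normalizing_U by (simp add: normalizing_bimodule_def ortho_map_def)

lemma \<phi>_projection:
  assumes P: "P \<in> projections M"
  shows "\<phi> P \<in> projections N" "\<phi> P ` L2 N = closed_span N {S F | S F. S \<in> U \<and> F \<in> P ` L2 M}"
proof -
  have "{S F | S F. S \<in> U \<and> F \<in> P ` L2 M} \<subseteq> L2 N"
    using proj_range_iff[OF P] U_L2 by blast
  note c = closed_span_csub[OF this]
  show "\<phi> P \<in> projections N" "\<phi> P ` L2 N = closed_span N {S F | S F. S \<in> U \<and> F \<in> P ` L2 M}"
    unfolding Map_op_def using proj_onto_correct[OF c] by auto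
qed

lemma \<phi>_upper:
  assumes "P \<in> projections M" "S \<in> U" "F \<in> P ` L2 M"
  shows "S F \<in> \<phi> P ` L2 N"
  unfolding \<phi>_projection(2)[OF assms(1)] using assms closed_span_superset by fastforce

lemma \<phi>_least:
  assumes "P \<in> projections M" "l2_closed_subspace N V" "\<And>S F. S \<in> U \<Longrightarrow> F \<in> P ` L2 M \<Longrightarrow> S F \<in> V"
  shows "\<phi> P ` L2 N \<subseteq> V"
  unfolding \<phi>_projection(2)[OF assms(1)] using assms(2,3) by (intro closed_span_minimal) auto

text \<open>The values of \<open>\<phi>\<close> are invariant under the multiplication masa, as \<open>U\<close> is.\<close>

lemma \<phi>_supp:
  assumes P: "P \<in> projections M"
  obtains \<beta> where "\<beta> \<in> sets N" "\<phi> P = Pr N \<beta>"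
proof -
  note V = proj_range_csub[OF \<phi>_projection(1)[OF P]]
  have "Pr N \<beta> G \<in> \<phi> P ` L2 N" if b: "\<beta> \<in> sets N" and G: "G \<in> \<phi> P ` L2 N" for \<beta> G
  proof -
    have "\<phi> P ` L2 N \<subseteq> {G \<in> L2 N. Pr N \<beta> G \<in> \<phi> P ` L2 N}"
    proof (rule \<phi>_least[OF P csub_preimage[OF Pr_in[OF b] V]])
      fix S F assume S: "S \<in> U" and F: "F \<in> P ` L2 M"
      then have FL: "F \<in> L2 M"
        using proj_range_iff[OF P] by blast
      have "compose (L2 M) (Pr N \<beta>) S F \<in> \<phi> P ` L2 N"
        by (rule \<phi>_upper[OF P U_compose_left[OF S Pr_masa[OF b]] F])
      then show "S F \<in> {G \<in> L2 N. Pr N \<beta> G \<in> \<phi> P ` L2 N}"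
        using FL U_L2[OF S FL] by (simp add: compose_def)
    qed
    then show ?thesis
      using G by blast
  qed
  then obtain \<beta> where b: "\<beta> \<in> sets N" "\<phi> P ` L2 N = supp N \<beta>"
    using invariant_subspace[OF sigma_finite_N V] by metis
  then have "\<phi> P = Pr N \<beta>"
    by (intro proj_eqI[OF \<phi>_projection(1)[OF P] Pr_projection])
  with b(1) show thesis
    by (rule that)
qed

text \<open>\<open>\<Phi> \<alpha>\<close> is the smallest set carrying all \<open>S F\<close> with \<open>S \<in> U\<close> and \<open>F\<close> supported on \<open>\<alpha>\<close>; the set
  \<open>\<Theta> \<beta>\<close> is the largest one such that these \<open>S F\<close> are supported on \<open>\<beta>\<close>. Both are determined up to
  null sets, and they form a Galois connection.\<close>

definition \<Phi> :: "'x set \<Rightarrow> 'y set" where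
  "\<Phi> \<alpha> = (SOME \<beta>. \<beta> \<in> sets N \<and> \<phi> (Pr M \<alpha>) = Pr N \<beta>)"

lemma \<Phi>:
  assumes "\<alpha> \<in> sets M"
  shows "\<Phi> \<alpha> \<in> sets N" "\<phi> (Pr M \<alpha>) = Pr N (\<Phi> \<alpha>)"
proof -
  have "\<exists>\<beta>. \<beta> \<in> sets N \<and> \<phi> (Pr M \<alpha>) = Pr N \<beta>"
    using \<phi>_supp[OF Pr_projection[OF assms]] by metis
  from someI_ex[OF this, folded \<Phi>_def]
  show "\<Phi> \<alpha> \<in> sets N" "\<phi> (Pr M \<alpha>) = Pr N (\<Phi> \<alpha>)"
    by (rule conjunct1, rule conjunct2)
qed

definition \<Theta> :: "'y set \<Rightarrow> 'x set" where
  "\<Theta> \<beta> = (SOME \<alpha>. \<alpha> \<in> sets M \<and> supp M \<alpha> = {F \<in> L2 M. \<forall>S\<in>U. S F \<in> supp N \<beta>})"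

lemma \<Theta>:
  assumes b: "\<beta> \<in> sets N"
  shows "\<Theta> \<beta> \<in> sets M" "supp M (\<Theta> \<beta>) = {F \<in> L2 M. \<forall>S\<in>U. S F \<in> supp N \<beta>}"
proof -
  have eq: "{F \<in> L2 M. \<forall>S\<in>U. S F \<in> supp N \<beta>} = {F \<in> L2 M. \<forall>S\<in>U. F \<in> {F \<in> L2 M. S F \<in> supp N \<beta>}}"
    by blast
  have V: "l2_closed_subspace M {F \<in> L2 M. \<forall>S\<in>U. S F \<in> supp N \<beta>}"
    unfolding eq
    by (intro csub_Inter csub_preimage[OF U_bounded] proj_range_csub[OF Pr_projection[OF b]])
  obtain \<alpha> where "\<alpha> \<in> sets M" "{F \<in> L2 M. \<forall>S\<in>U. S F \<in> supp N \<beta>} = supp M \<alpha>"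
  proof (rule invariant_subspace[OF sigma_finite_M V])
    fix \<alpha> F assume a: "\<alpha> \<in> sets M" and F: "F \<in> {F \<in> L2 M. \<forall>S\<in>U. S F \<in> supp N \<beta>}"
    then have FL: "F \<in> L2 M"
      by blast
    have "S (Pr M \<alpha> F) \<in> supp N \<beta>" if S: "S \<in> U" for S
    proof -
      have "compose (L2 M) S (Pr M \<alpha>) F \<in> supp N \<beta>"
        using F U_compose_right[OF S Pr_masa[OF a]] by blast
      then show ?thesis
        using FL by (simp add: compose_def)
    qed
    then show "Pr M \<alpha> F \<in> {F \<in> L2 M. \<forall>S\<in>U. S F \<in> supp N \<beta>}"
      using Pr_L2[OF a FL] by blast
  qed
  then have "\<exists>\<alpha>. \<alpha> \<in> sets M \<and> supp M \<alpha> = {F \<in> L2 M. \<forall>S\<in>U. S F \<in> supp N \<beta>}"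
    by (intro exI[of _ \<alpha>] conjI) simp_all
  from someI_ex[OF this, folded \<Theta>_def]
  show "\<Theta> \<beta> \<in> sets M" "supp M (\<Theta> \<beta>) = {F \<in> L2 M. \<forall>S\<in>U. S F \<in> supp N \<beta>}"
    by (rule conjunct1, rule conjunct2)
qed

lemma U_maps_\<Theta>: "\<beta> \<in> sets N \<Longrightarrow> S \<in> U \<Longrightarrow> F \<in> supp M (\<Theta> \<beta>) \<Longrightarrow> S F \<in> supp N \<beta>"
  using \<Theta>(2) by blast

lemma U_maps_\<Phi>: "\<alpha> \<in> sets M \<Longrightarrow> S \<in> U \<Longrightarrow> F \<in> supp M \<alpha> \<Longrightarrow> S F \<in> supp N (\<Phi> \<alpha>)"
  using \<phi>_upper[OF Pr_projection] \<Phi>(2) by simp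

lemma galois:
  assumes a: "\<alpha> \<in> sets M" and b: "\<beta> \<in> sets N"
  shows "(AE y in N. y \<in> \<Phi> \<alpha> \<longrightarrow> y \<in> \<beta>) \<longleftrightarrow> (AE x in M. x \<in> \<alpha> \<longrightarrow> x \<in> \<Theta> \<beta>)"
proof -
  note P = Pr_projection[OF a]
  have "supp N (\<Phi> \<alpha>) \<subseteq> supp N \<beta> \<longleftrightarrow> supp M \<alpha> \<subseteq> supp M (\<Theta> \<beta>)"
  proof
    assume le: "supp N (\<Phi> \<alpha>) \<subseteq> supp N \<beta>"
    show "supp M \<alpha> \<subseteq> supp M (\<Theta> \<beta>)"
      unfolding \<Theta>(2)[OF b]
    proof (intro subsetI CollectI conjI ballI)
      fix F S assume F: "F \<in> supp M \<alpha>" and S: "S \<in> U"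
      show "S F \<in> supp N \<beta>"
        using U_maps_\<Phi>[OF a S F] le by (rule rev_subsetD)
    qed (rule supp_L2[OF a])
  next
    assume le: "supp M \<alpha> \<subseteq> supp M (\<Theta> \<beta>)"
    have "\<phi> (Pr M \<alpha>) ` L2 N \<subseteq> supp N \<beta>"
    proof (rule \<phi>_least[OF P proj_range_csub[OF Pr_projection[OF b]]])
      fix S F assume S: "S \<in> U" and F: "F \<in> supp M \<alpha>"
      show "S F \<in> supp N \<beta>"
        using b S subsetD[OF le F] by (rule U_maps_\<Theta>)
    qed
    then show "supp N (\<Phi> \<alpha>) \<subseteq> supp N \<beta>"
      unfolding \<Phi>(2)[OF a] .
  qed
  then show ?thesis
    unfolding supp_le_iff[OF sigma_finite_N \<Phi>(1)[OF a] b] supp_le_iff[OF sigma_finite_M a \<Theta>(1)[OF b]] .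
qed

lemma unit: "\<alpha> \<in> sets M \<Longrightarrow> AE x in M. x \<in> \<alpha> \<longrightarrow> x \<in> \<Theta> (\<Phi> \<alpha>)"
  using galois[of \<alpha> "\<Phi> \<alpha>"] \<Phi>(1) by simp

lemma counit: "\<beta> \<in> sets N \<Longrightarrow> AE y in N. y \<in> \<Phi> (\<Theta> \<beta>) \<longrightarrow> y \<in> \<beta>"
  using galois[of "\<Theta> \<beta>" \<beta>] \<Theta>(1) by simp

lemma \<Phi>_mono:
  assumes "\<alpha> \<in> sets M" "\<alpha>' \<in> sets M" "AE x in M. x \<in> \<alpha> \<longrightarrow> x \<in> \<alpha>'"
  shows "AE y in N. y \<in> \<Phi> \<alpha> \<longrightarrow> y \<in> \<Phi> \<alpha>'"
proof -
  have "AE x in M. x \<in> \<alpha> \<longrightarrow> x \<in> \<Theta> (\<Phi> \<alpha>')"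
    using assms(3) unit[OF assms(2)] by eventually_elim blast
  then show ?thesis
    using galois[OF assms(1) \<Phi>(1)[OF assms(2)]] by blast
qed

lemma \<Theta>_mono:
  assumes "\<beta> \<in> sets N" "\<beta>' \<in> sets N" "AE y in N. y \<in> \<beta> \<longrightarrow> y \<in> \<beta>'"
  shows "AE x in M. x \<in> \<Theta> \<beta> \<longrightarrow> x \<in> \<Theta> \<beta>'"
proof -
  have "AE y in N. y \<in> \<Phi> (\<Theta> \<beta>) \<longrightarrow> y \<in> \<beta>'"
    using assms(3) counit[OF assms(1)] by eventually_elim blast
  then show ?thesis
    using galois[OF \<Theta>(1)[OF assms(1)] assms(2)] by blast
qed

lemma \<Phi>_cong:
  assumes "\<alpha> \<in> sets M" "\<alpha>' \<in> sets M" "AE x in M. x \<in> \<alpha> \<longleftrightarrow> x \<in> \<alpha>'"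
  shows "AE y in N. y \<in> \<Phi> \<alpha> \<longleftrightarrow> y \<in> \<Phi> \<alpha>'"
proof -
  have 1: "AE x in M. x \<in> \<alpha> \<longrightarrow> x \<in> \<alpha>'" and 2: "AE x in M. x \<in> \<alpha>' \<longrightarrow> x \<in> \<alpha>"
    using assms(3) by (auto elim: eventually_mono)
  from \<Phi>_mono[OF assms(1,2) 1] \<Phi>_mono[OF assms(2,1) 2] show ?thesis
    by eventually_elim blast
qed

lemma \<Theta>_cong:
  assumes "\<beta> \<in> sets N" "\<beta>' \<in> sets N" "AE y in N. y \<in> \<beta> \<longleftrightarrow> y \<in> \<beta>'"
  shows "AE x in M. x \<in> \<Theta> \<beta> \<longleftrightarrow> x \<in> \<Theta> \<beta>'"
proof -
  have 1: "AE y in N. y \<in> \<beta> \<longrightarrow> y \<in> \<beta>'" and 2: "AE y in N. y \<in> \<beta>' \<longrightarrow> y \<in> \<beta>"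
    using assms(3) by (auto elim: eventually_mono)
  from \<Theta>_mono[OF assms(1,2) 1] \<Theta>_mono[OF assms(2,1) 2] show ?thesis
    by eventually_elim blast
qed

lemma \<Phi>_empty: "AE y in N. y \<notin> \<Phi> {}"
proof -
  have "AE y in N. y \<in> \<Phi> {} \<longrightarrow> y \<in> {}"
    by (subst galois) auto
  then show ?thesis
    by simp
qed

text \<open>As a lower adjoint \<open>\<Phi>\<close> preserves unions.\<close>

lemma \<Phi>_UN:
  fixes A :: "nat \<Rightarrow> 'x set"
  assumes A: "\<And>i. A i \<in> sets M"
  shows "AE y in N. y \<in> \<Phi> (\<Union>i. A i) \<longleftrightarrow> (\<exists>i. y \<in> \<Phi> (A i))"
proof -
  have UA: "(\<Union>i. A i) \<in> sets M" and U\<Phi>: "(\<Union>i. \<Phi> (A i)) \<in> sets N"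
    using A \<Phi>(1) by auto
  have "AE y in N. y \<in> \<Phi> (A i) \<longrightarrow> y \<in> \<Phi> (\<Union>i. A i)" for i
    by (intro \<Phi>_mono A UA) auto
  then have 1: "AE y in N. \<forall>i. y \<in> \<Phi> (A i) \<longrightarrow> y \<in> \<Phi> (\<Union>i. A i)"
    by (intro AE_all_countable[THEN iffD2] allI)
  have "AE x in M. x \<in> A i \<longrightarrow> x \<in> \<Theta> (\<Union>i. \<Phi> (A i))" for i
    by (rule galois[THEN iffD1, OF A U\<Phi>]) auto
  then have "AE x in M. \<forall>i. x \<in> A i \<longrightarrow> x \<in> \<Theta> (\<Union>i. \<Phi> (A i))"
    by (intro AE_all_countable[THEN iffD2] allI)
  then have "AE x in M. x \<in> (\<Union>i. A i) \<longrightarrow> x \<in> \<Theta> (\<Union>i. \<Phi> (A i))"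
    by eventually_elim blast
  then have 2: "AE y in N. y \<in> \<Phi> (\<Union>i. A i) \<longrightarrow> y \<in> (\<Union>i. \<Phi> (A i))"
    using galois[OF UA U\<Phi>] by blast
  from 1 2 show ?thesis
    by eventually_elim blast
qed

lemma \<Phi>_Un_compl:
  assumes a: "\<alpha> \<in> sets M"
  shows "AE y in N. y \<in> \<Phi> (space M) \<longleftrightarrow> y \<in> \<Phi> \<alpha> \<or> y \<in> \<Phi> (space M - \<alpha>)"
proof -
  let ?A = "\<lambda>i :: nat. if i = 0 then \<alpha> else space M - \<alpha>"
  have "(\<Union>i. ?A i) = space M"
    using sets.sets_into_space[OF a] by (auto split: if_splits)
  moreover have "(\<exists>i. y \<in> \<Phi> (?A i)) \<longleftrightarrow> y \<in> \<Phi> \<alpha> \<or> y \<in> \<Phi> (space M - \<alpha>)" for y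
    by (auto split: if_splits)
  ultimately show ?thesis
    using \<Phi>_UN[of ?A] a by auto
qed

text \<open>The elements of \<open>S1 M N \<phi>\<close> that come from the masa of \<open>N\<close> are the projections of the sets
  \<open>\<Theta> \<beta>\<close>, and for these the ortho-map condition is one about sets.\<close>

lemma Sup_below_supp:
  assumes b: "\<beta> \<in> sets N"
  shows "proj_Sup M {P \<in> projections M. proj_le N (\<phi> P) (Pr N \<beta>)} = Pr M (\<Theta> \<beta>)"
proof -
  let ?S = "{P \<in> projections M. proj_le N (\<phi> P) (Pr N \<beta>)}"
  note t = \<Theta>(1)[OF b]
  have "closed_span M (\<Union>P\<in>?S. P ` L2 M) = supp M (\<Theta> \<beta>)"
  proof
    have "P ` L2 M \<subseteq> supp M (\<Theta> \<beta>)" if "P \<in> ?S" for P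
    proof -
      have P: "P \<in> projections M" and le: "\<phi> P ` L2 N \<subseteq> supp N \<beta>"
        using that by (simp_all add: proj_le_def)
      show ?thesis
        unfolding \<Theta>(2)[OF b]
      proof (intro subsetI CollectI conjI ballI)
        fix F S assume F: "F \<in> P ` L2 M" and S: "S \<in> U"
        show "S F \<in> supp N \<beta>"
          using \<phi>_upper[OF P S F] le by (rule rev_subsetD)
      qed (simp add: proj_range_iff[OF P])
    qed
    then show "closed_span M (\<Union>P\<in>?S. P ` L2 M) \<subseteq> supp M (\<Theta> \<beta>)"
      by (intro closed_span_minimal proj_range_csub Pr_projection t) blast
    have "\<phi> (Pr M (\<Theta> \<beta>)) ` L2 N \<subseteq> supp N \<beta>"
      by (intro \<phi>_least Pr_projection t proj_range_csub b U_maps_\<Theta>)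
    then have "Pr M (\<Theta> \<beta>) \<in> ?S"
      using Pr_projection[OF t] by (simp add: proj_le_def)
    then show "supp M (\<Theta> \<beta>) \<subseteq> closed_span M (\<Union>P\<in>?S. P ` L2 M)"
      by (intro order_trans[OF _ closed_span_superset] UN_upper)
  qed
  then show ?thesis
    unfolding proj_Sup_def using proj_onto_unique[OF Pr_projection[OF t]] by simp
qed

lemma ortho:
  assumes b: "\<beta> \<in> sets N"
  shows "AE y in N. \<not> (y \<in> \<Phi> (\<Theta> \<beta>) \<and> y \<in> \<Phi> (space M - \<Theta> \<beta>))"
proof -
  note t = \<Theta>(1)[OF b] and ct = sets.compl_sets[OF \<Theta>(1)[OF b]]
  have "Pr M (\<Theta> \<beta>) \<in> S1 M N \<phi>"
    unfolding S1_def
    by (intro CollectI exI[of _ "Pr N \<beta>"] conjI Sup_below_supp[OF b, symmetric] Pr_projection[OF b])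
  moreover have "\<forall>L\<in>S1 M N \<phi>. compose (L2 N) (\<phi> L) (\<phi> (proj_compl M L)) = op_zero N N"
    using normalizing_U by (simp add: normalizing_bimodule_def ortho_map_def)
  ultimately have "compose (L2 N) (\<phi> (Pr M (\<Theta> \<beta>))) (\<phi> (proj_compl M (Pr M (\<Theta> \<beta>)))) = op_zero N N"
    by simp
  then have z: "compose (L2 N) (Pr N (\<Phi> (\<Theta> \<beta>))) (Pr N (\<Phi> (space M - \<Theta> \<beta>))) = op_zero N N"
    by (simp only: Pr_compl[OF t] \<Phi>(2)[OF t] \<Phi>(2)[OF ct])
  obtain w W where c: "cyclic N w W"
    using cyclic_exists[OF sigma_finite_N] by metis
  then have W: "W \<in> L2 N"
    by (auto simp: cyclic_def)
  have "Pr N (\<Phi> (\<Theta> \<beta>)) (Pr N (\<Phi> (space M - \<Theta> \<beta>)) W) = l2_zero N"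
    using fun_cong[OF z, of W] W by (simp add: compose_def op_zero_def)
  then have "Pr N (\<Phi> (\<Theta> \<beta>) \<inter> \<Phi> (space M - \<Theta> \<beta>)) W = l2_zero N"
    using Pr_Pr[OF \<Phi>(1)[OF t] \<Phi>(1)[OF ct] W] by simp
  then have "\<Phi> (\<Theta> \<beta>) \<inter> \<Phi> (space M - \<Theta> \<beta>) \<in> null_sets N"
    using Pr_cyclic_zero_iff[OF c sets.Int[OF \<Phi>(1)[OF t] \<Phi>(1)[OF ct]]] by simp
  from AE_not_in[OF this] show ?thesis
    by simp
qed

text \<open>Whatever map \<open>\<psi>\<close> witnesses reflexivity, \<open>\<phi> P\<close> lies below \<open>\<psi> P\<close>, and \<open>\<phi> P\<close> is a set \<open>\<beta>\<close> for which
  the range of \<open>P\<close> is supported on \<open>\<Theta> \<beta>\<close>. So a reflexive \<open>U\<close> is determined by \<open>\<Theta>\<close>.\<close>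

lemma reflexive_in_U:
  assumes refl: "reflexive M N U" and T: "T \<in> bounded_ops M N"
    and maps: "\<And>\<beta> F. \<beta> \<in> sets N \<Longrightarrow> F \<in> supp M (\<Theta> \<beta>) \<Longrightarrow> T F \<in> supp N \<beta>"
  shows "T \<in> U"
proof -
  obtain \<psi> where \<psi>: "sup_preserving M N \<psi>"
    and U: "U = {T \<in> bounded_ops M N. \<forall>P\<in>projections M.
      compose (L2 M) (proj_compl N (\<psi> P)) (compose (L2 M) T P) = op_zero M N}"
    using refl by (auto simp: reflexive_def)
  have \<psi>P: "\<psi> P \<in> projections N" if "P \<in> projections M" for P
    using \<psi> that by (auto simp: sup_preserving_def)
  have iff: "S \<in> U \<longleftrightarrow> S \<in> bounded_ops M N \<and> (\<forall>P\<in>projections M. S ` P ` L2 M \<subseteq> \<psi> P ` L2 N)" for S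
  proof -
    have "S \<in> U \<longleftrightarrow> S \<in> bounded_ops M N \<and> (\<forall>P\<in>projections M.
        compose (L2 M) (proj_compl N (\<psi> P)) (compose (L2 M) S P) = op_zero M N)"
      by (subst U) simp
    then show ?thesis
      using compl_compose_zero_iff[OF \<psi>P, of _ S M] by (simp cong: conj_cong)
  qed
  have "T F \<in> \<psi> P ` L2 N" if P: "P \<in> projections M" and F: "F \<in> P ` L2 M" for P F
  proof -
    obtain \<beta> where b: "\<beta> \<in> sets N" "\<phi> P = Pr N \<beta>"
      using \<phi>_supp[OF P] by metis
    have "F \<in> supp M (\<Theta> \<beta>)"
      unfolding \<Theta>(2)[OF b(1)] using \<phi>_upper[OF P _ F] F proj_range_iff[OF P] b(2) by auto
    then have "T F \<in> \<phi> P ` L2 N"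
      using maps[OF b(1)] b(2) by simp
    moreover have "\<phi> P ` L2 N \<subseteq> \<psi> P ` L2 N"
    proof (rule \<phi>_least[OF P proj_range_csub[OF \<psi>P[OF P]]])
      fix S F assume S: "S \<in> U" and F: "F \<in> P ` L2 M"
      have "S ` P ` L2 M \<subseteq> \<psi> P ` L2 N"
        using iff[of S] S P by simp
      then show "S F \<in> \<psi> P ` L2 N"
        using imageI[OF F, of S] by (rule subsetD)
    qed
    ultimately show ?thesis
      by (rule rev_subsetD)
  qed
  then have "\<forall>P\<in>projections M. T ` P ` L2 M \<subseteq> \<psi> P ` L2 N"
    by (intro ballI image_subsetI) simp
  then show ?thesis
    using iff[of T] T by simp
qed

lemma mult_masa_in:
  "mult_masa M \<subseteq> {A \<in> bounded_ops M M. \<forall>T\<in>U. compose (L2 M) T A \<in> U}"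
  "mult_masa N \<subseteq> {B \<in> bounded_ops N N. \<forall>T\<in>U. compose (L2 M) B T \<in> U}"
  using U_compose_right U_compose_left mult_masa_bounded by blast+

end

section \<open>Operators supported on a graph\<close>

text \<open>The part of the graph inside a rectangle lies over a set of first coordinates, and both null
  strips have null preimages under \<open>x \<mapsto> (x, f x)\<close>.\<close>

lemma marginally_null_graph_iff:
  assumes f: "f \<in> measurable M N" and null: "preserves_null_sets M N f"
    and a: "\<alpha> \<in> sets M" and b: "\<beta> \<in> sets N"
  shows "marginally_null M N ((\<alpha> \<times> \<beta>) \<inter> {(x, f x) | x. x \<in> space M}) \<longleftrightarrow>
    (AE x in M. \<not> (x \<in> \<alpha> \<and> f x \<in> \<beta>))"
proof
  assume "marginally_null M N ((\<alpha> \<times> \<beta>) \<inter> {(x, f x) | x. x \<in> space M})"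
  then obtain A B where AB: "A \<in> null_sets M" "B \<in> null_sets N"
    "(\<alpha> \<times> \<beta>) \<inter> {(x, f x) | x. x \<in> space M} \<subseteq> (A \<times> space N) \<union> (space M \<times> B)"
    unfolding marginally_null_def by blast
  show "AE x in M. \<not> (x \<in> \<alpha> \<and> f x \<in> \<beta>)"
    using AE_not_in[OF AB(1)] AE_nonsingular[OF f null AE_not_in[OF AB(2)]] AE_space
  proof eventually_elim
    case (elim x)
    then show ?case
      using subsetD[OF AB(3), of "(x, f x)"] by auto
  qed
next
  assume ae: "AE x in M. \<not> (x \<in> \<alpha> \<and> f x \<in> \<beta>)"
  define A where "A = \<alpha> \<inter> (f -` \<beta> \<inter> space M)"
  have "A \<in> sets M"
    using a measurable_sets[OF f b] by (auto simp: A_def)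
  moreover have "AE x in M. x \<notin> A"
    using ae by eventually_elim (auto simp: A_def)
  ultimately have "A \<in> null_sets M"
    using AE_iff_null_sets by blast
  moreover have "(\<alpha> \<times> \<beta>) \<inter> {(x, f x) | x. x \<in> space M} \<subseteq> (A \<times> space N) \<union> (space M \<times> {})"
    using measurable_space[OF f] by (auto simp: A_def)
  ultimately show "marginally_null M N ((\<alpha> \<times> \<beta>) \<inter> {(x, f x) | x. x \<in> space M})"
    unfolding marginally_null_def by blast
qed

lemma suppI: "\<alpha> \<in> sets M \<Longrightarrow> F \<in> L2 M \<Longrightarrow> Pr M \<alpha> F = F \<Longrightarrow> F \<in> supp M \<alpha>"
  using proj_range_iff[OF Pr_projection] by blast

lemma compress_zero_iff:
  assumes T: "T \<in> bounded_ops M N" and a: "\<alpha> \<in> sets M" and b: "\<beta> \<in> sets N"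
  shows "compose (L2 M) (Pr N \<beta>) (compose (L2 M) T (Pr M \<alpha>)) = op_zero M N \<longleftrightarrow>
    (\<forall>F\<in>supp M \<alpha>. T F \<in> supp N (space N - \<beta>))"
proof -
  have "Pr N \<beta> (T (Pr M \<alpha> F)) = l2_zero N \<longleftrightarrow> T (Pr M \<alpha> F) \<in> supp N (space N - \<beta>)" if "F \<in> L2 M" for F
    by (rule Pr_zero_iff_compl_range[OF b bounded_opsD(1)[OF T Pr_L2[OF a that]]])
  then show ?thesis
    unfolding compose_eq_zero_iff[OF compose_in[OF Pr_in[OF b] compose_in[OF T Pr_in[OF a]]]]
    by (simp add: compose_def)
qed

text \<open>An operator is supported on the graph of \<open>f\<close> precisely if it maps functions supported on the
  preimage of a set to functions supported on this set.\<close>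

lemma M_max_graph_iff:
  assumes f: "f \<in> measurable M N" and null: "preserves_null_sets M N f"
    and M: "sigma_finite_measure M"
  shows "T \<in> M_max M N {(x, f x) | x. x \<in> space M} \<longleftrightarrow> T \<in> bounded_ops M N \<and>
    (\<forall>\<beta>\<in>sets N. \<forall>F\<in>supp M (f -` \<beta> \<inter> space M). T F \<in> supp N \<beta>)"
proof -
  have "(\<forall>\<alpha>\<in>sets M. \<forall>\<beta>\<in>sets N. (AE x in M. \<not> (x \<in> \<alpha> \<and> f x \<in> \<beta>)) \<longrightarrow>
        (\<forall>F\<in>supp M \<alpha>. T F \<in> supp N (space N - \<beta>))) \<longleftrightarrow>
      (\<forall>\<beta>\<in>sets N. \<forall>F\<in>supp M (f -` \<beta> \<inter> space M). T F \<in> supp N \<beta>)" (is "?L \<longleftrightarrow> ?R")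
  proof
    assume L: ?L
    show ?R
    proof (intro ballI)
      fix \<beta> F assume b: "\<beta> \<in> sets N" and F: "F \<in> supp M (f -` \<beta> \<inter> space M)"
      have "AE x in M. \<not> (x \<in> f -` \<beta> \<inter> space M \<and> f x \<in> space N - \<beta>)"
        by simp
      then have "T F \<in> supp N (space N - (space N - \<beta>))"
        using L[rule_format, OF measurable_sets[OF f b] sets.compl_sets[OF b] _ F] by blast
      then show "T F \<in> supp N \<beta>"
        using sets.sets_into_space[OF b] by (simp add: double_diff)
    qed
  next
    assume R: ?R
    show ?L
    proof (intro ballI impI)
      fix \<alpha> \<beta> F assume a: "\<alpha> \<in> sets M" and b: "\<beta> \<in> sets N" and F: "F \<in> supp M \<alpha>"
        and ae: "AE x in M. \<not> (x \<in> \<alpha> \<and> f x \<in> \<beta>)"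
      note c = sets.compl_sets[OF b]
      have "AE x in M. x \<in> \<alpha> \<longrightarrow> x \<in> f -` (space N - \<beta>) \<inter> space M"
        using ae AE_space by eventually_elim (use measurable_space[OF f] in blast)
      then have "supp M \<alpha> \<subseteq> supp M (f -` (space N - \<beta>) \<inter> space M)"
        using supp_le_iff[OF M a measurable_sets[OF f c]] by blast
      then show "T F \<in> supp N (space N - \<beta>)"
        using R[rule_format, OF c subsetD, OF _ F] by blast
    qed
  qed
  moreover have "T \<in> M_max M N {(x, f x) | x. x \<in> space M} \<longleftrightarrow> T \<in> bounded_ops M N \<and> ?L"
    unfolding M_max_def mem_Collect_eq
  proof (intro conj_cong ball_cong imp_cong refl)
    fix \<alpha> \<beta> assume T: "T \<in> bounded_ops M N" and a: "\<alpha> \<in> sets M" and b: "\<beta> \<in> sets N"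
    show "marginally_null M N ((\<alpha> \<times> \<beta>) \<inter> {(x, f x) | x. x \<in> space M}) \<longleftrightarrow>
        (AE x in M. \<not> (x \<in> \<alpha> \<and> f x \<in> \<beta>))"
      by (rule marginally_null_graph_iff[OF f null a b])
    show "compose (L2 M) (Pr N \<beta>) (compose (L2 M) T (Pr M \<alpha>)) = op_zero M N \<longleftrightarrow>
        (\<forall>F\<in>supp M \<alpha>. T F \<in> supp N (space N - \<beta>))"
      by (rule compress_zero_iff[OF T a b])
  qed
  ultimately show ?thesis
    by (simp only:)
qed

section \<open>Thin bimodules are supported on graphs\<close>

text \<open>Over a null space all vectors are equal.\<close>

lemma trivial_bounded_ops:
  assumes "AE x in M. False"
  shows "bounded_ops M M = mult_masa M"
proof
  have eq: "F = G" if "F \<in> L2 M" "G \<in> L2 M" for F G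
    by (rule L2_eqI[OF that]) (use assms in eventually_elim, simp)
  have "sigma_finite_measure M"
  proof (rule sigma_finite_measure.intro, intro exI[of _ "{space M}"] conjI ballI)
    have "space M \<in> null_sets M"
      using assms AE_iff_null_sets[of "space M" M] by (auto elim: eventually_mono)
    then show "emeasure M A \<noteq> \<infinity>" if "A \<in> {space M}" for A
      using that by auto
  qed auto
  then show "bounded_ops M M \<subseteq> mult_masa M"
  proof (intro subsetI commutant_masa)
    fix A \<alpha> F assume A: "A \<in> bounded_ops M M" and a: "\<alpha> \<in> sets M" and F: "F \<in> L2 M"
    show "A (Pr M \<alpha> F) = Pr M \<alpha> (A F)"
      by (rule eq[OF bounded_opsD(1)[OF A Pr_L2[OF a F]] Pr_L2[OF a bounded_opsD(1)[OF A F]]])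
  qed
next
  show "mult_masa M \<subseteq> bounded_ops M M"
    by (rule subsetI) (rule mult_masa_bounded)
qed

context normalizing
begin

lemma U_trivial_iff:
  "U = {op_zero M N} \<longleftrightarrow> (\<forall>S\<in>U. \<forall>F\<in>L2 M. S F = l2_zero N)"
proof
  assume z: "\<forall>S\<in>U. \<forall>F\<in>L2 M. S F = l2_zero N"
  have "S = op_zero M N" if S: "S \<in> U" for S
    using compose_eq_zero_iff[OF U_bounded[OF S]] z S by blast
  then show "U = {op_zero M N}"
    using U_zero by blast
qed (simp add: op_zero_def)

lemma zero_in_U: "S \<in> bounded_ops M N \<Longrightarrow> (\<And>F. F \<in> L2 M \<Longrightarrow> S F = l2_zero N) \<Longrightarrow> S \<in> U"
  using compose_eq_zero_iff U_zero by metis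

text \<open>Every operator is a multiplier of the zero space.\<close>

lemma thin_zero_imp_degenerate:
  assumes thin: "thin M N U" and z: "U = {op_zero M N}"
  shows "degenerate M N U"
proof -
  have "compose (L2 M) T A \<in> U" if "A \<in> bounded_ops M M" "T \<in> U" for A T
  proof (rule zero_in_U[OF compose_in[OF U_bounded[OF that(2)] that(1)]])
    fix F assume F: "F \<in> L2 M"
    have "T = op_zero M N"
      using that(2) z by simp
    then show "compose (L2 M) T A F = l2_zero N"
      using F bounded_opsD(1)[OF that(1) F] by (simp add: compose_def op_zero_def)
  qed
  moreover have "compose (L2 M) B T \<in> U" if "B \<in> bounded_ops N N" "T \<in> U" for B T
  proof (rule zero_in_U[OF compose_in[OF that(1) U_bounded[OF that(2)]]])
    fix F assume F: "F \<in> L2 M"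
    have "T = op_zero M N"
      using that(2) z by simp
    then show "compose (L2 M) B T F = l2_zero N"
      using F bounded_opsD(5)[OF that(1)] by (simp add: compose_def op_zero_def)
  qed
  ultimately have "{A \<in> bounded_ops M M. \<forall>T\<in>U. compose (L2 M) T A \<in> U} = bounded_ops M M"
      "{B \<in> bounded_ops N N. \<forall>T\<in>U. compose (L2 M) B T \<in> U} = bounded_ops N N"
    by blast+
  then show ?thesis
    using thin z by (simp add: thin_def degenerate_def)
qed

end

locale thin_normalizing = normalizing M N U
  for M :: "'x measure" and N :: "'y measure" and U +
  assumes thin_U: "thin M N U" and nondegenerate: "\<not> degenerate M N U"
begin

lemma reflexive_U: "reflexive M N U"
  and right_multipliers: "A \<in> bounded_ops M M \<Longrightarrow> (\<And>T. T \<in> U \<Longrightarrow> compose (L2 M) T A \<in> U) \<Longrightarrow> A \<in> mult_masa M"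
  and left_multipliers: "B \<in> bounded_ops N N \<Longrightarrow> (\<And>T. T \<in> U \<Longrightarrow> compose (L2 M) B T \<in> U) \<Longrightarrow> B \<in> mult_masa N"
proof -
  have *: "{A \<in> bounded_ops M M. \<forall>T\<in>U. compose (L2 M) T A \<in> U} = mult_masa M"
    "{B \<in> bounded_ops N N. \<forall>T\<in>U. compose (L2 M) B T \<in> U} = mult_masa N"
    using thin_U by (simp_all add: thin_def)
  show "reflexive M N U"
    using thin_U by (simp add: thin_def)
  show "A \<in> bounded_ops M M \<Longrightarrow> (\<And>T. T \<in> U \<Longrightarrow> compose (L2 M) T A \<in> U) \<Longrightarrow> A \<in> mult_masa M"
    unfolding *(1)[symmetric] by simp
  show "B \<in> bounded_ops N N \<Longrightarrow> (\<And>T. T \<in> U \<Longrightarrow> compose (L2 M) B T \<in> U) \<Longrightarrow> B \<in> mult_masa N"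
    unfolding *(2)[symmetric] by simp
qed

lemma not_zero: "U \<noteq> {op_zero M N}"
  using thin_zero_imp_degenerate[OF thin_U] nondegenerate by blast

text \<open>If the vectors killed by \<open>U\<close> did not only consist of zero, every operator into them would
  be a right multiplier, and so a multiplication operator, which rank one operators exclude.\<close>

lemma kernel_null: "AE x in M. x \<notin> \<Theta> {}"
proof -
  note t = \<Theta>(1)[OF sets.empty_sets]
  have kill: "S F = l2_zero N" if "S \<in> U" "F \<in> supp M (\<Theta> {})" for S F
    using U_maps_\<Theta>[OF sets.empty_sets that] by (simp add: supp_empty)
  have "\<Theta> {} \<in> null_sets M \<or> space M - \<Theta> {} \<in> null_sets M"
  proof (rule rank_one_not_masa[OF sigma_finite_M t])
    fix A assume A: "A \<in> bounded_ops M M" and fix1: "\<And>F. F \<in> L2 M \<Longrightarrow> Pr M (\<Theta> {}) (A F) = A F"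
    show "A \<in> mult_masa M"
    proof (rule right_multipliers[OF A])
      fix T assume T: "T \<in> U"
      show "compose (L2 M) T A \<in> U"
      proof (rule zero_in_U[OF compose_in[OF U_bounded[OF T] A]])
        fix F assume F: "F \<in> L2 M"
        have "A F \<in> supp M (\<Theta> {})"
          by (rule suppI[OF t bounded_opsD(1)[OF A F] fix1[OF F]])
        then show "compose (L2 M) T A F = l2_zero N"
          using kill[OF T] F by (simp add: compose_def)
      qed
    qed
  qed
  moreover have "space M - \<Theta> {} \<notin> null_sets M"
  proof
    assume n: "space M - \<Theta> {} \<in> null_sets M"
    have "S F = l2_zero N" if S: "S \<in> U" and F: "F \<in> L2 M" for S F
    proof -
      have "F \<in> supp M (\<Theta> {})"
        by (rule suppI[OF t F Pr_absorb[OF t F Pr_null[OF n F]]])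
      then show ?thesis
        by (rule kill[OF S])
    qed
    then show False
      using U_trivial_iff not_zero by blast
  qed
  ultimately show ?thesis
    using AE_not_in by blast
qed

text \<open>Dually, operators that vanish on the closed range of \<open>U\<close> are left multipliers.\<close>

lemma range_full: "AE y in N. y \<in> \<Phi> (space M)"
proof -
  note p = \<Phi>(1)[OF sets.top]
  have range: "S F \<in> supp N (\<Phi> (space M))" if "S \<in> U" "F \<in> L2 M" for S F
    using U_maps_\<Phi>[OF sets.top that(1), of F] that(2) by (simp only: supp_space)
  have "\<Phi> (space M) \<in> null_sets N \<or> space N - \<Phi> (space M) \<in> null_sets N"
  proof (rule rank_one_not_masa[OF sigma_finite_N p])
    fix B assume B: "B \<in> bounded_ops N N" and kill: "\<And>G. G \<in> L2 N \<Longrightarrow> B (Pr N (\<Phi> (space M)) G) = l2_zero N"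
    show "B \<in> mult_masa N"
    proof (rule left_multipliers[OF B])
      fix T assume T: "T \<in> U"
      show "compose (L2 M) B T \<in> U"
      proof (rule zero_in_U[OF compose_in[OF B U_bounded[OF T]]])
        fix F assume F: "F \<in> L2 M"
        show "compose (L2 M) B T F = l2_zero N"
          using kill[OF U_L2[OF T F]] Pr_range_fixed[OF p range[OF T F]] F by (simp add: compose_def)
      qed
    qed
  qed
  moreover have "\<Phi> (space M) \<notin> null_sets N"
  proof
    assume n: "\<Phi> (space M) \<in> null_sets N"
    have "S F = l2_zero N" if S: "S \<in> U" and F: "F \<in> L2 M" for S F
      using Pr_range_fixed[OF p range[OF S F]] Pr_null[OF n U_L2[OF S F]] by simp
    then show False
      using U_trivial_iff not_zero by blast
  qed
  ultimately have "space N - \<Phi> (space M) \<in> null_sets N"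
    by blast
  from AE_not_in[OF this] AE_space show ?thesis
    by eventually_elim simp
qed

text \<open>The sets \<open>\<alpha>\<close> such that \<open>\<Phi> \<alpha>\<close> and \<open>\<Phi> (space M - \<alpha>)\<close> are disjoint form a \<open>\<sigma>\<close>-algebra. Since
  \<open>U\<close> is normalizing it contains all \<open>\<Theta> \<beta>\<close>, so that operators commuting with it are right
  multipliers of \<open>U\<close>. Thinness therefore forces it to contain all measurable sets.\<close>

lemma \<Phi>_disjoint:
  assumes a: "\<alpha> \<in> sets M"
  shows "AE y in N. \<not> (y \<in> \<Phi> \<alpha> \<and> y \<in> \<Phi> (space M - \<alpha>))"
proof -
  define \<A> where "\<A> = {\<alpha> \<in> sets M. AE y in N. \<not> (y \<in> \<Phi> \<alpha> \<and> y \<in> \<Phi> (space M - \<alpha>))}"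
  have "sigma_algebra (space M) \<A>"
    unfolding sigma_algebra_iff2
  proof (intro conjI ballI allI impI)
    show "\<A> \<subseteq> Pow (space M)"
      using sets.sets_into_space by (auto simp: \<A>_def)
    show "{} \<in> \<A>"
      using \<Phi>_empty unfolding \<A>_def by (auto elim: eventually_mono)
    fix \<alpha> assume "\<alpha> \<in> \<A>"
    then have a: "\<alpha> \<in> sets M" "AE y in N. \<not> (y \<in> \<Phi> \<alpha> \<and> y \<in> \<Phi> (space M - \<alpha>))"
      by (auto simp: \<A>_def)
    have "space M - (space M - \<alpha>) = \<alpha>"
      using sets.sets_into_space[OF a(1)] by auto
    then show "space M - \<alpha> \<in> \<A>"
      using a unfolding \<A>_def by (auto elim: eventually_mono)
  next
    fix A :: "nat \<Rightarrow> 'x set" assume "range A \<subseteq> \<A>"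
    then have "A i \<in> \<A>" for i
      by blast
    then have A: "A i \<in> sets M" and disj: "AE y in N. \<not> (y \<in> \<Phi> (A i) \<and> y \<in> \<Phi> (space M - A i))" for i
      by (simp_all add: \<A>_def)
    have UA: "(\<Union>i. A i) \<in> sets M"
      using A by auto
    have "AE y in N. y \<in> \<Phi> (space M - (\<Union>i. A i)) \<longrightarrow> y \<in> \<Phi> (space M - A i)" for i
      using A UA by (intro \<Phi>_mono) auto
    then have "AE y in N. \<forall>i. y \<in> \<Phi> (space M - (\<Union>i. A i)) \<longrightarrow> y \<in> \<Phi> (space M - A i)"
      by (intro AE_all_countable[THEN iffD2] allI)
    moreover have "AE y in N. \<forall>i. \<not> (y \<in> \<Phi> (A i) \<and> y \<in> \<Phi> (space M - A i))"
      by (intro AE_all_countable[THEN iffD2] allI disj)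
    ultimately have "AE y in N. \<not> (y \<in> \<Phi> (\<Union>i. A i) \<and> y \<in> \<Phi> (space M - (\<Union>i. A i)))"
      using \<Phi>_UN[of A, OF A] by eventually_elim blast
    then show "(\<Union>i. A i) \<in> \<A>"
      using UA by (simp add: \<A>_def)
  qed
  then have sets: "sets (sigma (space M) \<A>) = \<A>"
    by (rule sigma_algebra.sets_measure_of_eq)
  have \<Theta>_in: "\<Theta> \<beta> \<in> \<A>" if "\<beta> \<in> sets N" for \<beta>
    using \<Theta>(1)[OF that] ortho[OF that] by (simp add: \<A>_def)
  have commutant: "A \<in> mult_masa M"
    if A: "A \<in> bounded_ops M M"
      and comm: "\<And>\<alpha> F. \<alpha> \<in> sets (sigma (space M) \<A>) \<Longrightarrow> F \<in> L2 M \<Longrightarrow> A (Pr M \<alpha> F) = Pr M \<alpha> (A F)" for A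
  proof (rule right_multipliers[OF A])
    fix T assume T: "T \<in> U"
    show "compose (L2 M) T A \<in> U"
    proof (rule reflexive_in_U[OF reflexive_U compose_in[OF U_bounded[OF T] A]])
      fix \<beta> F assume b: "\<beta> \<in> sets N" and F: "F \<in> supp M (\<Theta> \<beta>)"
      note t = \<Theta>(1)[OF b]
      have FL: "F \<in> L2 M"
        by (rule supp_L2[OF t F])
      have "Pr M (\<Theta> \<beta>) (A F) = A F"
        using comm[of "\<Theta> \<beta>", OF _ FL] \<Theta>_in[OF b] Pr_range_fixed[OF t F] by (simp add: sets)
      then have "A F \<in> supp M (\<Theta> \<beta>)"
        by (rule suppI[OF t bounded_opsD(1)[OF A FL]])
      then show "compose (L2 M) T A F \<in> supp N \<beta>"
        using U_maps_\<Theta>[OF b T] FL by (simp add: compose_def)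
    qed
  qed
  obtain \<alpha>' where "\<alpha>' \<in> sets (sigma (space M) \<A>)" and eq: "AE x in M. x \<in> \<alpha> \<longleftrightarrow> x \<in> \<alpha>'"
  proof (rule subalgebra_full[OF sigma_finite_M _ _ _ a, of "sigma (space M) \<A>"])
    show "space (sigma (space M) \<A>) = space M"
      by (rule space_measure_of_conv)
    show "sets (sigma (space M) \<A>) \<subseteq> sets M"
      unfolding sets by (auto simp: \<A>_def)
  qed (rule commutant)
  from this(1) have a': "\<alpha>' \<in> sets M" "AE y in N. \<not> (y \<in> \<Phi> \<alpha>' \<and> y \<in> \<Phi> (space M - \<alpha>'))"
    unfolding sets by (simp_all add: \<A>_def)
  have "AE x in M. x \<in> space M - \<alpha> \<longleftrightarrow> x \<in> space M - \<alpha>'"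
    using eq by eventually_elim simp
  from \<Phi>_cong[OF sets.compl_sets[OF a] sets.compl_sets[OF a'(1)] this] \<Phi>_cong[OF a a'(1) eq] a'(2)
  show ?thesis
    by eventually_elim simp
qed

lemma \<Phi>_compl:
  assumes a: "\<alpha> \<in> sets M"
  shows "AE y in N. y \<in> \<Phi> (space M - \<alpha>) \<longleftrightarrow> y \<notin> \<Phi> \<alpha>"
  using \<Phi>_disjoint[OF a] \<Phi>_Un_compl[OF a] range_full by eventually_elim blast

text \<open>The same argument on the other side: the sets \<open>\<Phi> \<alpha>\<close> form a \<open>\<sigma>\<close>-algebra whose commutant consists
  of left multipliers of \<open>U\<close>.\<close>

lemma \<Phi>_onto:
  assumes b: "\<beta> \<in> sets N"
  obtains \<alpha> where "\<alpha> \<in> sets M" "AE y in N. y \<in> \<beta> \<longleftrightarrow> y \<in> \<Phi> \<alpha>"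
proof -
  define \<B> where "\<B> = {\<beta> \<in> sets N. \<exists>\<alpha>\<in>sets M. AE y in N. y \<in> \<beta> \<longleftrightarrow> y \<in> \<Phi> \<alpha>}"
  have \<B>I: "\<beta> \<in> \<B>" if "\<beta> \<in> sets N" "\<alpha> \<in> sets M" "AE y in N. y \<in> \<beta> \<longleftrightarrow> y \<in> \<Phi> \<alpha>" for \<alpha> \<beta>
    unfolding \<B>_def by (intro CollectI conjI bexI[of _ \<alpha>] that)
  have "sigma_algebra (space N) \<B>"
    unfolding sigma_algebra_iff2
  proof (intro conjI ballI allI impI)
    show "\<B> \<subseteq> Pow (space N)"
      unfolding \<B>_def using sets.sets_into_space by blast
    show "{} \<in> \<B>"
      by (rule \<B>I[of "{}" "{}"]) (use \<Phi>_empty in \<open>auto elim: eventually_mono\<close>)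
    fix \<beta> assume "\<beta> \<in> \<B>"
    then obtain \<alpha> where a: "\<beta> \<in> sets N" "\<alpha> \<in> sets M" "AE y in N. y \<in> \<beta> \<longleftrightarrow> y \<in> \<Phi> \<alpha>"
      unfolding \<B>_def by blast
    have "AE y in N. y \<in> space N - \<beta> \<longleftrightarrow> y \<in> \<Phi> (space M - \<alpha>)"
      using a(3) \<Phi>_compl[OF a(2)] AE_space by eventually_elim simp
    then show "space N - \<beta> \<in> \<B>"
      by (rule \<B>I[OF sets.compl_sets[OF a(1)] sets.compl_sets[OF a(2)]])
  next
    fix B :: "nat \<Rightarrow> 'y set" assume "range B \<subseteq> \<B>"
    then have "B i \<in> \<B>" for i
      by blast
    then have *: "B i \<in> sets N \<and> (\<exists>\<alpha>. \<alpha> \<in> sets M \<and> (AE y in N. y \<in> B i \<longleftrightarrow> y \<in> \<Phi> \<alpha>))" for i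
      unfolding \<B>_def Bex_def mem_Collect_eq .
    then have B: "B i \<in> sets N" for i
      by (rule conjunct1)
    from * have "\<forall>i. \<exists>\<alpha>. \<alpha> \<in> sets M \<and> (AE y in N. y \<in> B i \<longleftrightarrow> y \<in> \<Phi> \<alpha>)"
      by (intro allI) (rule conjunct2)
    then obtain A where "\<forall>i. A i \<in> sets M \<and> (AE y in N. y \<in> B i \<longleftrightarrow> y \<in> \<Phi> (A i))"
      by (rule choice[THEN exE])
    then have A: "A i \<in> sets M" and BA: "AE y in N. y \<in> B i \<longleftrightarrow> y \<in> \<Phi> (A i)" for i
      by blast+
    have "AE y in N. \<forall>i. y \<in> B i \<longleftrightarrow> y \<in> \<Phi> (A i)"
      by (intro AE_all_countable[THEN iffD2] allI BA)
    then have "AE y in N. y \<in> (\<Union>i. B i) \<longleftrightarrow> y \<in> \<Phi> (\<Union>i. A i)"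
      using \<Phi>_UN[of A, OF A] by eventually_elim simp
    then show "(\<Union>i. B i) \<in> \<B>"
      using A B by (intro \<B>I[of _ "\<Union>i. A i"]) auto
  qed
  then have sets: "sets (sigma (space N) \<B>) = \<B>"
    by (rule sigma_algebra.sets_measure_of_eq)
  have commutant: "B \<in> mult_masa N"
    if B: "B \<in> bounded_ops N N"
      and comm: "\<And>\<beta> G. \<beta> \<in> sets (sigma (space N) \<B>) \<Longrightarrow> G \<in> L2 N \<Longrightarrow> B (Pr N \<beta> G) = Pr N \<beta> (B G)" for B
  proof (rule left_multipliers[OF B])
    fix T assume T: "T \<in> U"
    show "compose (L2 M) B T \<in> U"
    proof (rule reflexive_in_U[OF reflexive_U compose_in[OF B U_bounded[OF T]]])
      fix \<beta> F assume b: "\<beta> \<in> sets N" and F: "F \<in> supp M (\<Theta> \<beta>)"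
      note t = \<Theta>(1)[OF b]
      note p = \<Phi>(1)[OF t]
      have FL: "F \<in> L2 M"
        by (rule supp_L2[OF t F])
      have "\<Phi> (\<Theta> \<beta>) \<in> \<B>"
        by (rule \<B>I[OF p t]) simp
      then have "Pr N (\<Phi> (\<Theta> \<beta>)) (B (T F)) = B (T F)"
        using comm[of "\<Phi> (\<Theta> \<beta>)", OF _ U_L2[OF T FL]] Pr_range_fixed[OF p U_maps_\<Phi>[OF t T F]]
        by (simp add: sets)
      then have "B (T F) \<in> supp N (\<Phi> (\<Theta> \<beta>))"
        by (rule suppI[OF p bounded_opsD(1)[OF B U_L2[OF T FL]]])
      moreover have "supp N (\<Phi> (\<Theta> \<beta>)) \<subseteq> supp N \<beta>"
        using supp_le_iff[OF sigma_finite_N p b] counit[OF b] by blast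
      ultimately show "compose (L2 M) B T F \<in> supp N \<beta>"
        using FL by (auto simp: compose_def)
    qed
  qed
  obtain \<beta>' where "\<beta>' \<in> sets (sigma (space N) \<B>)" and eq: "AE y in N. y \<in> \<beta> \<longleftrightarrow> y \<in> \<beta>'"
  proof (rule subalgebra_full[OF sigma_finite_N _ _ _ b, of "sigma (space N) \<B>"])
    show "space (sigma (space N) \<B>) = space N"
      by (rule space_measure_of_conv)
    show "sets (sigma (space N) \<B>) \<subseteq> sets N"
      unfolding sets by (simp add: \<B>_def subset_iff)
  qed (rule commutant)
  from this(1)[unfolded sets] obtain \<alpha> where a: "\<alpha> \<in> sets M" "AE y in N. y \<in> \<beta>' \<longleftrightarrow> y \<in> \<Phi> \<alpha>"
    unfolding \<B>_def by blast
  have "AE y in N. y \<in> \<beta> \<longleftrightarrow> y \<in> \<Phi> \<alpha>"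
    using eq a(2) by eventually_elim simp
  with a(1) show thesis
    by (rule that)
qed

text \<open>Thus \<open>\<Phi>\<close> and \<open>\<Theta>\<close> are mutually inverse isomorphisms modulo null sets, and the point maps that
  realize them are almost inverse to each other.\<close>

lemma \<Phi>_\<Theta>:
  assumes b: "\<beta> \<in> sets N"
  shows "AE y in N. y \<in> \<Phi> (\<Theta> \<beta>) \<longleftrightarrow> y \<in> \<beta>"
proof -
  obtain \<alpha> where a: "\<alpha> \<in> sets M" "AE y in N. y \<in> \<beta> \<longleftrightarrow> y \<in> \<Phi> \<alpha>"
    using \<Phi>_onto[OF b] by metis
  have "AE y in N. y \<in> \<Phi> \<alpha> \<longrightarrow> y \<in> \<beta>"
    using a(2) by eventually_elim simp
  then have "AE x in M. x \<in> \<alpha> \<longrightarrow> x \<in> \<Theta> \<beta>"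
    using galois[OF a(1) b] by blast
  from \<Phi>_mono[OF a(1) \<Theta>(1)[OF b] this] a(2) counit[OF b] show ?thesis
    by eventually_elim blast
qed

lemma \<Theta>_\<Phi>:
  assumes a: "\<alpha> \<in> sets M"
  shows "AE x in M. x \<in> \<Theta> (\<Phi> \<alpha>) \<longleftrightarrow> x \<in> \<alpha>"
proof -
  define D where "D = \<Theta> (\<Phi> \<alpha>) - \<alpha>"
  note p = \<Phi>(1)[OF a]
  note t = \<Theta>(1)[OF p]
  have D: "D \<in> sets M"
    using a t by (auto simp: D_def)
  have "AE y in N. y \<in> \<Phi> D \<longrightarrow> y \<in> \<Phi> (\<Theta> (\<Phi> \<alpha>))"
    by (intro \<Phi>_mono D t) (auto simp: D_def)
  moreover have "AE y in N. y \<in> \<Phi> D \<longrightarrow> y \<in> \<Phi> (space M - \<alpha>)"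
    using sets.sets_into_space[OF t] by (intro \<Phi>_mono D sets.compl_sets a) (auto simp: D_def)
  ultimately have "AE y in N. y \<in> \<Phi> D \<longrightarrow> y \<in> {}"
    using counit[OF p] \<Phi>_disjoint[OF a] by eventually_elim blast
  then have "AE x in M. x \<in> D \<longrightarrow> x \<in> \<Theta> {}"
    by (subst (asm) galois[OF D]) auto
  then show ?thesis
    using kernel_null unit[OF a] by eventually_elim (auto simp: D_def)
qed

lemma \<Theta>_full: "AE x in M. x \<in> \<Theta> (space N)"
proof -
  have "AE y in N. y \<in> \<Phi> (space M) \<longrightarrow> y \<in> space N"
    using AE_space by eventually_elim simp
  then have "AE x in M. x \<in> space M \<longrightarrow> x \<in> \<Theta> (space N)"
    by (subst (asm) galois) auto
  then show ?thesis
    using AE_space by eventually_elim simp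
qed

lemma \<Theta>_compl:
  assumes b: "\<beta> \<in> sets N"
  shows "AE x in M. x \<in> \<Theta> (space N - \<beta>) \<longleftrightarrow> x \<notin> \<Theta> \<beta>"
proof -
  note t = \<Theta>(1)[OF b]
  note ct = sets.compl_sets[OF t]
  have "AE y in N. y \<in> space N - \<beta> \<longleftrightarrow> y \<in> \<Phi> (space M - \<Theta> \<beta>)"
    using \<Phi>_compl[OF t] \<Phi>_\<Theta>[OF b] AE_space by eventually_elim simp
  from \<Theta>_cong[OF sets.compl_sets[OF b] \<Phi>(1)[OF ct] this] \<Theta>_\<Phi>[OF ct] AE_space
  show ?thesis
    by eventually_elim simp
qed

lemma \<Theta>_UN:
  fixes B :: "nat \<Rightarrow> 'y set"
  assumes B: "\<And>i. B i \<in> sets N"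
  shows "AE x in M. x \<in> \<Theta> (\<Union>i. B i) \<longleftrightarrow> (\<exists>i. x \<in> \<Theta> (B i))"
proof -
  have T: "\<Theta> (B i) \<in> sets M" for i
    using \<Theta>(1) B by blast
  have UT: "(\<Union>i. \<Theta> (B i)) \<in> sets M" and UB: "(\<Union>i. B i) \<in> sets N"
    using T B by auto
  have "AE y in N. \<forall>i. y \<in> \<Phi> (\<Theta> (B i)) \<longleftrightarrow> y \<in> B i"
    by (intro AE_all_countable[THEN iffD2] allI \<Phi>_\<Theta> B)
  then have "AE y in N. y \<in> (\<Union>i. B i) \<longleftrightarrow> y \<in> \<Phi> (\<Union>i. \<Theta> (B i))"
    using \<Phi>_UN[of "\<lambda>i. \<Theta> (B i)", OF T] by eventually_elim simp
  from \<Theta>_cong[OF UB \<Phi>(1)[OF UT] this] \<Theta>_\<Phi>[OF UT] show ?thesis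
    by eventually_elim simp
qed

lemma spaces_nonempty: "space M \<noteq> {}" "space N \<noteq> {}"
proof -
  show "space M \<noteq> {}"
  proof
    assume e: "space M = {}"
    have "S F = l2_zero N" if "S \<in> U" "F \<in> L2 M" for S F
    proof -
      have "F = l2_zero M"
        by (rule L2_eqI[OF that(2) zero_in]) (use AE_space in eventually_elim, simp add: e)
      then show ?thesis
        using bounded_opsD(5)[OF U_bounded[OF that(1)]] by simp
    qed
    then show False
      using U_trivial_iff not_zero by blast
  qed
  show "space N \<noteq> {}"
  proof
    assume e: "space N = {}"
    have "S F = l2_zero N" if "S \<in> U" "F \<in> L2 M" for S F
      by (rule L2_eqI[OF U_L2[OF that] zero_in]) (use AE_space in eventually_elim, simp add: e)
    then show False
      using U_trivial_iff not_zero by blast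
  qed
qed

theorem supported_on_graph:
  "\<exists>f\<in>measurable M N. almost_one_to_one M f \<and> almost_onto M N f \<and>
     preserves_null_sets M N f \<and> U = M_max M N {(x, f x) | x. x \<in> space M}"
proof -
  obtain f where f: "f \<in> measurable M N" and f\<Theta>: "\<And>\<beta>. \<beta> \<in> sets N \<Longrightarrow> AE x in M. f x \<in> \<beta> \<longleftrightarrow> x \<in> \<Theta> \<beta>"
    using point_realization[OF standard_N spaces_nonempty(2) \<Theta>(1) \<Theta>_full \<Theta>_compl \<Theta>_UN] by metis
  obtain g where g: "g \<in> measurable N M" and g\<Phi>: "\<And>\<alpha>. \<alpha> \<in> sets M \<Longrightarrow> AE y in N. g y \<in> \<alpha> \<longleftrightarrow> y \<in> \<Phi> \<alpha>"
    using point_realization[OF standard_M spaces_nonempty(1) \<Phi>(1) range_full \<Phi>_compl \<Phi>_UN] by metis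
  have null_f: "preserves_null_sets M N f"
    unfolding preserves_null_sets_def
  proof
    fix \<beta> assume b: "\<beta> \<in> null_sets N"
    then have bs: "\<beta> \<in> sets N" and "AE y in N. y \<notin> \<beta>"
      by (auto intro: AE_not_in)
    from this(2) have "AE y in N. y \<in> \<beta> \<longleftrightarrow> y \<in> {}"
      by eventually_elim simp
    from \<Theta>_cong[OF bs sets.empty_sets this] kernel_null f\<Theta>[OF bs]
    have "AE x in M. x \<notin> f -` \<beta> \<inter> space M"
      by eventually_elim simp
    then show "f -` \<beta> \<inter> space M \<in> null_sets M"
      using AE_iff_null_sets[OF measurable_sets[OF f bs]] by blast
  qed
  have null_g: "preserves_null_sets N M g"
    unfolding preserves_null_sets_def
  proof
    fix \<alpha> assume a: "\<alpha> \<in> null_sets M"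
    then have as: "\<alpha> \<in> sets M" and "AE x in M. x \<notin> \<alpha>"
      by (auto intro: AE_not_in)
    from this(2) have "AE x in M. x \<in> \<alpha> \<longleftrightarrow> x \<in> {}"
      by eventually_elim simp
    from \<Phi>_cong[OF as sets.empty_sets this] \<Phi>_empty g\<Phi>[OF as]
    have "AE y in N. y \<notin> g -` \<alpha> \<inter> space N"
      by eventually_elim simp
    then show "g -` \<alpha> \<inter> space N \<in> null_sets N"
      using AE_iff_null_sets[OF measurable_sets[OF g as]] by blast
  qed
  have gf: "AE x in M. g (f x) = x"
  proof (rule inverse_point_maps[OF standard_M f g null_f \<Phi>(1) g\<Phi>])
    fix \<alpha> assume a: "\<alpha> \<in> sets M"
    show "AE x in M. f x \<in> \<Phi> \<alpha> \<longleftrightarrow> x \<in> \<alpha>"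
      using f\<Theta>[OF \<Phi>(1)[OF a]] \<Theta>_\<Phi>[OF a] by eventually_elim simp
  qed
  have fg: "AE y in N. f (g y) = y"
  proof (rule inverse_point_maps[OF standard_N g f null_g \<Theta>(1) f\<Theta>])
    fix \<beta> assume b: "\<beta> \<in> sets N"
    show "AE y in N. g y \<in> \<Theta> \<beta> \<longleftrightarrow> y \<in> \<beta>"
      using g\<Phi>[OF \<Theta>(1)[OF b]] \<Phi>_\<Theta>[OF b] by eventually_elim simp
  qed
  have "almost_one_to_one M f"
  proof -
    obtain A where A: "\<And>x. x \<in> space M - A \<Longrightarrow> g (f x) = x" "A \<in> null_sets M"
      using AE_E3[OF gf] by blast
    have "inj_on f (space M - A)"
      by (rule inj_on_inverseI[of _ g]) (rule A(1))
    then show ?thesis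
      using A(2) by (auto simp: almost_one_to_one_def)
  qed
  moreover have "almost_onto M N f"
    unfolding almost_onto_def
  proof
    fix A assume "A \<in> null_sets M"
    then have "AE y in N. g y \<notin> A"
      by (intro AE_nonsingular[OF g null_g] AE_not_in)
    then have "AE y in N. f (g y) = y \<and> g y \<notin> A"
      using fg by eventually_elim simp
    then obtain B where B: "\<And>y. y \<in> space N - B \<Longrightarrow> f (g y) = y \<and> g y \<notin> A" "B \<in> null_sets N"
      using AE_E3 by blast
    have "y \<in> B" if y: "y \<in> space N" "y \<notin> f ` (space M - A)" for y
    proof (rule ccontr)
      assume "y \<notin> B"
      then have "f (g y) = y" "g y \<in> space M - A"
        using B(1)[of y] y(1) measurable_space[OF g] by auto
      then show False
        using y(2) by (metis imageI)
    qed
    then show "\<exists>B\<in>null_sets N. space N - f ` (space M - A) \<subseteq> B"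
      using B(2) by blast
  qed
  moreover have "U = M_max M N {(x, f x) | x. x \<in> space M}"
  proof (rule set_eqI)
    fix T
    have eq: "supp M (f -` \<beta> \<inter> space M) = supp M (\<Theta> \<beta>)" if b: "\<beta> \<in> sets N" for \<beta>
    proof -
      have "AE x in M. x \<in> f -` \<beta> \<inter> space M \<longleftrightarrow> x \<in> \<Theta> \<beta>"
        using f\<Theta>[OF b] AE_space by eventually_elim simp
      then show ?thesis
        using Pr_cong[OF measurable_sets[OF f b] \<Theta>(1)[OF b]] by simp
    qed
    have "T \<in> U \<longleftrightarrow> T \<in> bounded_ops M N \<and> (\<forall>\<beta>\<in>sets N. \<forall>F\<in>supp M (\<Theta> \<beta>). T F \<in> supp N \<beta>)"
    proof
      assume T: "T \<in> U"
      show "T \<in> bounded_ops M N \<and> (\<forall>\<beta>\<in>sets N. \<forall>F\<in>supp M (\<Theta> \<beta>). T F \<in> supp N \<beta>)"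
        by (intro conjI ballI U_bounded[OF T] U_maps_\<Theta>[OF _ T])
    next
      assume T: "T \<in> bounded_ops M N \<and> (\<forall>\<beta>\<in>sets N. \<forall>F\<in>supp M (\<Theta> \<beta>). T F \<in> supp N \<beta>)"
      show "T \<in> U"
        by (rule reflexive_in_U[OF reflexive_U conjunct1[OF T]]) (rule bspec[OF bspec[OF conjunct2[OF T]]])
    qed
    then show "T \<in> U \<longleftrightarrow> T \<in> M_max M N {(x, f x) | x. x \<in> space M}"
      unfolding M_max_graph_iff[OF f null_f sigma_finite_M] by (simp only: eq cong: ball_cong)
  qed
  ultimately show ?thesis
    using f null_f by blast
qed

end

section \<open>Graphs support thin bimodules\<close>

locale graph_bimodule = normalizing M N U
  for M :: "'x measure" and N :: "'y measure" and U +
  fixes f :: "'x \<Rightarrow> 'y"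
  assumes f: "f \<in> measurable M N" and one_to_one: "almost_one_to_one M f"
    and onto: "almost_onto M N f" and null: "preserves_null_sets M N f"
    and U_graph: "U = M_max M N {(x, f x) | x. x \<in> space M}"
    and nonempty: "space M \<noteq> {}"
begin

abbreviation pre :: "'y set \<Rightarrow> 'x set" where
  "pre \<beta> \<equiv> f -` \<beta> \<inter> space M"

lemma pre_sets: "\<beta> \<in> sets N \<Longrightarrow> pre \<beta> \<in> sets M"
  by (rule measurable_sets[OF f])

lemma U_iff: "T \<in> U \<longleftrightarrow> T \<in> bounded_ops M N \<and> (\<forall>\<beta>\<in>sets N. \<forall>F\<in>supp M (pre \<beta>). T F \<in> supp N \<beta>)"
  unfolding U_graph by (rule M_max_graph_iff[OF f null sigma_finite_M])

lemma U_maps: "T \<in> U \<Longrightarrow> \<beta> \<in> sets N \<Longrightarrow> F \<in> supp M (pre \<beta>) \<Longrightarrow> T F \<in> supp N \<beta>"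
  unfolding U_iff by blast

text \<open>The map \<open>Map U\<close>, an ortho-map by hypothesis, witnesses reflexivity: its value at the projection
  of the preimage of \<open>\<beta>\<close> lies below the projection of \<open>\<beta>\<close>.\<close>

lemma reflexive_U: "reflexive M N U"
  unfolding reflexive_def
proof (intro exI[of _ \<phi>] conjI \<phi>_sup_preserving set_eqI iffI)
  fix T assume T: "T \<in> U"
  show "T \<in> {T \<in> bounded_ops M N. \<forall>P\<in>projections M.
      compose (L2 M) (proj_compl N (\<phi> P)) (compose (L2 M) T P) = op_zero M N}"
  proof (intro CollectI conjI ballI)
    fix P assume P: "P \<in> projections M"
    have "T ` P ` L2 M \<subseteq> \<phi> P ` L2 N"
      by (intro image_subsetI \<phi>_upper[OF P T] imageI)
    then show "compose (L2 M) (proj_compl N (\<phi> P)) (compose (L2 M) T P) = op_zero M N"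
      using compl_compose_zero_iff[OF \<phi>_projection(1)[OF P] U_bounded[OF T] P] by simp
  qed (rule U_bounded[OF T])
next
  fix T assume T: "T \<in> {T \<in> bounded_ops M N. \<forall>P\<in>projections M.
      compose (L2 M) (proj_compl N (\<phi> P)) (compose (L2 M) T P) = op_zero M N}"
  then have Tb: "T \<in> bounded_ops M N"
    by simp
  show "T \<in> U"
    unfolding U_iff
  proof (intro conjI ballI Tb)
    fix \<beta> F assume b: "\<beta> \<in> sets N" and F: "F \<in> supp M (pre \<beta>)"
    note P = Pr_projection[OF pre_sets[OF b]]
    have "T ` supp M (pre \<beta>) \<subseteq> \<phi> (Pr M (pre \<beta>)) ` L2 N"
      using compl_compose_zero_iff[OF \<phi>_projection(1)[OF P] Tb P] T P by simp
    also have "\<dots> \<subseteq> supp N \<beta>"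
      by (rule \<phi>_least[OF P proj_range_csub[OF Pr_projection[OF b]]]) (rule U_maps[OF _ b])
    finally show "T F \<in> supp N \<beta>"
      using imageI[OF F, of T] by (rule subsetD)
  qed
qed

text \<open>Discarding a null set of the domain only discards a null set of values.\<close>

lemma reflect_AE:
  assumes P: "{y \<in> space N. P y} \<in> sets N" and ae: "AE x in M. P (f x)"
  shows "AE y in N. P y"
proof -
  obtain A where A: "\<And>x. x \<in> space M - A \<Longrightarrow> P (f x)" "A \<in> null_sets M"
    using AE_E3[OF ae] by blast
  obtain B where B: "B \<in> null_sets N" "space N - f ` (space M - A) \<subseteq> B"
    using onto A(2) unfolding almost_onto_def by blast
  show ?thesis
    using AE_not_in[OF B(1)] AE_space
  proof eventually_elim
    case (elim y)
    then obtain x where "x \<in> space M - A" "y = f x"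
      using B(2) by blast
    then show ?case
      using A(1) by blast
  qed
qed

text \<open>Since \<open>f\<close> is almost injective, every measurable set is a preimage under \<open>f\<close> up to a null set.\<close>

definition \<eta> :: "'x set \<Rightarrow> 'y set" where
  "\<eta> \<alpha> = (SOME \<beta>. \<beta> \<in> sets N \<and> (AE x in M. f x \<in> \<beta> \<longleftrightarrow> x \<in> \<alpha>))"

lemma \<eta>:
  assumes a: "\<alpha> \<in> sets M"
  shows "\<eta> \<alpha> \<in> sets N" "AE x in M. f x \<in> \<eta> \<alpha> \<longleftrightarrow> x \<in> \<alpha>"
proof -
  obtain A where A: "A \<in> null_sets M" "inj_on f (space M - A)"
    using one_to_one unfolding almost_one_to_one_def by blast
  obtain \<beta> where "\<beta> \<in> sets N" "AE x in M. f x \<in> \<beta> \<longleftrightarrow> x \<in> \<alpha>"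
    using injective_preimages_full[OF standard_M standard_N f A a] by metis
  then have "\<exists>\<beta>. \<beta> \<in> sets N \<and> (AE x in M. f x \<in> \<beta> \<longleftrightarrow> x \<in> \<alpha>)"
    by (intro exI[of _ \<beta>] conjI)
  from someI_ex[OF this, folded \<eta>_def]
  show "\<eta> \<alpha> \<in> sets N" "AE x in M. f x \<in> \<eta> \<alpha> \<longleftrightarrow> x \<in> \<alpha>"
    by (rule conjunct1, rule conjunct2)
qed

lemma \<eta>_full: "AE y in N. y \<in> \<eta> (space M)"
proof (rule reflect_AE)
  show "{y \<in> space N. y \<in> \<eta> (space M)} \<in> sets N"
    using \<eta>(1)[OF sets.top] by measurable
  show "AE x in M. f x \<in> \<eta> (space M)"
    using \<eta>(2)[OF sets.top] AE_space by eventually_elim simp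
qed

lemma \<eta>_compl:
  assumes a: "\<alpha> \<in> sets M"
  shows "AE y in N. y \<in> \<eta> (space M - \<alpha>) \<longleftrightarrow> y \<notin> \<eta> \<alpha>"
proof (rule reflect_AE)
  note c = sets.compl_sets[OF a]
  show "{y \<in> space N. y \<in> \<eta> (space M - \<alpha>) \<longleftrightarrow> y \<notin> \<eta> \<alpha>} \<in> sets N"
    using \<eta>(1)[OF a] \<eta>(1)[OF c] by measurable
  show "AE x in M. f x \<in> \<eta> (space M - \<alpha>) \<longleftrightarrow> f x \<notin> \<eta> \<alpha>"
    using \<eta>(2)[OF a] \<eta>(2)[OF c] AE_space by eventually_elim simp
qed

lemma \<eta>_UN:
  fixes A :: "nat \<Rightarrow> 'x set"
  assumes A: "\<And>i. A i \<in> sets M"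
  shows "AE y in N. y \<in> \<eta> (\<Union>i. A i) \<longleftrightarrow> (\<exists>i. y \<in> \<eta> (A i))"
proof (rule reflect_AE)
  have UA: "(\<Union>i. A i) \<in> sets M"
    using A by auto
  have [measurable]: "\<eta> (A i) \<in> sets N" "\<eta> (\<Union>i. A i) \<in> sets N" for i
    using \<eta>(1) A UA by blast+
  show "{y \<in> space N. y \<in> \<eta> (\<Union>i. A i) \<longleftrightarrow> (\<exists>i. y \<in> \<eta> (A i))} \<in> sets N"
    by measurable
  have "AE x in M. \<forall>i. f x \<in> \<eta> (A i) \<longleftrightarrow> x \<in> A i"
    by (intro AE_all_countable[THEN iffD2] allI \<eta>(2) A)
  then show "AE x in M. f x \<in> \<eta> (\<Union>i. A i) \<longleftrightarrow> (\<exists>i. f x \<in> \<eta> (A i))"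
    using \<eta>(2)[OF UA] by eventually_elim simp
qed

text \<open>A weighted composition operator with the almost everywhere inverse of \<open>f\<close> lies in \<open>U\<close>. It is
  injective, and the image under it of a cyclic vector vanishes on no set of positive measure.\<close>

lemma composition_in_U:
  obtains T where "T \<in> U" "\<And>F. F \<in> L2 M \<Longrightarrow> T F = l2_zero N \<Longrightarrow> F = l2_zero M"
    "\<exists>W\<in>L2 M. AE y in N. rep (T W) y \<noteq> 0"
proof -
  obtain g where g: "g \<in> measurable N M" and g\<eta>: "\<And>\<alpha>. \<alpha> \<in> sets M \<Longrightarrow> AE y in N. g y \<in> \<alpha> \<longleftrightarrow> y \<in> \<eta> \<alpha>"
    using point_realization[OF standard_M nonempty \<eta>(1) \<eta>_full \<eta>_compl \<eta>_UN] by metis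
  have null_g: "preserves_null_sets N M g"
    unfolding preserves_null_sets_def
  proof
    fix \<alpha> assume a: "\<alpha> \<in> null_sets M"
    then have as: "\<alpha> \<in> sets M" and ae: "AE x in M. x \<notin> \<alpha>"
      by (auto intro: AE_not_in)
    have "AE y in N. y \<notin> \<eta> \<alpha>"
    proof (rule reflect_AE)
      show "{y \<in> space N. y \<notin> \<eta> \<alpha>} \<in> sets N"
        using \<eta>(1)[OF as] by measurable
      show "AE x in M. f x \<notin> \<eta> \<alpha>"
        using \<eta>(2)[OF as] ae by eventually_elim simp
    qed
    then have "AE y in N. y \<notin> g -` \<alpha> \<inter> space N"
      using g\<eta>[OF as] by eventually_elim simp
    then show "g -` \<alpha> \<inter> space N \<in> null_sets N"
      using AE_iff_null_sets[OF measurable_sets[OF g as]] by blast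
  qed
  have gf: "AE x in M. g (f x) = x"
    by (rule inverse_point_maps[OF standard_M f g null \<eta>(1) g\<eta> \<eta>(2)])
  obtain T and c :: "'y \<Rightarrow> real" where T: "T \<in> bounded_ops M N" and c: "\<And>y. c y > 0"
    and rT: "\<And>F. F \<in> L2 M \<Longrightarrow> AE y in N. rep (T F) y = of_real (c y) * rep F (g y)"
    using weighted_composition[OF sigma_finite_M sigma_finite_N g null_g] by metis
  have c0: "c y \<noteq> 0" for y
    using c[of y] by simp
  have "T \<in> U"
    unfolding U_iff
  proof (intro conjI ballI T)
    fix \<beta> F assume b: "\<beta> \<in> sets N" and F: "F \<in> supp M (pre \<beta>)"
    note p = pre_sets[OF b]
    have FL: "F \<in> L2 M" and F0: "AE x in M. x \<notin> pre \<beta> \<longrightarrow> rep F x = 0"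
      using F Pr_range_iff[OF p] by blast+
    have "AE y in N. y \<in> \<eta> (pre \<beta>) \<longleftrightarrow> y \<in> \<beta>"
    proof (rule reflect_AE)
      show "{y \<in> space N. y \<in> \<eta> (pre \<beta>) \<longleftrightarrow> y \<in> \<beta>} \<in> sets N"
        using \<eta>(1)[OF p] b by measurable
      show "AE x in M. f x \<in> \<eta> (pre \<beta>) \<longleftrightarrow> f x \<in> \<beta>"
        using \<eta>(2)[OF p] AE_space by eventually_elim simp
    qed
    then have "AE y in N. y \<notin> \<beta> \<longrightarrow> rep (T F) y = 0"
      using g\<eta>[OF p] AE_nonsingular[OF g null_g F0] rT[OF FL] by eventually_elim simp
    then show "T F \<in> supp N \<beta>"
      using Pr_range_iff[OF b] bounded_opsD(1)[OF T FL] by blast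
  qed
  moreover have "F = l2_zero M" if F: "F \<in> L2 M" and z: "T F = l2_zero N" for F
  proof -
    have "AE y in N. rep (T F) y = 0"
      using eq_zero_iff[OF bounded_opsD(1)[OF T F]] z by blast
    then have "AE y in N. rep F (g y) = 0"
      using rT[OF F] by eventually_elim (simp add: c0)
    from AE_nonsingular[OF f null this] gf have "AE x in M. rep F x = 0"
      by eventually_elim simp
    then show ?thesis
      using eq_zero_iff[OF F] by blast
  qed
  moreover have "\<exists>W\<in>L2 M. AE y in N. rep (T W) y \<noteq> 0"
  proof -
    obtain w W where cyc: "cyclic M w W"
      using cyclic_exists[OF sigma_finite_M] by metis
    then have W: "W \<in> L2 M" and w: "\<And>x. w x > 0" "AE x in M. rep W x = of_real (w x)"
      by (auto simp: cyclic_def)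
    have w0: "w x \<noteq> 0" for x
      using w(1)[of x] by simp
    have "AE y in N. rep (T W) y \<noteq> 0"
      using rT[OF W] AE_nonsingular[OF g null_g w(2)] by eventually_elim (simp add: c0 w0)
    then show ?thesis
      using W by blast
  qed
  ultimately show thesis
    by (rule that)
qed

text \<open>The smallest set carrying the ranges of all operators in \<open>U\<close> carries an almost nowhere vanishing
  function, so it is everything.\<close>

lemma range_total:
  assumes V: "l2_closed_subspace N V" and range: "\<And>S F. S \<in> U \<Longrightarrow> F \<in> L2 M \<Longrightarrow> S F \<in> V"
  shows "V = L2 N"
proof -
  obtain T W where T: "T \<in> U" and W: "W \<in> L2 M" and TW: "AE y in N. rep (T W) y \<noteq> 0"
    using composition_in_U by metis
  note p = \<Phi>(1)[OF sets.top]
  have "T W \<in> supp N (\<Phi> (space M))"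
    using U_maps_\<Phi>[OF sets.top T, of W] W by (simp only: supp_space)
  then have "AE y in N. y \<notin> \<Phi> (space M) \<longrightarrow> rep (T W) y = 0"
    using Pr_range_iff[OF p] by blast
  then have "AE y in N. y \<in> space N \<longrightarrow> y \<in> \<Phi> (space M)"
    using TW by eventually_elim blast
  then have "L2 N \<subseteq> supp N (\<Phi> (space M))"
    using supp_le_iff[OF sigma_finite_N sets.top p] by (simp only: supp_space)
  also have "supp N (\<Phi> (space M)) = \<phi> (Pr M (space M)) ` L2 N"
    using \<Phi>(2)[OF sets.top] by simp
  also have "\<dots> \<subseteq> V"
    by (rule \<phi>_least[OF Pr_projection[OF sets.top] V]) (rule range, simp_all only: supp_space)
  finally show ?thesis
    using csubD(1)[OF V] by blast
qed

end

lemma masa_if_off_diagonal_zero: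
  assumes M: "sigma_finite_measure M" and A: "A \<in> bounded_ops M M"
    and off: "\<And>\<alpha> F. \<alpha> \<in> sets M \<Longrightarrow> F \<in> L2 M \<Longrightarrow> Pr M (space M - \<alpha>) (A (Pr M \<alpha> F)) = l2_zero M"
  shows "A \<in> mult_masa M"
proof (rule commutant_masa[OF M A])
  fix \<alpha> F assume a: "\<alpha> \<in> sets M" and F: "F \<in> L2 M"
  note c = sets.compl_sets[OF a]
  have AL: "A G \<in> L2 M" if "G \<in> L2 M" for G
    by (rule bounded_opsD(1)[OF A that])
  have "space M - (space M - \<alpha>) = \<alpha>"
    using sets.sets_into_space[OF a] by auto
  then have z: "compose (L2 M) (Pr M \<alpha>) A (Pr M (space M - \<alpha>) F) = l2_zero M"
    using off[OF c F] Pr_L2[OF c F] by (simp add: compose_def)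
  have "A (Pr M \<alpha> F) = Pr M \<alpha> (A (Pr M \<alpha> F))"
    by (rule Pr_absorb[OF a AL[OF Pr_L2[OF a F]] off[OF a F], symmetric])
  also have "\<dots> = compose (L2 M) (Pr M \<alpha>) A (Pr M \<alpha> F)"
    using Pr_L2[OF a F] by (simp add: compose_def)
  also have "\<dots> = compose (L2 M) (Pr M \<alpha>) A F"
    by (rule op_Pr_absorb[OF compose_in[OF Pr_in[OF a] A] a F z])
  also have "\<dots> = Pr M \<alpha> (A F)"
    using F by (simp add: compose_def)
  finally show "A (Pr M \<alpha> F) = Pr M \<alpha> (A F)" .
qed

context graph_bimodule
begin

lemma supp_cong: "\<alpha> \<in> sets M \<Longrightarrow> \<alpha>' \<in> sets M \<Longrightarrow> AE x in M. x \<in> \<alpha> \<longleftrightarrow> x \<in> \<alpha>' \<Longrightarrow> supp M \<alpha> = supp M \<alpha>'"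
  using Pr_cong by metis

text \<open>Let \<open>A\<close> be a right multiplier and \<open>\<alpha>\<close> the preimage of \<open>\<beta>\<close>. For \<open>F\<close> supported on \<open>\<alpha>\<close> the
  functions \<open>T A F\<close> and \<open>T P A F\<close>, with \<open>P\<close> the projection to \<open>\<alpha>\<close>, are supported on \<open>\<beta>\<close>, and their
  difference is supported off \<open>\<beta>\<close>. As \<open>T\<close> is injective, \<open>A F\<close> is supported on \<open>\<alpha>\<close>.\<close>

lemma right_multiplier_masa:
  assumes A: "A \<in> bounded_ops M M" and mult: "\<And>T. T \<in> U \<Longrightarrow> compose (L2 M) T A \<in> U"
  shows "A \<in> mult_masa M"
proof (rule masa_if_off_diagonal_zero[OF sigma_finite_M A])
  fix \<alpha> F assume a: "\<alpha> \<in> sets M" and F: "F \<in> L2 M"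
  note c = sets.compl_sets[OF a] and b = \<eta>(1)[OF a]
  note cb = sets.compl_sets[OF b]
  obtain T where T: "T \<in> U" and inj: "\<And>F. F \<in> L2 M \<Longrightarrow> T F = l2_zero N \<Longrightarrow> F = l2_zero M"
    using composition_in_U by metis
  note Tb = U_bounded[OF T]
  have "AE x in M. x \<in> \<alpha> \<longleftrightarrow> x \<in> pre (\<eta> \<alpha>)"
    using \<eta>(2)[OF a] AE_space by eventually_elim simp
  then have s1: "supp M \<alpha> = supp M (pre (\<eta> \<alpha>))"
    by (rule supp_cong[OF a pre_sets[OF b]])
  have "AE x in M. x \<in> space M - \<alpha> \<longleftrightarrow> x \<in> pre (space N - \<eta> \<alpha>)"
    using \<eta>(2)[OF a] AE_space by eventually_elim (use measurable_space[OF f] in auto)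
  then have s2: "supp M (space M - \<alpha>) = supp M (pre (space N - \<eta> \<alpha>))"
    by (rule supp_cong[OF c pre_sets[OF cb]])
  define G where "G = A (Pr M \<alpha> F)"
  have PF: "Pr M \<alpha> F \<in> L2 M"
    by (rule Pr_L2[OF a F])
  have G: "G \<in> L2 M"
    unfolding G_def by (rule bounded_opsD(1)[OF A PF])
  note PG = Pr_L2[OF a G] and QG = Pr_L2[OF c G]
  have "compose (L2 M) T A (Pr M \<alpha> F) \<in> supp N (\<eta> \<alpha>)"
    by (rule U_maps[OF mult[OF T] b]) (use F s1 in blast)
  then have 1: "T G \<in> supp N (\<eta> \<alpha>)"
    using PF by (simp add: compose_def G_def)
  have 2: "T (Pr M \<alpha> G) \<in> supp N (\<eta> \<alpha>)"
    by (rule U_maps[OF T b]) (use G s1 in blast)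
  have 3: "T (Pr M (space M - \<alpha>) G) \<in> supp N (space N - \<eta> \<alpha>)"
    by (rule U_maps[OF T cb]) (use G s2 in blast)
  have "Pr M (space M - \<alpha>) G = l2_diff M G (Pr M \<alpha> G)"
    using fun_cong[OF Pr_compl[OF a], of G] G by (simp add: proj_compl_def)
  then have "T (Pr M (space M - \<alpha>) G) = l2_diff N (T G) (T (Pr M \<alpha> G))"
    using bounded_opsD(4)[OF Tb G PG] by simp
  then have "T (Pr M (space M - \<alpha>) G) \<in> supp N (\<eta> \<alpha>)"
    using csubD(5)[OF proj_range_csub[OF Pr_projection[OF b]] 1 2] by simp
  then have "T (Pr M (space M - \<alpha>) G) = l2_zero N"
    by (rule supp_disjoint[OF b _ 3])
  then show "Pr M (space M - \<alpha>) (A (Pr M \<alpha> F)) = l2_zero M"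
    unfolding G_def[symmetric] by (rule inj[OF QG])
qed

text \<open>For \<open>S\<close> in \<open>U\<close> the part of \<open>S F\<close> on \<open>\<beta>\<close> is \<open>S\<close> applied to the part of \<open>F\<close> on the preimage of \<open>\<beta>\<close>.
  So a left multiplier \<open>B\<close> maps it to a function supported on \<open>\<beta>\<close>, and the ranges of \<open>U\<close> are total.\<close>

lemma left_multiplier_masa:
  assumes B: "B \<in> bounded_ops N N" and mult: "\<And>T. T \<in> U \<Longrightarrow> compose (L2 M) B T \<in> U"
  shows "B \<in> mult_masa N"
proof (rule masa_if_off_diagonal_zero[OF sigma_finite_N B])
  fix \<beta> G assume b: "\<beta> \<in> sets N" and G: "G \<in> L2 N"
  note cb = sets.compl_sets[OF b] and p = pre_sets[OF b]
  let ?C = "compose (L2 N) (Pr N (space N - \<beta>)) (compose (L2 N) B (Pr N \<beta>))"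
  have C: "?C \<in> bounded_ops N N"
    by (rule compose_in[OF Pr_in[OF cb] compose_in[OF B Pr_in[OF b]]])
  have "{G \<in> L2 N. ?C G \<in> {l2_zero N}} = L2 N"
  proof (rule range_total[OF csub_preimage[OF C csub_zero]])
    fix S F assume S: "S \<in> U" and F: "F \<in> L2 M"
    note SF = U_L2[OF S F] and PF = Pr_L2[OF p F]
    have eq: "Pr N \<beta> (S F) = S (Pr M (pre \<beta>) F)"
    proof -
      have "pre (space N - \<beta>) = space M - pre \<beta>"
        using measurable_space[OF f] by auto
      then have "S (Pr M (space M - pre \<beta>) F) \<in> supp N (space N - \<beta>)"
        using U_maps[OF S cb, of "Pr M (space M - pre \<beta>) F"] F by simp
      then have "Pr N \<beta> (S (Pr M (space M - pre \<beta>) F)) = l2_zero N"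
        using Pr_zero_iff_compl_range[OF b U_L2[OF S Pr_L2[OF sets.compl_sets[OF p] F]]] by blast
      then have "compose (L2 M) (Pr N \<beta>) S (Pr M (space M - pre \<beta>) F) = l2_zero N"
        using Pr_L2[OF sets.compl_sets[OF p] F] by (simp add: compose_def)
      from op_Pr_absorb[OF compose_in[OF Pr_in[OF b] U_bounded[OF S]] p F this]
      have "Pr N \<beta> (S F) = Pr N \<beta> (S (Pr M (pre \<beta>) F))"
        using F PF by (simp add: compose_def)
      also have "\<dots> = S (Pr M (pre \<beta>) F)"
        by (rule Pr_range_fixed[OF b U_maps[OF S b]]) (use F in blast)
      finally show ?thesis .
    qed
    have "compose (L2 M) B S (Pr M (pre \<beta>) F) \<in> supp N \<beta>"
      by (rule U_maps[OF mult[OF S] b]) (use F in blast)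
    then have in_b: "B (Pr N \<beta> (S F)) \<in> supp N \<beta>"
      using PF by (simp add: compose_def eq)
    have dd: "space N - (space N - \<beta>) = \<beta>"
      using sets.sets_into_space[OF b] by auto
    have "Pr N (space N - \<beta>) (B (Pr N \<beta> (S F))) = l2_zero N"
      using Pr_zero_iff_compl_range[OF cb bounded_opsD(1)[OF B Pr_L2[OF b SF]]] in_b by (simp only: dd)
    then show "S F \<in> {G \<in> L2 N. ?C G \<in> {l2_zero N}}"
      using SF by (simp add: compose_def)
  qed
  then have "?C G = l2_zero N"
    using G by blast
  then show "Pr N (space N - \<beta>) (B (Pr N \<beta> G)) = l2_zero N"
    using G by (simp add: compose_def)
qed

lemma thin_U: "thin M N U"
  unfolding thin_def
proof (intro conjI bimodule reflexive_U)
  show "{A \<in> bounded_ops M M. \<forall>T\<in>U. compose (L2 M) T A \<in> U} = mult_masa M"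
    using right_multiplier_masa by (intro equalityI mult_masa_in(1)) blast
  show "{B \<in> bounded_ops N N. \<forall>T\<in>U. compose (L2 M) B T \<in> U} = mult_masa N"
    using left_multiplier_masa by (intro equalityI mult_masa_in(2)) blast
qed

end

section \<open>The characterization of thin normalizing bimodules\<close>

text \<open>An almost onto map from an empty space forces the codomain to be null, so that there are no
  nonzero vectors on either side.\<close>

lemma (in normalizing) empty_domain_degenerate:
  assumes "space M = {}" and "almost_onto M N f"
  shows "degenerate M N U"
proof -
  have M0: "AE x in M. False"
    using AE_space by eventually_elim (simp add: assms(1))
  obtain B where "B \<in> null_sets N" "space N - f ` (space M - {}) \<subseteq> B"
    using assms(2) unfolding almost_onto_def by blast
  then have "B \<in> null_sets N" "space N \<subseteq> B"
    using assms(1) by simp_all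
  from AE_not_in[OF this(1)] AE_space have N0: "AE y in N. False"
    by eventually_elim (use \<open>space N \<subseteq> B\<close> in blast)
  have "S F = l2_zero N" if "S \<in> U" "F \<in> L2 M" for S F
    by (rule L2_eqI[OF U_L2[OF that] zero_in]) (use N0 in eventually_elim, simp)
  then have "U = {op_zero M N}"
    using U_trivial_iff by blast
  then show ?thesis
    using trivial_bounded_ops[OF M0] trivial_bounded_ops[OF N0] by (simp add: degenerate_def)
qed

theorem theorem3p7:
  fixes M :: "'x measure" and N :: "'y measure" and U :: "('x, 'y) oper set"
  assumes "standard_measure_space M" and "standard_measure_space N"
    and "normalizing_bimodule M N U"
    and "\<not> degenerate M N U"
  shows "thin M N U \<longleftrightarrow>
    (\<exists>f\<in>measurable M N. almost_one_to_one M f \<and> almost_onto M N f \<and>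
       preserves_null_sets M N f \<and> U = M_max M N {(x, f x) | x. x \<in> space M})"
proof -
  interpret normalizing M N U
    using assms(1-3) by (rule normalizing.intro)
  show ?thesis
  proof
    assume "thin M N U"
    then interpret thin_normalizing M N U
      using assms(4) by unfold_locales
    show "\<exists>f\<in>measurable M N. almost_one_to_one M f \<and> almost_onto M N f \<and>
        preserves_null_sets M N f \<and> U = M_max M N {(x, f x) | x. x \<in> space M}"
      by (rule supported_on_graph)
  next
    assume "\<exists>f\<in>measurable M N. almost_one_to_one M f \<and> almost_onto M N f \<and>
        preserves_null_sets M N f \<and> U = M_max M N {(x, f x) | x. x \<in> space M}"
    then obtain f where f: "f \<in> measurable M N" "almost_one_to_one M f" "almost_onto M N f"
        "preserves_null_sets M N f" "U = M_max M N {(x, f x) | x. x \<in> space M}"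
      by blast
    have "space M \<noteq> {}"
      using empty_domain_degenerate[OF _ f(3)] assms(4) by blast
    with f interpret graph_bimodule M N U f
      by unfold_locales
    show "thin M N U"
      by (rule thin_U)
  qed
qed

end
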